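(* Let $n,m$ be integers with $2\le m\le\lfloor n/2\rfloor$, and consider the set $\mathbb{U}(n,m)$ of unicyclic graphs with $n$ vertices and matching number $m$. In each case below, the listed graphs are (up to isomorphism) exactly the graphs attaining the minimum Kirchhoff index in $\mathbb{U}(n,m)$, and the minimum value is as indicated. (i) $m=2$: $C_n$ for $n=4,5$, with value $\frac{n^3-n}{12}$; $U(4,1,n-5,0)$ for $6\le n\le 11$, with value $\frac12(2n^2-5n-2)$; $U(3,1,8,0)$ and $U(4,1,7,0)$ for $n=12$, with value $113$; $U(3,1,n-4,0)$ for $n\ge 13$, with value $\frac13(3n^2-8n+3)$. (ii) $m=3$: $C_n$ for $n=6,7$, with value $\frac{n^3-n}{12}$; $U_{n,3}$ for $n\ge 8$, with value $n^2-2n-5$. (iii) $m=4$: $C_8$ for $n=8$, with value $42$; $U(7,1,1,0)$ and $C_9$ for $n=9$, with value $60$; $U(7,1,2,0)$ for $n=10$, with value $79$; $U(6,2,3,0)$ and $U(7,1,3,0)$ for $n=11$, with value $100$; $U(6,2,n-8,0)$ for $n=12,13$, with value $\frac13(3n^2-n-52)$; $U_{14,4}$ and $U(6,2,6,0)$ for $n=14$, with value $174$; $U_{n,4}$ for $n\ge 15$, with value $n^2-n-8$. (iv) $m=5$: $U(8,2)$ for $n=10$, with value $81\frac78$; $U(7,3,n-10,0)$ for $11\le n\le 13$, with value $\frac17(7n^2+12n-245)$; $U_{14,5}$, $U(6,2,4,1)$ and $U(7,3,4,0)$ for $n=14$, with value $185$; $U_{n,5}$ for $n\ge 15$, with value $n^2-11$.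 (v) $m=6$: $U(8,4,n-12,0)$ for $n=12,13$, with value $\frac14(4n^2+19n-262)$; $U_{14,6}$, $U(6,2,2,2)$ and $U(7,3,2,1)$ for $n=14$, with value $196$; $U_{n,6}$ for $n\ge 15$, with value $n^2+n-14$. (vi) $m=7$: $U(7,7)$ for $n=14$, with value $203$; $U_{n,7}$ for $n\ge 15$, with value $n^2+2n-17$. (vii) $m\ge 8$: $U_{n,m}$ for $n\ge 16$, with value $n^2+nm-5n-3m+4$.
   Context: Graphs are finite and simple. For a connected graph $G$, $r_G(u,v)$ is the resistance distance: the effective resistance between $u$ and $v$ in the electrical network obtained from $G$ by replacing each edge by a unit resistor. The Kirchhoff index is $Kf(G)=\sum_{\{u,v\}\subseteq V(G)} r_G(u,v)$. A unicyclic graph is a connected graph with exactly one cycle. The matching number is the number of edges in a maximum matching. $C_n$ is the cycle on $n$ vertices. For integers $k\ge 3$, $1\le t\le k$, $i,j\ge 0$, the graph $U(k,t,i,j)$ (with $k+t+i+2j$ vertices) is obtained from the cycle $C_k$ as follows: choose $t$ consecutive vertices of $C_k$; attach one pendent vertex to each of the $t$ chosen vertices; then attach $i$ further pendent vertices and $j$ paths on two vertices (each joined by an edge from one of its end vertices) to a central vertex of the $t$ chosen consecutive vertices (for $t$ even, either of the two middle ones). Write $U(k,t)=U(k,t,0,0)$. For $3\le m\le\lfloor n/2\rfloor$, $U_{n,m}=U(5,1,n-2m,m-3)$. *)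

theory Defs
  imports Complex_Main "HOL-Library.Disjoint_Sets"
begin

text \<open>A graph is a pair of a vertex set and a set of edges, the edges being two-element
  sets of vertices.\<close>

type_synonym 'a graph = "'a set \<times> 'a set set"

abbreviation verts :: "'a graph \<Rightarrow> 'a set" where "verts \<equiv> fst"
abbreviation edges :: "'a graph \<Rightarrow> 'a set set" where "edges \<equiv> snd"

definition simple_graph :: "'a graph \<Rightarrow> bool" where
  "simple_graph G \<longleftrightarrow> finite (verts G) \<and> (\<forall>e\<in>edges G. e \<subseteq> verts G \<and> card e = 2)"

definition graph_iso :: "'a graph \<Rightarrow> 'b graph \<Rightarrow> bool" (infix "\<simeq>\<^sub>g" 50) where
  "G \<simeq>\<^sub>g H \<longleftrightarrow>
     (\<exists>f. bij_betw f (verts G) (verts H) \<and> edges H = (\<lambda>e. f ` e) ` edges G)"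

definition subgraph :: "'a graph \<Rightarrow> 'a graph \<Rightarrow> bool" where
  "subgraph H G \<longleftrightarrow> simple_graph H \<and> verts H \<subseteq> verts G \<and> edges H \<subseteq> edges G"

definition connected_graph :: "'a graph \<Rightarrow> bool" where
  "connected_graph G \<longleftrightarrow>
     verts G \<noteq> {} \<and> (\<forall>u\<in>verts G. \<forall>v\<in>verts G. (u, v) \<in> {(x, y). {x, y} \<in> edges G}\<^sup>*)"

definition matching :: "'a graph \<Rightarrow> 'a set set \<Rightarrow> bool" where
  "matching G M \<longleftrightarrow> M \<subseteq> edges G \<and> disjoint M"

definition matching_number :: "'a graph \<Rightarrow> nat" where
  "matching_number G = Max (card ` {M. matching G M})"

definition cycle_graph :: "nat \<Rightarrow> nat graph" where
  "cycle_graph n = ({..<n}, {{x, (x + 1) mod n} | x. x < n})"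

definition unicyclic :: "'a graph \<Rightarrow> bool" where
  "unicyclic G \<longleftrightarrow> simple_graph G \<and> connected_graph G \<and>
     (\<exists>!H. subgraph H G \<and> (\<exists>k\<ge>3. H \<simeq>\<^sub>g cycle_graph k))"

definition unicyclic_graphs :: "nat \<Rightarrow> nat \<Rightarrow> 'a graph set" where
  "unicyclic_graphs n m =
     {G. unicyclic G \<and> card (verts G) = n \<and> matching_number G = m}"


text \<open>Every edge is a unit resistor, so by Ohm's law the current from \<open>x\<close> to \<open>y\<close> along an edge
  is \<open>\<phi> x - \<phi> y\<close>. By Kirchhoff's current law \<open>\<phi>\<close> is a potential for a unit current entering
  at \<open>u\<close> and leaving at \<open>v\<close> iff the net outflow at every vertex equals the injected current.\<close>

definition unit_current_potential :: "'a graph \<Rightarrow> 'a \<Rightarrow> 'a \<Rightarrow> ('a \<Rightarrow> real) \<Rightarrow> bool" where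
  "unit_current_potential G u v \<phi> \<longleftrightarrow>
     (\<forall>x\<in>verts G. (\<Sum>y | {x, y} \<in> edges G. \<phi> x - \<phi> y) = of_bool (x = u) - of_bool (x = v))"

text \<open>On a finite connected graph the potential exists and is unique up to an additive constant,
  so the description operator is applied to a uniquely determined number.\<close>

definition resistance :: "'a graph \<Rightarrow> 'a \<Rightarrow> 'a \<Rightarrow> real" where
  "resistance G u v = (THE r. \<exists>\<phi>. unit_current_potential G u v \<phi> \<and> r = \<phi> u - \<phi> v)"

lemma resistance_commute: "resistance G u v = resistance G v u"
proof -
  have *: "\<exists>\<phi>. unit_current_potential G b a \<phi> \<and> r = \<phi> b - \<phi> a"
    if "unit_current_potential G a b \<phi>" "r = \<phi> a - \<phi> b" for a b r \<phi>
  proof (intro exI conjI)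
    have "(\<Sum>y | {x, y} \<in> edges G. - \<phi> x - - \<phi> y) = - (\<Sum>y | {x, y} \<in> edges G. \<phi> x - \<phi> y)" for x
      by (simp add: sum_negf [symmetric])
    then show "unit_current_potential G b a (\<lambda>x. - \<phi> x)"
      using that(1) by (simp add: unit_current_potential_def)
  qed (use that(2) in simp)
  show ?thesis
    unfolding resistance_def by (rule arg_cong [where f = The], rule ext) (use * in blast)
qed

text \<open>The sum runs over ordered pairs of distinct vertices, hence the factor one half.\<close>

definition Kirchhoff_index :: "'a graph \<Rightarrow> real" where
  "Kirchhoff_index G = (\<Sum>u\<in>verts G. \<Sum>v\<in>verts G - {u}. resistance G u v) / 2"


text \<open>In \<open>U_centre c k t i j\<close> the cycle is \<open>0, \<dots>, k - 1\<close>, the chosen consecutive vertices are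
  \<open>0, \<dots>, t - 1\<close>, and \<open>k + s\<close> is the pendent vertex at \<open>s < t\<close>. The \<open>i\<close> further pendent
  vertices at \<open>c\<close> follow, and then the vertices of the \<open>j\<close> attached paths, two by two.\<close>

definition U_centre :: "nat \<Rightarrow> nat \<Rightarrow> nat \<Rightarrow> nat \<Rightarrow> nat \<Rightarrow> nat graph" where
  "U_centre c k t i j =
     ({..<k + t + i + 2 * j},
      edges (cycle_graph k)
      \<union> {{s, k + s} | s. s < t}
      \<union> {{c, k + t + a} | a. a < i}
      \<union> {{c, k + t + i + 2 * b} | b. b < j}
      \<union> {{k + t + i + 2 * b, k + t + i + 2 * b + 1} | b. b < j})"

text \<open>For odd \<open>t\<close> the centre \<open>(t - 1) div 2\<close> is the unique middle vertex; for even \<open>t\<close> it is one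
  of the two, the other being \<open>t div 2\<close> (see \<open>U_other_centre\<close> below).\<close>

definition U :: "nat \<Rightarrow> nat \<Rightarrow> nat \<Rightarrow> nat \<Rightarrow> nat graph" where
  "U k t i j = U_centre ((t - 1) div 2) k t i j"

lemma U_other_centre:
  assumes "3 \<le> k" "1 \<le> t" "t \<le> k"
  shows "U k t i j \<simeq>\<^sub>g U_centre (t div 2) k t i j"
proof -
  define c where "c = (t - 1) div 2"
  define f where "f x = (if x < t then t - 1 - x else if x < k then k + t - 1 - x
                         else if x < k + t then k + (k + t - 1 - x) else x)" for x
  define F where "F = (\<lambda>A. (\<lambda>e. f ` e) ` A)"
  have c: "c < t" "f c = t div 2"
    using assms unfolding c_def f_def by auto
  have inv: "f (f x) = x" for x
    using assms unfolding f_def by auto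
  have F_inv: "F (F A) = A" for A
    by (simp add: F_def image_image inv)
  have lt: "f x < k + t + i + 2 * j \<longleftrightarrow> x < k + t + i + 2 * j" for x
    using assms unfolding f_def by auto
  have bij: "bij_betw f {..<k + t + i + 2 * j} {..<k + t + i + 2 * j}"
    by (rule bij_betwI [where g = f]) (auto simp: inv lt)
  have F_family: "F {g a | a. a < n} = {f ` g a | a. a < n}" for g and n :: nat
    unfolding F_def by blast
  have high: "f x = x" if "k + t \<le> x" for x
    using that assms unfolding f_def by auto
  have low: "f s = t - 1 - s" "f (k + s) = k + (t - 1 - s)" if "s < t" for s
    using that assms unfolding f_def by auto
  have cyc_le: "F (edges (cycle_graph k)) \<subseteq> edges (cycle_graph k)"
  proof -
    have "\<exists>y<k. {f x, f ((x + 1) mod k)} = {y, (y + 1) mod k}" if x: "x < k" for x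
    proof (intro exI conjI)
      show y: "f ((x + 1) mod k) < k"
        using assms mod_less_divisor [of k "x + 1"] unfolding f_def by auto
      have "(f ((x + 1) mod k) + 1) mod k =
            (if f ((x + 1) mod k) + 1 = k then 0 else f ((x + 1) mod k) + 1)"
        using y by auto
      moreover have "(x + 1) mod k = (if x + 1 = k then 0 else x + 1)"
        using x by auto
      ultimately have "f x = (f ((x + 1) mod k) + 1) mod k"
        using assms x unfolding f_def by (simp split: if_splits; linarith)
      then show "{f x, f ((x + 1) mod k)} = {f ((x + 1) mod k), (f ((x + 1) mod k) + 1) mod k}"
        by auto
    qed
    then have "f ` {x, (x + 1) mod k} \<in> edges (cycle_graph k)" if "x < k" for x
      using that unfolding cycle_graph_def image_insert image_empty snd_conv by blast
    then show ?thesis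
      unfolding F_def by (subst cycle_graph_def) (auto simp del: image_insert)
  qed
  moreover have "F A \<subseteq> F B" if "A \<subseteq> B" for A B
    using that by (auto simp: F_def)
  ultimately have cyc: "F (edges (cycle_graph k)) = edges (cycle_graph k)"
    by (metis F_inv subset_antisym)
  have pend: "F {{s, k + s} | s. s < t} = {{s, k + s} | s. s < t}"
  proof -
    have "f ` {s, k + s} = {t - 1 - s, k + (t - 1 - s)}" if "s < t" for s
      using low [OF that] by simp
    then have "F {{s, k + s} | s. s < t} = {{t - 1 - s, k + (t - 1 - s)} | s. s < t}"
      unfolding F_family by (intro Collect_cong ex_cong1) metis
    also have "\<dots> = {{s, k + s} | s. s < t}"
    proof (intro equalityI subsetI)
      fix e assume "e \<in> {{s, k + s} | s. s < t}"
      then obtain s where "s < t" "e = {s, k + s}" by blast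
      then have "t - 1 - s < t" "e = {t - 1 - (t - 1 - s), k + (t - 1 - (t - 1 - s))}" by auto
      then show "e \<in> {{t - 1 - s, k + (t - 1 - s)} | s. s < t}" by blast
    next
      fix e assume "e \<in> {{t - 1 - s, k + (t - 1 - s)} | s. s < t}"
      then obtain s where "s < t" "e = {t - 1 - s, k + (t - 1 - s)}" by blast
      moreover from this have "t - 1 - s < t" by simp
      ultimately show "e \<in> {{s, k + s} | s. s < t}" by blast
    qed
    finally show ?thesis .
  qed
  have F_Un: "F (A \<union> B) = F A \<union> F B" for A B
    by (simp add: F_def image_Un)
  have "F (edges (U_centre c k t i j)) = edges (U_centre (t div 2) k t i j)"
    by (simp add: U_centre_def F_Un cyc pend F_family high c)
  with bij show ?thesis
    unfolding graph_iso_def U_def c_def [symmetric] F_def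
    by (intro exI [of _ f]) (simp add: U_centre_def)
qed

definition U_nm :: "nat \<Rightarrow> nat \<Rightarrow> nat graph" where
  "U_nm n m = U 5 1 (n - 2 * m) (m - 3)"


text \<open>Up to isomorphism, the graphs in \<open>Ls\<close> are exactly the graphs in the class \<open>\<G>\<close> that
  minimise the Kirchhoff index over \<open>\<G>\<close>, and the minimum is \<open>x\<close>. The members of \<open>\<G>\<close> may have
  vertices of any type.\<close>

definition Kirchhoff_minimisers :: "'a graph set \<Rightarrow> nat graph set \<Rightarrow> real \<Rightarrow> bool" where
  "Kirchhoff_minimisers \<G> Ls x \<longleftrightarrow>
     {G \<in> \<G>. \<forall>H\<in>\<G>. Kirchhoff_index G \<le> Kirchhoff_index H}
       = {G. simple_graph G \<and> (\<exists>L\<in>Ls. G \<simeq>\<^sub>g L)}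
     \<and> (\<forall>L\<in>Ls. Kirchhoff_index L = x)"

end

theory Submission
  imports Defs
begin

text \<open>Let \<open>G\<close> be unicyclic with \<open>n\<close> vertices and a cycle of length \<open>k\<close>, and let \<open>b t\<close> be the number of
  descendants of a non-cycle vertex \<open>t\<close>. Solving Kirchhoff's equations explicitly gives
  \<open>Kf(G) = \<Sum>\<^sub>t b t (n - b t) + \<Sum>\<^bsub>i<j\<^esub> n\<^sub>i n\<^sub>j r\<^sub>i\<^sub>j\<close>, where \<open>n\<^sub>i\<close> is the size of the tree at the cycle vertex \<open>i\<close>
  and \<open>r\<^sub>i\<^sub>j = d (k - d) / k\<close> for vertices at distance \<open>d\<close> on the cycle. With \<open>n\<^sub>i = 1 + x\<^sub>i\<close> the second sum is
  \<open>(k\<^sup>3 - k) / 12 + (n - k) (k\<^sup>2 - 1) / 6 + \<Sum>\<^bsub>i<j\<^esub> x\<^sub>i x\<^sub>j r\<^sub>i\<^sub>j\<close>.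

  Let \<open>s\<close> be the number of non-trivial trees and \<open>q\<close> the number of non-pendent bridges. The first sum
  is at least \<open>(n - k) (n - 1) + q (n - 3)\<close>, the last one is least when the \<open>s\<close> trees sit at consecutive
  vertices and all but the middle one are single pendent vertices, and a vertex cover argument
  gives \<open>2 m \<le> 2 q + k + s\<close>. The resulting lower bound depends on \<open>n, k, s, q\<close> only. For \<open>n \<ge> 15\<close> its excess
  over the claimed minimum is linear in \<open>n\<close> and independent of \<open>m\<close>, once \<open>q\<close> is eliminated; finitely
  many triples \<open>(k, s, q)\<close> remain for smaller \<open>n\<close>. Equality in all the estimates forces the shape
  \<open>U k s i q\<close>.\<close>

section \<open>Resistance distances in a cycle with trees attached\<close>

text \<open>None of the estimates is sharp for arbitrary parameters; each only has to be sharp where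
  a minimiser sits. In a set \<open>S\<close> of tree positions a vertex has at most two cyclic
  neighbours, and every further member is charged as if it were at distance two. \<open>S\<close> is
  bounded through its rows and, independently, through its complement. For three positions on a
  7-cycle and four on an 8-cycle neither bound is attained, so these two values come from an
  enumeration of all subsets; so does the fact that sets of minimal cost are consecutive, for the
  four shapes with 1 < s < k that occur. The vertex cover serves twice. It bounds \<open>q\<close>
  from below, and where it is tight it forces a pendent vertex at every occupied cycle vertex. A
  central tree made of two-vertex paths only would meet the same lower bound without having the
  required shape, so this leaf at the centre is essential. The cycle without trees lies outside the
  estimate and is compared separately.\<close>

lemma harmonic_constant:
  fixes \<delta> :: "'a \<Rightarrow> real"
  assumes "simple_graph G" "connected_graph G"
    and harm: "\<And>x. x \<in> verts G \<Longrightarrow> (\<Sum>y | {x, y} \<in> edges G. \<delta> x - \<delta> y) = 0"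
    and "u \<in> verts G" "w \<in> verts G"
  shows "\<delta> u = \<delta> w"
proof -
  have fin: "finite (verts G)" and edge: "{x, y} \<in> edges G \<Longrightarrow> y \<in> verts G" for x y
    using assms(1) by (auto simp: simple_graph_def)
  define M where "M = Max (\<delta> ` verts G)"
  have le: "\<delta> x \<le> M" if "x \<in> verts G" for x
    using that fin by (auto simp: M_def)
  have "M \<in> \<delta> ` verts G"
    unfolding M_def using fin assms(4) by (intro Max_in) auto
  then obtain a where a: "a \<in> verts G" "\<delta> a = M" by auto
  \<comment> \<open>Maximum principle: at a maximum the differences to the neighbours are
    nonnegative and sum to zero, so all of them vanish and the maximum spreads along edges.\<close>
  have *: "\<delta> y = M" if "(a, y) \<in> {(x, y). {x, y} \<in> edges G}\<^sup>*" for y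
    using that
  proof (induction rule: rtrancl_induct)
    case base
    then show ?case by (rule a)
  next
    case (step y z)
    have y: "y \<in> verts G" and z: "{y, z} \<in> edges G"
      using step(2) edge[of z y] by (auto simp: insert_commute)
    have fy: "finite {z. {y, z} \<in> edges G}"
      by (rule finite_subset[OF _ fin]) (auto dest: edge)
    have "\<forall>z\<in>{z. {y, z} \<in> edges G}. \<delta> y - \<delta> z = 0"
      using harm[OF y] fy step.IH by (subst (asm) sum_nonneg_eq_0_iff) (auto dest: edge le)
    then show ?case using z step.IH by simp
  qed
  show ?thesis
    using * a assms(2,4,5) by (metis connected_graph_def)
qed

text \<open>The difference of two potentials for the same current is harmonic, hence constant. One
  explicit potential therefore suffices to evaluate the description operator.\<close>

lemma resistance_eqI:
  assumes "simple_graph G" "connected_graph G" "u \<in> verts G" "w \<in> verts G"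
    and \<phi>: "unit_current_potential G u w \<phi>"
  shows "resistance G u w = \<phi> u - \<phi> w"
  unfolding resistance_def
proof (rule the_equality)
  show "\<exists>\<phi>'. unit_current_potential G u w \<phi>' \<and> \<phi> u - \<phi> w = \<phi>' u - \<phi>' w"
    using \<phi> by blast
next
  fix r assume "\<exists>\<phi>'. unit_current_potential G u w \<phi>' \<and> r = \<phi>' u - \<phi>' w"
  then obtain \<phi>' where \<phi>': "unit_current_potential G u w \<phi>'" and r: "r = \<phi>' u - \<phi>' w"
    by blast
  have "(\<phi>' u - \<phi> u) = (\<phi>' w - \<phi> w)"
  proof (rule harmonic_constant[OF assms(1,2) _ assms(3,4)])
    fix x assume x: "x \<in> verts G"
    have "(\<Sum>y | {x, y} \<in> edges G. \<phi>' x - \<phi> x - (\<phi>' y - \<phi> y))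
      = (\<Sum>y | {x, y} \<in> edges G. \<phi>' x - \<phi>' y) - (\<Sum>y | {x, y} \<in> edges G. \<phi> x - \<phi> y)"
      by (simp add: sum_subtractf[symmetric] algebra_simps)
    also have "\<dots> = 0"
      using \<phi> \<phi>' x by (simp add: unit_current_potential_def)
    finally show "(\<Sum>y | {x, y} \<in> edges G. \<phi>' x - \<phi> x - (\<phi>' y - \<phi> y)) = 0" .
  qed
  then show "r = \<phi> u - \<phi> w" using r by simp
qed

text \<open>Two arcs of \<open>d\<close> and \<open>k - d\<close> unit resistors in parallel. The
  expression is invariant under exchanging \<open>d\<close> and \<open>k - d\<close>, so
  \<open>|i - j|\<close> may stand for the distance on the cycle.\<close>

definition cycle_resistance :: "nat \<Rightarrow> nat \<Rightarrow> nat \<Rightarrow> real" where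
  "cycle_resistance k i j = \<bar>real i - real j\<bar> * (real k - \<bar>real i - real j\<bar>) / real k"

lemma cycle_resistance_commute: "cycle_resistance k i j = cycle_resistance k j i"
  by (simp add: cycle_resistance_def abs_minus_commute)

lemma cycle_resistance_self [simp]: "cycle_resistance k i i = 0"
  by (simp add: cycle_resistance_def)

text \<open>The second difference of \<open>d * (k - d) / k\<close> is constant, and the kink at
  \<open>i = j\<close> is the source. The constant \<open>2 / k\<close> does not depend on
  \<open>j\<close> and cancels when a source and a sink are combined.\<close>

lemma cycle_resistance_laplacian:
  assumes "3 \<le> k" "i < k" "j < k"
  shows "2 * cycle_resistance k i j - cycle_resistance k ((i + 1) mod k) j
         - cycle_resistance k ((i + k - 1) mod k) j = 2 / k - 2 * of_bool (i = j)"
proof -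
  have nx: "(i + 1) mod k = (if i + 1 = k then 0 else i + 1)"
    using assms by auto
  have pv: "(i + k - 1) mod k = (if i = 0 then k - 1 else i - 1)"
    using assms by (auto simp: mod_if)
  have abs1: "\<bar>real a - real b\<bar> = (if a \<ge> b then real a - real b else real b - real a)" for a b
    by auto
  have k: "real (k - 1) = real k - 1" "real k > 0" "i > 0 \<Longrightarrow> real (i - 1) = real i - 1"
    using assms by (auto simp: of_nat_diff)
  consider "i = 0" | "i + 1 = k" | "i > 0" "i + 1 < k" using assms by linarith
  then show ?thesis
  proof cases
    case 1
    then show ?thesis using assms k unfolding nx pv cycle_resistance_def abs1
      by (auto simp: divide_simps; simp add: algebra_simps)
  next
    case 2
    then have "real i = real k - 1" by linarith
    with 2 show ?thesis using assms k unfolding nx pv cycle_resistance_def abs1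
      by (auto simp: divide_simps; simp add: algebra_simps)
  next
    case 3
    have ineqs: "j \<le> i - 1 \<longleftrightarrow> j < i" "j \<le> i + 1 \<longleftrightarrow> \<not> i + 1 < j" using 3 by auto
    consider "j < i" | "j = i" | "j = i + 1" | "i + 1 < j" by linarith
    then show ?thesis
      using 3 assms k ineqs unfolding nx pv cycle_resistance_def abs1
      by cases (simp_all add: divide_simps, simp_all add: algebra_simps)
  qed
qed

text \<open>The row is cut at \<open>i\<close>: the left part runs through the distances 1 to
  \<open>i\<close>, the right part through 0 to \<open>k - i - 1\<close>; the closed form
  \<open>S\<close> evaluates both.\<close>

lemma sum_cycle_resistance:
  assumes "i < k"
  shows "(\<Sum>j<k. cycle_resistance k i j) = (real k ^ 2 - 1) / 6"
proof -
  have S: "(\<Sum>d<a. real d * (c - real d)) = a * (a - 1) * (3 * c - 2 * a + 1) / 6" for a and c :: real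
    by (induction a) (simp_all add: field_simps)
  define h where "h d = real d * (real k - real d)" for d
  have "(\<Sum>j<k. cycle_resistance k i j) * k = (\<Sum>j<k. \<bar>real i - real j\<bar> * (real k - \<bar>real i - real j\<bar>))"
    using assms by (simp add: cycle_resistance_def sum_divide_distrib[symmetric])
  also have "\<dots> = (\<Sum>j\<in>{..<i} \<union> {i..<k}. \<bar>real i - real j\<bar> * (real k - \<bar>real i - real j\<bar>))"
    using assms by (intro sum.cong) auto
  also have "(\<Sum>j\<in>{..<i} \<union> {i..<k}. \<bar>real i - real j\<bar> * (real k - \<bar>real i - real j\<bar>))
    = (\<Sum>j<i. h (i - j)) + (\<Sum>j=i..<k. h (j - i))"
    by (subst sum.union_disjoint) (auto simp: h_def intro!: arg_cong2[where f="(+)"] sum.cong)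
  also have "(\<Sum>j<i. h (i - j)) = (\<Sum>d<i. h (Suc d))"
    by (rule sum.reindex_bij_witness[of _ "\<lambda>d. i - Suc d" "\<lambda>j. i - Suc j"]) (auto simp: Suc_diff_Suc)
  also have "\<dots> = (\<Sum>d<i+1. h d)"
    by (simp add: sum.lessThan_Suc_shift h_def del: sum.lessThan_Suc)
  also have "(\<Sum>j=i..<k. h (j - i)) = (\<Sum>d<k-i. h d)"
    by (rule sum.reindex_bij_witness[of _ "\<lambda>d. d + i" "\<lambda>j. j - i"]) auto
  also have "(\<Sum>d<i+1. h d) + (\<Sum>d<k-i. h d) = k * ((real k ^ 2 - 1) / 6)"
    unfolding h_def S using assms by (simp add: of_nat_diff field_simps power2_eq_square)
  finally show ?thesis using assms by simp
qed

text \<open>The map \<open>p\<close> sends a vertex off the cycle to its neighbour towards the cycle, and fixes the cycle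
  pointwise.\<close>

locale unicyclic_rep =
  fixes G :: "'a graph" and k :: nat and v :: "nat \<Rightarrow> 'a" and p :: "'a \<Rightarrow> 'a"
  assumes k3: "3 \<le> k" and inj: "inj_on v {..<k}" and fin: "finite (verts G)"
    and cyc_sub: "v ` {..<k} \<subseteq> verts G"
    and p_cyc: "i < k \<Longrightarrow> p (v i) = v i"
    and p_verts: "x \<in> verts G \<Longrightarrow> p x \<in> verts G"
    and reach: "x \<in> verts G \<Longrightarrow> \<exists>j. (p ^^ j) x \<in> v ` {..<k}"
    and edges_eq: "edges G = {{v i, v ((i + 1) mod k)} | i. i < k}
                     \<union> {{x, p x} | x. x \<in> verts G - v ` {..<k}}"
begin

abbreviation "V \<equiv> verts G"
abbreviation "Z \<equiv> v ` {..<k}"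
abbreviation "T \<equiv> V - Z"

definition "dep x = (LEAST j. (p ^^ j) x \<in> Z)"
definition "rt x = (p ^^ dep x) x"
definition "ri x = the_inv_into {..<k} v (rt x)"
text \<open>As \<open>p\<close> fixes the cycle, \<open>D (v i)\<close> is the whole tree hanging at
  \<open>v i\<close>, including \<open>v i\<close>, so one notion serves both bridges and cycle
  vertices.\<close>

definition "D t = {u \<in> V. \<exists>j. (p ^^ j) u = t}"

lemma finT [simp]: "finite T" and finZ [simp]: "finite Z" using fin by auto
lemma finD [simp]: "finite (D t)" using fin by (simp add: D_def)
lemma finite_children [simp]: "finite {y. y \<in> V \<and> y \<notin> Z \<and> p y = x}" using fin by simp
lemma k0: "0 < k" using k3 by simp

lemma p_Z: "z \<in> Z \<Longrightarrow> p z = z" using p_cyc by auto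
lemma p_pow_Z: "z \<in> Z \<Longrightarrow> (p ^^ j) z = z" by (induction j) (auto simp: p_Z)

lemma p_pow_V: "x \<in> V \<Longrightarrow> (p ^^ j) x \<in> V" by (induction j) (auto simp: p_verts)

lemma V_induct [consumes 1, case_names cyc tree]:
  assumes "x \<in> V" "\<And>z. z \<in> Z \<Longrightarrow> P z" "\<And>x. x \<in> T \<Longrightarrow> P (p x) \<Longrightarrow> P x"
  shows "P x"
proof -
  obtain j where "(p ^^ j) x \<in> Z" using reach[OF assms(1)] by blast
  then show ?thesis using assms(1)
  proof (induction j arbitrary: x)
    case (Suc j)
    show ?case
    proof (cases "x \<in> Z")
      case False
      then show ?thesis
        using Suc.IH[of "p x"] Suc.prems p_verts assms(3)[of x] by (simp add: funpow_swap1)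
    qed (use assms(2) in auto)
  qed (use assms(2) in auto)
qed

lemma dep_Z: "z \<in> Z \<Longrightarrow> dep z = 0"
  unfolding dep_def by (rule Least_eq_0) auto

lemma dep_T: assumes "x \<in> T" shows "dep x = Suc (dep (p x))"
proof -
  obtain j where "(p ^^ j) x \<in> Z" using reach assms by blast
  then have "dep x = Suc (LEAST j. (p ^^ Suc j) x \<in> Z)"
    unfolding dep_def using assms by (intro Least_Suc) auto
  then show ?thesis by (simp add: dep_def funpow_swap1)
qed

lemma root_Z: "z \<in> Z \<Longrightarrow> rt z = z" by (simp add: rt_def dep_Z)
lemma root_T: "x \<in> T \<Longrightarrow> rt x = rt (p x)"
  unfolding rt_def by (simp only: dep_T) (simp add: funpow_swap1)
lemma root_in: "x \<in> V \<Longrightarrow> rt x \<in> Z"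
  by (induction x rule: V_induct) (simp_all add: root_Z root_T)

lemma ri_less: "x \<in> V \<Longrightarrow> ri x < k" and v_ri: "x \<in> V \<Longrightarrow> v (ri x) = rt x"
  using root_in[of x] the_inv_into_into[OF inj, of "rt x" "{..<k}"] f_the_inv_into_f[OF inj, of "rt x"]
  by (auto simp: ri_def)

lemma v_V: "i < k \<Longrightarrow> v i \<in> V" using cyc_sub by auto
lemma v_eq: "i < k \<Longrightarrow> j < k \<Longrightarrow> v i = v j \<longleftrightarrow> i = j" using inj by (auto simp: inj_on_def)

lemma ri_v: "i < k \<Longrightarrow> ri (v i) = i"
  using v_ri[of "v i"] ri_less[of "v i"] by (auto simp: v_V root_Z v_eq)
lemma ri_p: "x \<in> V \<Longrightarrow> ri (p x) = ri x"
  by (cases "x \<in> Z") (auto simp: ri_def root_T p_Z)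

lemma D_rec: "u \<in> V \<Longrightarrow> u \<in> D t \<longleftrightarrow> u = t \<or> p u \<in> D t"
proof -
  assume u: "u \<in> V"
  have "(\<exists>j. (p ^^ j) u = t) \<longleftrightarrow> u = t \<or> (\<exists>j. (p ^^ Suc j) u = t)"
    by (metis funpow_0 not0_implies_Suc)
  then show ?thesis using u p_verts by (simp add: D_def funpow_swap1)
qed

lemma D_Z: "z \<in> Z \<Longrightarrow> z \<in> D t \<longleftrightarrow> z = t"
  using cyc_sub by (auto simp: D_def p_pow_Z)

text \<open>Depth excludes that a parent descends from its child; this is the acyclicity of the
  trees.\<close>

lemma D_dep: "u \<in> D t \<Longrightarrow> u = t \<or> dep t < dep u"
proof -
  assume "u \<in> D t"
  then have "u \<in> V" by (simp add: D_def)
  then show ?thesis using \<open>u \<in> D t\<close>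
  proof (induction u rule: V_induct)
    case (cyc z)
    then show ?case by (simp add: D_Z)
  next
    case (tree x)
    then show ?case using D_rec[of x t] dep_T[of x] by auto
  qed
qed

lemma p_notin_D: "t \<in> T \<Longrightarrow> p t \<notin> D t"
  using D_dep[of "p t" t] dep_T[of t] by auto

lemma p_neq: "t \<in> T \<Longrightarrow> p t \<noteq> t" using dep_T[of t] by auto

lemma D_self: "t \<in> V \<Longrightarrow> t \<in> D t" by (auto simp: D_rec)

lemma D_T_sub: "t \<in> T \<Longrightarrow> D t \<subseteq> T"
  using D_Z by (fastforce simp: D_def)

lemma D_root: "z \<in> Z \<Longrightarrow> u \<in> V \<Longrightarrow> u \<in> D z \<longleftrightarrow> rt u = z"
proof (rotate_tac, induction u rule: V_induct)
  case (cyc u)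
  then show ?case by (simp add: D_Z root_Z)
next
  case (tree u)
  then show ?case using D_rec[of u z] root_T[of u] by auto
qed

lemma D_ri: "i < k \<Longrightarrow> u \<in> V \<Longrightarrow> u \<in> D (v i) \<longleftrightarrow> ri u = i"
  using D_root[of "v i" u] v_ri[of u] ri_less[of u] by (metis imageI lessThan_iff v_eq)

text \<open>The two cases exclude each other, as \<open>p u\<close> never descends from
  \<open>u\<close>. So the indicator of \<open>D t\<close> changes along the edge from
  \<open>t\<close> to \<open>p t\<close> only.\<close>

lemma D_step: "u \<in> T \<Longrightarrow> (of_bool (u \<in> D t) :: real) = of_bool (u = t) + of_bool (p u \<in> D t)"
  using D_rec[of u t] p_notin_D[of u] by auto

text \<open>In terms of indicators the equation also says that the descendant sets of the children
  are disjoint.\<close>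

lemma D_children:
  assumes "x \<in> V" "u \<in> V"
  shows "(of_bool (u \<in> D x) :: real)
    = of_bool (u = x) + (\<Sum>y | y \<in> T \<and> p y = x. of_bool (u \<in> D y))"
  using assms(2)
proof (induction u rule: V_induct)
  case (cyc u)
  then show ?case by (auto simp: D_Z intro!: sum.neutral)
next
  case (tree u)
  have "(\<Sum>y | y \<in> T \<and> p y = x. of_bool (u = y)) = (of_bool (p u = x) :: real)"
  proof (cases "p u = x")
    case True
    then have "(\<Sum>y | y \<in> T \<and> p y = x. of_bool (u = y)) = (\<Sum>y\<in>{u}. of_bool (u = y) :: real)"
      using tree by (intro sum.mono_neutral_right) auto
    then show ?thesis using True by simp
  qed (auto intro!: sum.neutral)
  then show ?case using tree by (simp add: D_step sum.distrib)
qed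

lemma simple: "simple_graph G"
proof -
  have "(i + 1) mod k < k" for i using k0 by simp
  moreover have "i \<noteq> (i + 1) mod k" if "i < k" for i
    using that k3 by (cases "i + 1 = k") auto
  ultimately have "card {v i, v ((i + 1) mod k)} = 2" "{v i, v ((i + 1) mod k)} \<subseteq> V" if "i < k" for i
    using that v_eq[of i "(i + 1) mod k"] v_V by (auto simp del: mod_less)
  moreover have "card {x, p x} = 2" "{x, p x} \<subseteq> V" if "x \<in> T" for x
    using that p_neq[of x] p_verts by auto
  ultimately show ?thesis
    unfolding simple_graph_def edges_eq using fin by (auto simp del: mod_less)
qed

lemma tree_edge: "x \<in> T \<Longrightarrow> {x, p x} \<in> edges G"
  unfolding edges_eq by blast
lemma cycle_edge: "i < k \<Longrightarrow> {v i, v ((i + 1) mod k)} \<in> edges G"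
  unfolding edges_eq by blast

lemma connected: "connected_graph G"
proof -
  let ?R = "{(x, y). {x, y} \<in> edges G}\<^sup>*"
  have sym: "sym ?R"
    by (rule sym_rtrancl) (auto simp: sym_def insert_commute)
  have cyc: "(v 0, v i) \<in> ?R" if "i < k" for i
    using that
  proof (induction i)
    case (Suc i)
    then show ?case using cycle_edge[of i]
      by (auto simp: intro: rtrancl.rtrancl_into_rtrancl)
  qed simp
  have "(v 0, x) \<in> ?R" if "x \<in> V" for x
    using that
  proof (induction x rule: V_induct)
    case (cyc z)
    then show ?case using \<open>\<And>i. i < k \<Longrightarrow> (v 0, v i) \<in> ?R\<close> by auto
  next
    case (tree x)
    then show ?case using tree_edge[of x]
      by (auto simp: insert_commute intro: rtrancl.rtrancl_into_rtrancl)
  qed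
  note star = this
  have "(x, y) \<in> ?R" if "x \<in> V" "y \<in> V" for x y
    using rtrancl_trans[OF symD[OF sym star[OF that(1)]] star[OF that(2)]] .
  moreover have "V \<noteq> {}" using v_V[of 0] k0 by blast
  ultimately show ?thesis
    unfolding connected_graph_def by blast
qed

lemma nx_less: "(i + 1) mod k < k" and pv_less: "(i + k - 1) mod k < k" using k0 by simp_all
lemma nx_pv: "i < k \<Longrightarrow> ((i + k - 1) mod k + 1) mod k = i"
  using k3 by (auto simp: mod_if)
lemma pv_nx: "i < k \<Longrightarrow> ((i + 1) mod k + k - 1) mod k = i"
  using k3 by (auto simp: mod_if)
lemma nx_neq_pv: "i < k \<Longrightarrow> (i + 1) mod k \<noteq> (i + k - 1) mod k"
  using k3 by (auto simp: mod_if)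

section \<open>Laplacians and explicit potentials\<close>

lemma neighbours_T:
  assumes "x \<in> T"
  shows "{y. {x, y} \<in> edges G} = insert (p x) {y. y \<in> T \<and> p y = x}"
  using assms v_V nx_less unfolding edges_eq
  by (auto simp: doubleton_eq_iff simp del: mod_less)

lemma neighbours_Z:
  assumes "i < k"
  shows "{y. {v i, y} \<in> edges G}
    = {v ((i + 1) mod k), v ((i + k - 1) mod k)} \<union> {y. y \<in> T \<and> p y = v i}"
proof (intro equalityI subsetI)
  let ?C = "{v ((i + 1) mod k), v ((i + k - 1) mod k)}"
  fix y assume "y \<in> {y. {v i, y} \<in> edges G}"
  then consider j where "{v i, y} = {v j, v ((j + 1) mod k)}" "j < k"
    | x where "{v i, y} = {x, p x}" "x \<in> T"
    unfolding edges_eq by blast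
  then show "y \<in> ?C \<union> {y. y \<in> T \<and> p y = v i}"
  proof cases
    case 1
    then have "y \<in> ?C"
      using assms nx_less[of j] v_eq[of i] pv_nx[of j]
      by (auto simp: doubleton_eq_iff simp del: mod_less)
    then show ?thesis by blast
  next
    case 2
    then show ?thesis using assms by (auto simp: doubleton_eq_iff)
  qed
next
  fix y assume "y \<in> {v ((i + 1) mod k), v ((i + k - 1) mod k)} \<union> {y. y \<in> T \<and> p y = v i}"
  then consider "y = v ((i + 1) mod k)" | "y = v ((i + k - 1) mod k)" | "y \<in> T" "p y = v i" by blast
  then show "y \<in> {y. {v i, y} \<in> edges G}"
  proof cases
    case 1
    then show ?thesis using cycle_edge[OF assms] by simp
  next
    case 2
    then show ?thesis using cycle_edge[OF pv_less[of i]] nx_pv[OF assms]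
      by (simp add: insert_commute del: mod_less)
  next
    case 3
    then show ?thesis using tree_edge[of y] by (simp add: insert_commute)
  qed
qed

lemma laplacian_T:
  fixes \<phi> :: "'a \<Rightarrow> real"
  assumes "x \<in> T"
  shows "(\<Sum>y | {x, y} \<in> edges G. \<phi> x - \<phi> y)
    = (\<phi> x - \<phi> (p x)) - (\<Sum>y | y \<in> T \<and> p y = x. \<phi> y - \<phi> (p y))"
proof -
  have "p x \<notin> {y. y \<in> T \<and> p y = x}"
    using assms D_rec[of "p x" x] p_notin_D[OF assms] D_self[of x] by auto
  then show ?thesis
    unfolding neighbours_T[OF assms]
    by (subst sum.insert) (auto simp: sum_negf[symmetric] intro!: sum.cong)
qed

lemma laplacian_Z:
  fixes \<phi> :: "'a \<Rightarrow> real"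
  assumes "i < k"
  shows "(\<Sum>y | {v i, y} \<in> edges G. \<phi> (v i) - \<phi> y)
    = 2 * \<phi> (v i) - \<phi> (v ((i + 1) mod k)) - \<phi> (v ((i + k - 1) mod k))
      - (\<Sum>y | y \<in> T \<and> p y = v i. \<phi> y - \<phi> (p y))"
proof -
  have "{v ((i + 1) mod k), v ((i + k - 1) mod k)} \<inter> {y. y \<in> T \<and> p y = v i} = {}"
    using nx_less pv_less by auto
  moreover have "v ((i + 1) mod k) \<noteq> v ((i + k - 1) mod k)"
    using v_eq[OF nx_less pv_less] nx_neq_pv[OF assms] by simp
  ultimately show ?thesis
    unfolding neighbours_Z[OF assms]
    by (subst sum.union_disjoint) (auto simp: sum_negf[symmetric] intro!: sum.cong)
qed

text \<open>The indicator function of \<open>D t\<close> has Laplacian \<open>\<delta>\<^sub>t - \<delta>\<^bsub>p t\<^esub>\<close>, so that bridges contribute one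
  unit each for every separated pair.\<close>

lemma resistance_eq:
  assumes u: "u \<in> V" and w: "w \<in> V"
  shows "resistance G u w
    = (\<Sum>t\<in>T. of_bool ((u \<in> D t) \<noteq> (w \<in> D t))) + cycle_resistance k (ri u) (ri w)"
proof -
  \<comment> \<open>\<open>c t\<close> is the current from \<open>t\<close> to \<open>p t\<close>;
    it is nonzero only if exactly one of \<open>u\<close> and \<open>w\<close> lies below
    \<open>t\<close>.\<close>
  define c where "c t = (of_bool (u \<in> D t) - of_bool (w \<in> D t) :: real)" for t
  \<comment> \<open>The Laplacian of \<open>cycle_resistance\<close> has a source of strength -2,
    hence the factor one half and the order sink minus source.\<close>
  define \<psi> where "\<psi> i = (cycle_resistance k i (ri w) - cycle_resistance k i (ri u)) / 2" for i
  define \<phi> where "\<phi> x = (\<Sum>t\<in>T. c t * of_bool (x \<in> D t)) + \<psi> (ri x)" for x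
  have step: "\<phi> y - \<phi> (p y) = c y" if "y \<in> T" for y
  proof -
    have "\<phi> y - \<phi> (p y) = (\<Sum>t\<in>T. c t * of_bool (y = t))"
      using that by (simp add: \<phi>_def ri_p D_step sum.distrib algebra_simps)
    also have "\<dots> = c y"
      using that finT by (subst sum.remove[of _ y]) (auto intro!: sum.neutral)
    finally show ?thesis .
  qed
  have kids: "c x - (\<Sum>y | y \<in> T \<and> p y = x. \<phi> y - \<phi> (p y)) = of_bool (x = u) - of_bool (x = w)"
    if "x \<in> V" for x
  proof -
    have "(\<Sum>y | y \<in> T \<and> p y = x. \<phi> y - \<phi> (p y)) = (\<Sum>y | y \<in> T \<and> p y = x. c y)"
      by (rule sum.cong) (auto simp: step)
    then show ?thesis
      using D_children[OF that u] D_children[OF that w]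
      by (simp add: c_def sum_subtractf eq_commute[of x])
  qed
  have \<phi>_v: "\<phi> (v i) = \<psi> i" if "i < k" for i
    using that D_Z by (auto simp: \<phi>_def ri_v intro!: sum.neutral)
  have "unit_current_potential G u w \<phi>"
    unfolding unit_current_potential_def
  proof
    fix x assume x: "x \<in> V"
    show "(\<Sum>y | {x, y} \<in> edges G. \<phi> x - \<phi> y) = of_bool (x = u) - of_bool (x = w)"
    proof (cases "x \<in> Z")
      case False
      then show ?thesis using laplacian_T[of x \<phi>] kids[OF x] step[of x] x by simp
    next
      case True
      then obtain i where i: "i < k" "x = v i" by auto
      \<comment> \<open>Seen from the cycle, the current enters at the root of \<open>u\<close> and
        leaves at the root of \<open>w\<close>; if the roots agree, nothing flows on the
        cycle.\<close>
      have "2 * \<psi> i - \<psi> ((i + 1) mod k) - \<psi> ((i + k - 1) mod k) = of_bool (i = ri u) - of_bool (i = ri w)"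
        using cycle_resistance_laplacian[OF k3 i(1) ri_less[OF u]]
          cycle_resistance_laplacian[OF k3 i(1) ri_less[OF w]]
        unfolding \<psi>_def by argo
      also have "\<dots> = c x"
        using D_ri[OF i(1) u] D_ri[OF i(1) w] i by (auto simp: c_def)
      finally show ?thesis
        using laplacian_Z[OF i(1), of \<phi>] kids[OF x] \<phi>_v[OF i(1)] \<phi>_v[OF nx_less] \<phi>_v[OF pv_less]
        unfolding i(2) by (simp del: mod_less)
    qed
  qed
  then have "resistance G u w = \<phi> u - \<phi> w"
    by (rule resistance_eqI[OF simple connected u w])
  also have "\<dots> = (\<Sum>t\<in>T. c t * of_bool (u \<in> D t) - c t * of_bool (w \<in> D t)) + (\<psi> (ri u) - \<psi> (ri w))"
    by (simp only: \<phi>_def sum_subtractf)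
  also have "(\<Sum>t\<in>T. c t * of_bool (u \<in> D t) - c t * of_bool (w \<in> D t)) = (\<Sum>t\<in>T. c t * c t)"
    by (simp only: c_def right_diff_distrib)
  \<comment> \<open>\<open>c t\<close> is -1, 0 or 1, so its square is the indicator that the bridge
    separates \<open>u\<close> from \<open>w\<close>.\<close>
  also have "(\<Sum>t\<in>T. c t * c t) = (\<Sum>t\<in>T. of_bool ((u \<in> D t) \<noteq> (w \<in> D t)))"
    by (rule sum.cong) (auto simp: c_def)
  also have "\<psi> (ri u) - \<psi> (ri w) = cycle_resistance k (ri u) (ri w)"
    using cycle_resistance_commute[of k "ri u" "ri w"] by (simp add: \<psi>_def)
  finally show ?thesis .
qed

lemma sum_fibres:
  fixes g :: "nat \<Rightarrow> real"
  shows "(\<Sum>u\<in>V. g (ri u)) = (\<Sum>i<k. real (card (D (v i))) * g i)"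
proof -
  have "(\<Sum>u\<in>V. g (ri u)) = (\<Sum>i<k. \<Sum>u | u \<in> V \<and> ri u = i. g (ri u))"
    using fin ri_less by (intro sum.group[symmetric]) auto
  also have "\<dots> = (\<Sum>i<k. real (card (D (v i))) * g i)"
  proof (rule sum.cong[OF refl])
    fix i assume "i \<in> {..<k}"
    then have "{u. u \<in> V \<and> ri u = i} = D (v i)"
      using D_ri[of i] by (auto simp: D_def)
    then have "(\<Sum>u | u \<in> V \<and> ri u = i. g (ri u)) = (\<Sum>u\<in>D (v i). g i)"
      by (intro sum.cong) auto
    then show "(\<Sum>u | u \<in> V \<and> ri u = i. g (ri u)) = real (card (D (v i))) * g i"
      by simp
  qed
  finally show ?thesis .
qed

lemma Kirchhoff_eq:
  "Kirchhoff_index G = (\<Sum>t\<in>T. real (card (D t)) * (real (card V) - real (card (D t))))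
    + (\<Sum>i<k. \<Sum>j<k. real (card (D (v i))) * real (card (D (v j))) * cycle_resistance k i j) / 2"
proof -
  have "(\<Sum>u\<in>V. \<Sum>w\<in>V - {u}. resistance G u w)
     = (\<Sum>u\<in>V. \<Sum>w\<in>V. (\<Sum>t\<in>T. of_bool ((u \<in> D t) \<noteq> (w \<in> D t))) + cycle_resistance k (ri u) (ri w))"
  proof (rule sum.cong[OF refl])
    fix u assume u: "u \<in> V"
    show "(\<Sum>w\<in>V - {u}. resistance G u w)
      = (\<Sum>w\<in>V. (\<Sum>t\<in>T. of_bool ((u \<in> D t) \<noteq> (w \<in> D t))) + cycle_resistance k (ri u) (ri w))"
      by (subst sum.remove[OF fin u, where g="\<lambda>w. (\<Sum>t\<in>T. of_bool ((u \<in> D t) \<noteq> (w \<in> D t))) + cycle_resistance k (ri u) (ri w)"])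
         (use resistance_eq[OF u] in auto)
  qed
  also have "\<dots> = (\<Sum>u\<in>V. \<Sum>w\<in>V. \<Sum>t\<in>T. of_bool ((u \<in> D t) \<noteq> (w \<in> D t)))
      + (\<Sum>u\<in>V. \<Sum>w\<in>V. cycle_resistance k (ri u) (ri w))"
    by (simp add: sum.distrib)
  also have "(\<Sum>u\<in>V. \<Sum>w\<in>V. \<Sum>t\<in>T. of_bool ((u \<in> D t) \<noteq> (w \<in> D t)))
    = (\<Sum>t\<in>T. \<Sum>u\<in>V. \<Sum>w\<in>V. of_bool ((u \<in> D t) \<noteq> (w \<in> D t)) :: real)"
    by (simp only: sum.swap[of _ T V])
  also have "\<dots> = (\<Sum>t\<in>T. 2 * (real (card (D t)) * (real (card V) - real (card (D t)))))"
  proof (rule sum.cong[OF refl])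
    fix t assume "t \<in> T"
    have DV: "V \<inter> {u. u \<in> D t} = D t" by (auto simp: D_def)
    \<comment> \<open>Exclusive disjunction as \<open>a + b - 2 * a * b\<close>, which makes the
      double sum factorise.\<close>
    have "(\<Sum>u\<in>V. \<Sum>w\<in>V. (of_bool ((u \<in> D t) \<noteq> (w \<in> D t)) :: real))
      = (\<Sum>u\<in>V. \<Sum>w\<in>V. (of_bool (u \<in> D t) + of_bool (w \<in> D t) - 2 * (of_bool (u \<in> D t) * of_bool (w \<in> D t))))"
      by (intro sum.cong refl) auto
    also have "\<dots> = 2 * (\<Sum>u\<in>V. of_bool (u \<in> D t)) * real (card V)
      - 2 * (\<Sum>u\<in>V. of_bool (u \<in> D t)) * (\<Sum>u\<in>V. of_bool (u \<in> D t))"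
      by (simp add: sum.distrib sum_subtractf sum_distrib_left[symmetric] sum_distrib_right[symmetric] algebra_simps)
    also have "(\<Sum>u\<in>V. of_bool (u \<in> D t)) = real (card (D t))"
      using fin DV by (simp add: of_bool_def sum.If_cases)
    finally show "(\<Sum>u\<in>V. \<Sum>w\<in>V. (of_bool ((u \<in> D t) \<noteq> (w \<in> D t)) :: real))
       = 2 * (real (card (D t)) * (real (card V) - real (card (D t))))"
      by (simp add: algebra_simps)
  qed
  also have "(\<Sum>u\<in>V. \<Sum>w\<in>V. cycle_resistance k (ri u) (ri w))
    = (\<Sum>i<k. \<Sum>j<k. real (card (D (v i))) * real (card (D (v j))) * cycle_resistance k i j)"
  proof -
    show ?thesis
      by (subst sum_fibres[of "\<lambda>i. \<Sum>w\<in>V. cycle_resistance k i (ri w)"], subst sum_fibres)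
         (simp add: sum_distrib_left mult.assoc)
  qed
  finally show ?thesis
    by (simp add: Kirchhoff_index_def sum_distrib_left[symmetric])
qed

end

section \<open>Matchings, and the uniqueness of the cycle\<close>

text \<open>An isomorphism is constrained on vertices only, so its inverse recovers an edge only if
  the edge consists of vertices.\<close>

lemma graph_iso_sym:
  assumes "\<Union> (edges G) \<subseteq> verts G" and iso: "G \<simeq>\<^sub>g H"
  shows "H \<simeq>\<^sub>g G"
proof -
  obtain f where f: "bij_betw f (verts G) (verts H)" "edges H = (\<lambda>e. f ` e) ` edges G"
    using iso unfolding graph_iso_def by blast
  define g where "g = the_inv_into (verts G) f"
  have g: "g (f x) = x" if "x \<in> verts G" for x
    using that f(1) by (simp add: g_def bij_betw_def the_inv_into_f_f)
  have "g ` f ` e = e" if "e \<in> edges G" for e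
    using that assms(1) g by (force simp: image_iff)
  then have "(\<lambda>e. g ` e) ` edges H = edges G"
    unfolding f(2) by (simp add: image_image)
  moreover have "bij_betw g (verts H) (verts G)"
    unfolding g_def by (rule bij_betw_the_inv_into[OF f(1)])
  ultimately show ?thesis
    unfolding graph_iso_def by (intro exI[of _ g]) simp
qed

lemma simple_graph_Union: "simple_graph G \<Longrightarrow> \<Union> (edges G) \<subseteq> verts G"
  by (auto simp: simple_graph_def)

lemma graph_iso_trans:
  assumes "G \<simeq>\<^sub>g H" "H \<simeq>\<^sub>g K" shows "G \<simeq>\<^sub>g K"
proof -
  obtain f where f: "bij_betw f (verts G) (verts H)" "edges H = (\<lambda>e. f ` e) ` edges G"
    using assms(1) unfolding graph_iso_def by blast
  obtain g where g: "bij_betw g (verts H) (verts K)" "edges K = (\<lambda>e. g ` e) ` edges H"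
    using assms(2) unfolding graph_iso_def by blast
  have "edges K = (\<lambda>e. (g \<circ> f) ` e) ` edges G"
    unfolding g(2) f(2) by (simp add: image_comp)
  with bij_betw_trans[OF f(1) g(1)] show ?thesis
    unfolding graph_iso_def by (intro exI[of _ "g \<circ> f"]) simp
qed

lemma finite_matchings: "simple_graph G \<Longrightarrow> finite {M. matching G M}"
proof -
  assume "simple_graph G"
  then have "finite (edges G)"
    by (intro finite_subset[of "edges G" "Pow (verts G)"]) (auto simp: simple_graph_def)
  then show ?thesis
    by (intro finite_subset[of "{M. matching G M}" "Pow (edges G)"]) (auto simp: matching_def)
qed

lemma matching_number_le:
  assumes "simple_graph G" "\<And>M. matching G M \<Longrightarrow> card M \<le> b"
  shows "matching_number G \<le> b"
proof -
  have "matching G {}" by (simp add: matching_def)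
  then show ?thesis
    unfolding matching_number_def using finite_matchings[OF assms(1)] assms(2)
    by (subst Max_le_iff) auto
qed

text \<open>Matchings are exhibited as indexed families. Edges are nonempty, so disjointness already
  makes the family injective.\<close>

lemma matching_number_ge:
  assumes "simple_graph G" "finite A"
    and "\<And>a. a \<in> A \<Longrightarrow> e a \<in> edges G"
    and disj: "\<And>a b. a \<in> A \<Longrightarrow> b \<in> A \<Longrightarrow> a \<noteq> b \<Longrightarrow> e a \<inter> e b = {}"
  shows "card A \<le> matching_number G"
proof -
  have ne: "e a \<noteq> {}" if "a \<in> A" for a
    using assms(1,3) that unfolding simple_graph_def by (metis card.empty zero_neq_numeral)
  then have "inj_on e A"
    using disj by (intro inj_onI) (metis Int_absorb)
  moreover have "matching G (e ` A)"
    using assms(3) disj by (auto simp: matching_def disjoint_def)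
  then have "card (e ` A) \<le> matching_number G"
    unfolding matching_number_def using finite_matchings[OF assms(1)] by (intro Max_ge) auto
  ultimately show ?thesis by (simp add: card_image)
qed

text \<open>Weak linear programming duality; the factor two makes half-integral covers integral.\<close>

lemma matching_number_le_cover:
  fixes w :: "'a \<Rightarrow> nat"
  assumes G: "simple_graph G" and w: "\<And>e. e \<in> edges G \<Longrightarrow> 2 \<le> sum w e"
  shows "2 * matching_number G \<le> sum w (verts G)"
proof -
  have fin: "finite (verts G)" using G by (simp add: simple_graph_def)
  have "card M \<le> sum w (verts G) div 2" if M: "matching G M" for M
  proof -
    have sub: "M \<subseteq> edges G" "disjoint M" using M by (auto simp: matching_def)
    have fe: "finite e" if "e \<in> M" for e
      using that sub(1) G fin by (meson finite_subset simple_graph_def subsetD)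
    have "2 * card M = (\<Sum>e\<in>M. 2)" by simp
    also have "\<dots> \<le> (\<Sum>e\<in>M. sum w e)" using sub(1) w by (intro sum_mono) auto
    also have "\<dots> = sum w (\<Union> M)"
      using sub(2) fe by (subst sum.Union_disjoint) (auto simp: disjoint_def)
    also have "\<dots> \<le> sum w (verts G)"
      using fin sub(1) simple_graph_Union[OF G] by (intro sum_mono2) auto
    finally show ?thesis by simp
  qed
  then have "matching_number G \<le> sum w (verts G) div 2"
    by (rule matching_number_le[OF G])
  then show ?thesis by simp
qed

text \<open>The only property of a cycle that the uniqueness argument uses: it has no vertex of
  degree one.\<close>

lemma cycle_graph_two_neighbours:
  assumes iso: "H \<simeq>\<^sub>g cycle_graph k" and "3 \<le> k" and H: "simple_graph H" and x: "x \<in> verts H"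
  obtains y z where "y \<noteq> z" "{x, y} \<in> edges H" "{x, z} \<in> edges H"
proof -
  obtain g where g: "bij_betw g {..<k} (verts H)"
      "edges H = (\<lambda>e. g ` e) ` {{x, (x + 1) mod k} | x. x < k}"
    using graph_iso_sym[OF simple_graph_Union[OF H] iso]
    unfolding graph_iso_def cycle_graph_def by auto
  obtain i where i: "i < k" "x = g i"
    using g(1) x by (metis bij_betw_iff_bijections lessThan_iff)
  define a b where "a = (i + 1) mod k" and "b = (i + k - 1) mod k"
  have ab: "a < k" "b < k" "a \<noteq> b" "(b + 1) mod k = i"
    using assms(2) i by (auto simp: a_def b_def mod_if)
  have edge: "{g j, g ((j + 1) mod k)} \<in> edges H" if "j < k" for j
    unfolding g(2) using that by (intro image_eqI[of _ _ "{j, (j + 1) mod k}"]) (auto simp del: mod_less)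
  have "g a \<noteq> g b" using g(1) ab by (auto simp: bij_betw_def inj_on_def)
  moreover have "{x, g a} \<in> edges H" using edge[OF i(1)] by (simp add: i a_def)
  moreover have "{x, g b} \<in> edges H" using edge[OF ab(2)] ab(4) by (simp add: i insert_commute)
  ultimately show ?thesis using that by blast
qed

section \<open>Uniqueness of the cycle\<close>

context unicyclic_rep
begin

definition "cycle_part = (Z, {{v i, v ((i + 1) mod k)} | i. i < k})"

lemma cycle_part_iso: "cycle_part \<simeq>\<^sub>g cycle_graph k"
proof (rule graph_iso_sym)
  show "\<Union> (edges (cycle_graph k)) \<subseteq> verts (cycle_graph k)"
    using k0 by (auto simp: cycle_graph_def)
  show "cycle_graph k \<simeq>\<^sub>g cycle_part"
    unfolding graph_iso_def cycle_part_def cycle_graph_def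
    using inj by (intro exI[of _ v]) (simp add: bij_betw_def setcompr_eq_image image_image)
qed

lemma cycle_part_subgraph: "subgraph cycle_part G"
proof -
  have "card e = 2" if "e \<in> edges cycle_part" for e
    using that simple by (auto simp: cycle_part_def simple_graph_def edges_eq)
  moreover have "e \<subseteq> verts cycle_part" if "e \<in> edges cycle_part" for e
    using that nx_less by (auto simp: cycle_part_def simp del: mod_less)
  ultimately show ?thesis
    using cyc_sub by (auto simp: subgraph_def simple_graph_def cycle_part_def edges_eq)
qed

text \<open>In \<open>H\<close> a tree vertex of maximal depth could only be adjacent to its parent,
  so \<open>H\<close> lives on the cycle. There each vertex of \<open>H\<close> needs both its
  cyclic neighbours, and walking around yields the whole cycle.\<close>

lemma two_neighbours_eq_cycle_part:
  assumes sub: "subgraph H G" and ne: "verts H \<noteq> {}"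
    and two: "\<And>x. x \<in> verts H \<Longrightarrow> \<exists>y z. y \<noteq> z \<and> {x, y} \<in> edges H \<and> {x, z} \<in> edges H"
  shows "H = cycle_part"
proof -
  have H: "simple_graph H" "verts H \<subseteq> V" "edges H \<subseteq> edges G" using sub by (auto simp: subgraph_def)
  have edge_V: "y \<in> verts H" if "{x, y} \<in> edges H" for x y
    using that H(1) by (auto simp: simple_graph_def)
  have noT: "verts H \<inter> T = {}"
  proof (rule ccontr)
    assume "verts H \<inter> T \<noteq> {}"
    then have "Max (dep ` (verts H \<inter> T)) \<in> dep ` (verts H \<inter> T)" by (intro Max_in) auto
    then obtain x where x: "x \<in> verts H \<inter> T" and "dep x = Max (dep ` (verts H \<inter> T))" by auto
    then have max: "dep y \<le> dep x" if "y \<in> verts H \<inter> T" for y using that by simp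
    have "y = p x" if "{x, y} \<in> edges H" for y
    proof -
      have "y \<in> {y. {x, y} \<in> edges G}" using that H(3) by auto
      then consider "y = p x" | "y \<in> T" "p y = x" using x neighbours_T[of x] by auto
      then show ?thesis
      proof cases
        case 2
        then show ?thesis using max[of y] edge_V[OF that] dep_T[of y] by auto
      qed
    qed
    then show False using two[of x] x by blast
  qed
  then have VZ: "verts H \<subseteq> Z" using H(2) by auto
  have eH: "edges H \<subseteq> edges cycle_part"
  proof
    fix e assume e: "e \<in> edges H"
    then have "e \<subseteq> verts H" "e \<in> edges G" using H by (auto simp: simple_graph_def)
    then have "e \<subseteq> Z" "e \<in> edges G" using VZ by auto
    then show "e \<in> edges cycle_part" unfolding edges_eq cycle_part_def by auto
  qed
  have nx: "{v i, v ((i + 1) mod k)} \<in> edges H" if i: "i < k" "v i \<in> verts H" for i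
  proof -
    obtain y z where yz: "y \<noteq> z" "{v i, y} \<in> edges H" "{v i, z} \<in> edges H" using two i(2) by blast
    have "y \<in> {v ((i + 1) mod k), v ((i + k - 1) mod k)}" if "{v i, y} \<in> edges H" for y
    proof -
      have "y \<in> {y. {v i, y} \<in> edges G}" "y \<in> Z" using that H(3) VZ edge_V by blast+
      then show ?thesis unfolding neighbours_Z[OF i(1)] by blast
    qed
    then show ?thesis using yz by blast
  qed
  obtain i where i: "i < k" "v i \<in> verts H" using ne VZ by blast
  have step: "v ((i + j) mod k) \<in> verts H" for j
  proof (induction j)
    case (Suc j)
    show ?case using nx[OF _ Suc] edge_V k0 by (metis add_Suc_right mod_Suc_eq mod_less_divisor Suc_eq_plus1)
  qed (use i in simp)
  have all: "v j \<in> verts H" if "j < k" for j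
    using step[of "j + k - i"] that i by simp
  then have "verts H = Z" using VZ by auto
  moreover have "edges H = edges cycle_part" using eH nx all unfolding cycle_part_def by auto
  ultimately show ?thesis by (simp add: cycle_part_def prod_eq_iff)
qed

lemma unicyclic: "unicyclic G"
  unfolding unicyclic_def
proof (intro conjI ex1I[of _ cycle_part] simple connected)
  show "subgraph cycle_part G" "\<exists>k\<ge>3. cycle_part \<simeq>\<^sub>g cycle_graph k"
    using cycle_part_subgraph cycle_part_iso k3 by blast+
next
  fix H assume "subgraph H G \<and> (\<exists>k\<ge>3. H \<simeq>\<^sub>g cycle_graph k)"
  then obtain k' where H: "subgraph H G" and k': "3 \<le> k'" "H \<simeq>\<^sub>g cycle_graph k'" by blast
  have "verts H \<noteq> {}" using k' by (auto simp: graph_iso_def cycle_graph_def bij_betw_def lessThan_empty_iff dest!: sym[of "{}"])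
  then show "H = cycle_part"
    using cycle_graph_two_neighbours[OF k'(2,1)] H
    by (intro two_neighbours_eq_cycle_part) (auto simp: subgraph_def, metis)
qed

text \<open>Renumbering puts any chosen cycle vertex at index 0. \<open>G\<close> and
  \<open>p\<close> stay, so the descendant sets do not change.\<close>

lemma rotate:
  assumes "r < k"
  shows "unicyclic_rep G k (\<lambda>i. v ((i + r) mod k)) p"
proof -
  let ?f = "\<lambda>i. (i + r) mod k"
  have f: "?f ((x + k - r) mod k) = x" if "x < k" for x
    using that assms by (simp add: mod_add_left_eq)
  have f_less: "?f i < k" for i using k0 by simp
  have surj: "?f ` {..<k} = {..<k}"
  proof (intro equalityI subsetI)
    fix x assume "x \<in> {..<k}"
    then show "x \<in> ?f ` {..<k}" using f[of x] k0 by (intro image_eqI[of _ _ "(x + k - r) mod k"]) auto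
  qed (use f_less in auto)
  then have "inj_on ?f {..<k}" by (simp add: eq_card_imp_inj_on)
  then have inj': "inj_on (\<lambda>i. v (?f i)) {..<k}"
    using inj surj comp_inj_on[of ?f "{..<k}" v] by (simp add: comp_def)
  have Z: "(\<lambda>i. v (?f i)) ` {..<k} = Z"
    by (metis surj image_image)
  have "{{v i, v ((i + 1) mod k)} | i. i < k} = (\<lambda>i. {v i, v ((i + 1) mod k)}) ` ?f ` {..<k}"
    unfolding surj by auto
  also have "\<dots> = {{v (?f i), v (?f ((i + 1) mod k))} | i. i < k}"
    by (auto simp: image_iff mod_simps)
  finally show ?thesis
    using k3 inj' fin cyc_sub p_cyc p_verts reach edges_eq f_less
    unfolding unicyclic_rep_def Z by presburger
qed

section \<open>Vertex counts and bounds for the matching number\<close>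

lemma verts_card: "card V = k + card T"
  using card_Diff_subset[OF finZ cyc_sub] card_mono[OF fin cyc_sub] card_image[OF inj] by simp

text \<open>The bridge from \<open>t\<close> to \<open>p t\<close> is pendent exactly if
  \<open>D t\<close> is a singleton, so these vertices stand for the non-pendent bridges.\<close>

definition "inner = {t \<in> T. 2 \<le> card (D t)}"
text \<open>Cycle vertices with a leaf attached directly, possibly fewer than those with a
  non-trivial tree. Only they need extra weight in the cover, and the difference matters for
  equality.\<close>

definition "leafy = {i. i < k \<and> (\<exists>t\<in>T. p t = v i \<and> card (D t) = 1)}"

lemma card_D_pos: "t \<in> V \<Longrightarrow> 0 < card (D t)"
  using D_self by (auto simp: card_gt_0_iff)

lemma card_D_parent: "t \<in> T \<Longrightarrow> 2 \<le> card (D (p t))"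
proof -
  assume t: "t \<in> T"
  have "{t, p t} \<subseteq> D (p t)" using t D_self[of t] D_self[of "p t"] p_verts D_rec[of t "p t"] by auto
  then have "card {t, p t} \<le> card (D (p t))" by (intro card_mono) auto
  then show ?thesis using p_neq[OF t] by simp
qed

text \<open>Doubled fractional cover: weight 1 on the cycle, raised to 2 at \<open>leafy\<close>
  vertices, weight 2 on \<open>inner\<close> and 0 on leaves. The edge of a leaf is covered by its
  parent, which is a \<open>leafy\<close> cycle vertex or, off the cycle, has two descendants and so
  is in \<open>inner\<close>.\<close>

lemma matching_number_upper: "2 * matching_number G \<le> 2 * card inner + k + card leafy"
proof -
  define w where "w x = (if x \<in> Z then 1 + (if ri x \<in> leafy then 1 else 0) else if x \<in> inner then 2 else 0 :: nat)" for x
  have "2 \<le> sum w e" if "e \<in> edges G" for e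
  proof -
    have "card e = 2" using that simple by (auto simp: simple_graph_def)
    consider i where "i < k" "e = {v i, v ((i + 1) mod k)}" | t where "t \<in> T" "e = {t, p t}"
      using \<open>e \<in> edges G\<close> unfolding edges_eq by blast
    then show ?thesis
    proof cases
      case 1
      have "2 = (\<Sum>x\<in>e. 1 :: nat)" using \<open>card e = 2\<close> by simp
      also have "\<dots> \<le> sum w e" using 1 nx_less by (intro sum_mono) (auto simp: w_def)
      finally show ?thesis .
    next
      case 2
      have "sum w e = w t + w (p t)" using 2 p_neq[of t] by simp
      moreover have "2 \<le> w t + w (p t)"
      proof (cases "t \<in> inner")
        case True
        then show ?thesis using 2 by (auto simp: w_def)
      next
        case False
        then have leaf: "card (D t) = 1" using 2 card_D_pos[of t] by (auto simp: inner_def)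
        show ?thesis
        proof (cases "p t \<in> Z")
          case True
          then obtain i where "i < k" "p t = v i" by auto
          then show ?thesis using leaf 2 by (auto simp: w_def ri_v leafy_def)
        next
          case False
          then show ?thesis using card_D_parent[of t] 2 p_verts[of t] by (auto simp: w_def inner_def)
        qed
      qed
      ultimately show ?thesis by simp
    qed
  qed
  then have "2 * matching_number G \<le> sum w V"
    by (rule matching_number_le_cover[OF simple])
  also have "sum w V = sum w Z + sum w T"
    using cyc_sub fin by (metis add.commute sum.subset_diff)
  also have "sum w Z = (\<Sum>i<k. 1 + (if i \<in> leafy then 1 else 0))"
    by (subst sum.reindex[OF inj]) (auto simp: w_def ri_v intro!: sum.cong)
  also have "\<dots> = k + card leafy"
    by (subst sum.distrib) (auto simp: sum.If_cases leafy_def intro!: arg_cong[where f=card])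
  also have "sum w T = 2 * card inner"
  proof -
    have "sum w T = (\<Sum>x\<in>T. if x \<in> inner then 2 else 0)" by (rule sum.cong) (auto simp: w_def)
    also have "\<dots> = 2 * card inner"
      by (auto simp: sum.If_cases inner_def intro!: arg_cong[where f=card])
    finally show ?thesis .
  qed
  finally show ?thesis by simp
qed

lemma matching_number_half_cycle: "k div 2 \<le> matching_number G"
proof -
  have "card {..<k div 2} \<le> matching_number G"
  proof (rule matching_number_ge[OF simple])
    fix a b assume ab: "a \<in> {..<k div 2}" "b \<in> {..<k div 2}"
    then have *: "2 * a + 1 < k" "2 * b + 1 < k" by auto
    show "{v (2 * a), v (2 * a + 1)} \<in> edges G"
      using cycle_edge[of "2 * a"] * by simp
    show "{v (2 * a), v (2 * a + 1)} \<inter> {v (2 * b), v (2 * b + 1)} = {}" if "a \<noteq> b"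
    proof -
      have "v ` {2 * a, 2 * a + 1} \<inter> v ` {2 * b, 2 * b + 1} = v ` ({2 * a, 2 * a + 1} \<inter> {2 * b, 2 * b + 1})"
        using * by (intro inj_on_image_Int[OF inj, symmetric]) auto
      also have "{2 * a, 2 * a + 1} \<inter> {2 * b, 2 * b + 1} = {}" using that by (simp; presburger)
      finally show ?thesis by simp
    qed
  qed simp
  then show ?thesis by simp
qed

text \<open>Opening the cycle at an edge of \<open>v 0\<close> and prepending \<open>t\<close> gives
  a path on \<open>k + 1\<close> vertices; every second edge is taken, beginning with the one at
  \<open>t\<close>.\<close>

lemma matching_number_half_path:
  assumes "t \<in> T" "p t = v 0"
  shows "(k + 1) div 2 \<le> matching_number G"
proof -
  define e where "e a = (if a = 0 then {t, v 0} else {v (2 * a - 1), v (2 * a)})" for a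
  have "card {..<(k + 1) div 2} \<le> matching_number G"
  proof (rule matching_number_ge[OF simple])
    fix a b assume ab: "a \<in> {..<(k + 1) div 2}" "b \<in> {..<(k + 1) div 2}"
    then have *: "2 * a < k" "2 * b < k" by auto
    show "e a \<in> edges G"
      using cycle_edge[of "2 * a - 1"] * tree_edge[of t] assms by (auto simp: e_def)
    show "e a \<inter> e b = {}" if "a \<noteq> b"
    proof -
      have e: "e c = (if c = 0 then {t} else {}) \<union> v ` (if c = 0 then {0} else {2 * c - 1, 2 * c})" for c
        by (auto simp: e_def)
      have t: "t \<notin> v ` A" if "A \<subseteq> {..<k}" for A using assms that by auto
      have "v ` (if a = 0 then {0} else {2 * a - 1, 2 * a}) \<inter> v ` (if b = 0 then {0} else {2 * b - 1, 2 * b})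
        = v ` ((if a = 0 then {0} else {2 * a - 1, 2 * a}) \<inter> (if b = 0 then {0} else {2 * b - 1, 2 * b}))"
        using * by (intro inj_on_image_Int[OF inj, symmetric]) auto
      also have "(if a = 0 then {0} else {2 * a - 1, 2 * a}) \<inter> (if b = 0 then {0} else {2 * b - 1, 2 * b}) = {}"
        using that by (cases "a = 0"; cases "b = 0") (simp_all, presburger+)
      finally show ?thesis
        unfolding e using that t[of "if a = 0 then {0} else {2 * a - 1, 2 * a}"]
          t[of "if b = 0 then {0} else {2 * b - 1, 2 * b}"] *
        by (cases "a = 0"; cases "b = 0") (auto simp: less_imp_diff_less)
    qed
  qed simp
  then show ?thesis by simp
qed

lemma tree_root_child:
  assumes "T \<noteq> {}" obtains t where "t \<in> T" "p t \<in> Z"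
proof -
  have "x \<in> Z \<or> (\<exists>t\<in>T. p t \<in> Z)" if "x \<in> V" for x
    using that by (induction x rule: V_induct) blast+
  then show ?thesis using assms that by blast
qed

text \<open>This bounds the cycle length by the matching number, which removes long cycles from the
  competition for small \<open>m\<close>.\<close>

lemma matching_number_lower: "(k + of_bool (T \<noteq> {})) div 2 \<le> matching_number G"
proof (cases "T = {}")
  case True
  then show ?thesis using matching_number_half_cycle by simp
next
  case False
  then obtain t i where t: "t \<in> T" "i < k" "p t = v i" by (rule tree_root_child) auto
  interpret R: unicyclic_rep G k "\<lambda>j. v ((j + i) mod k)" p by (rule rotate[OF t(2)])
  have "t \<in> R.T" using t R.p_neq R.p_cyc R.p_Z by (metis DiffI DiffE p_neq)
  then show ?thesis using R.matching_number_half_path[of t] t False by simp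
qed

end

lemma unicyclic_rep_iso:
  assumes "unicyclic_rep G k v p" "bij_betw f (verts G) (verts H)" "edges H = (\<lambda>e. f ` e) ` edges G"
  shows "unicyclic_rep H k (f \<circ> v) (f \<circ> p \<circ> the_inv_into (verts G) f)"
proof -
  interpret unicyclic_rep G k v p by fact
  have inj_f: "inj_on f V" and Vf: "verts H = f ` V" using assms(2) by (auto simp: bij_betw_def)
  define g where "g = the_inv_into V f"
  have g: "g (f x) = x" if "x \<in> V" for x using that inj_f by (simp add: g_def the_inv_into_f_f)
  have pow: "((f \<circ> p \<circ> g) ^^ j) (f x) = f ((p ^^ j) x)" if "x \<in> V" for x j
    using that by (induction j) (auto simp: g p_pow_V)
  have mem: "f x \<in> (f \<circ> v) ` {..<k} \<longleftrightarrow> x \<in> Z" if "x \<in> V" for x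
    using inj_on_image_mem_iff[OF inj_f that cyc_sub] by (simp add: image_comp)
  show ?thesis
    unfolding g_def[symmetric]
  proof
    show "inj_on (f \<circ> v) {..<k}" using inj inj_f cyc_sub by (meson comp_inj_on inj_on_subset)
    show "edges H = {{(f \<circ> v) i, (f \<circ> v) ((i + 1) mod k)} | i. i < k}
        \<union> {{x, (f \<circ> p \<circ> g) x} | x. x \<in> verts H - (f \<circ> v) ` {..<k}}"
    proof -
      have "verts H - (f \<circ> v) ` {..<k} = f ` T"
        using inj_on_image_set_diff[OF inj_f Diff_subset cyc_sub] unfolding Vf by (simp add: image_comp)
      then have T': "{{x, (f \<circ> p \<circ> g) x} | x. x \<in> verts H - (f \<circ> v) ` {..<k}} = (\<lambda>x. {f x, f (p x)}) ` T"
        by (simp add: setcompr_eq_image image_image g)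
      show ?thesis
        unfolding T' unfolding assms(3) edges_eq
        by (simp add: image_Un setcompr_eq_image image_image set_diff_eq)
    qed
  qed (use k3 fin cyc_sub p_cyc p_verts reach pow mem g v_V p_pow_V in \<open>auto simp: Vf\<close>)
qed

section \<open>Decomposition of unicyclic graphs\<close>

text \<open>In a walk of least length no vertex repeats, since the part between two visits could be
  cut out.\<close>

lemma shortest_path:
  assumes "(a, b) \<in> R\<^sup>*"
  obtains f n where "f 0 = a" "f n = b" "\<And>i. i < n \<Longrightarrow> (f i, f (Suc i)) \<in> R" "inj_on f {..n}"
proof -
  define n where "n = (LEAST n. (a, b) \<in> R ^^ n)"
  obtain n' where "(a, b) \<in> R ^^ n'" using assms rtrancl_imp_relpow by blast
  then have n: "(a, b) \<in> R ^^ n" unfolding n_def by (rule LeastI)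
  have least: "n \<le> l" if "(a, b) \<in> R ^^ l" for l unfolding n_def by (rule Least_le) (rule that)
  obtain f where f: "f 0 = a" "f n = b" "\<forall>i<n. (f i, f (Suc i)) \<in> R"
    using n unfolding relpow_fun_conv by blast
  have "f i \<noteq> f j" if "i < j" "j \<le> n" for i j
  proof
    assume eq: "f i = f j"
    have "(f 0, f i) \<in> R ^^ i"
      unfolding relpow_fun_conv using f(3) that by (intro exI[of _ f]) auto
    moreover have "(f j, f n) \<in> R ^^ (n - j)"
      unfolding relpow_fun_conv using f(3) that by (intro exI[of _ "\<lambda>l. f (j + l)"]) auto
    ultimately have "(a, b) \<in> R ^^ (i + (n - j))"
      using f(1,2) eq by (auto simp: relpow_add)
    then show False using least that by fastforce
  qed
  then have "inj_on f {..n}"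
    by (intro linorder_inj_onI) auto
  then show ?thesis using f that by blast
qed

text \<open>A path from \<open>a\<close> to \<open>b\<close> inside \<open>E'\<close> is closed by
  the edge itself. It has at least two steps because \<open>a\<close> and \<open>b\<close> differ
  and the edge is not in \<open>E'\<close>.\<close>

lemma edge_in_cycle:
  assumes G: "simple_graph G" and E': "E' \<subseteq> edges G" and e: "{a, b} \<in> edges G" "{a, b} \<notin> E'" "a \<noteq> b"
    and ab: "(a, b) \<in> {(x, y). {x, y} \<in> E'}\<^sup>*"
  obtains H l where "subgraph H G" "3 \<le> l" "H \<simeq>\<^sub>g cycle_graph l" "{a, b} \<in> edges H"
proof -
  obtain f n where f: "f 0 = a" "f n = b"
    and "\<And>i. i < n \<Longrightarrow> (f i, f (Suc i)) \<in> {(x, y). {x, y} \<in> E'}" and inj: "inj_on f {..n}"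
    by (rule shortest_path[OF ab]) blast
  then have step: "{f i, f (Suc i)} \<in> E'" if "i < n" for i using that by auto
  have "n \<noteq> 0" using f e(3) by (cases n) auto
  moreover have "n \<noteq> 1"
  proof
    assume "n = 1"
    then show False using f e(2) step[of 0] by simp
  qed
  ultimately have n: "2 \<le> n" by linarith
  define H where "H = (f ` {..<n + 1}, (\<lambda>e. f ` e) ` edges (cycle_graph (n + 1)))"
  have cyc: "cycle_graph (n + 1) \<simeq>\<^sub>g H"
    unfolding graph_iso_def H_def using inj
    by (intro exI[of _ f]) (auto simp: bij_betw_def cycle_graph_def lessThan_Suc_atMost)
  have edges_H: "edges H \<subseteq> insert {a, b} E'"
  proof
    fix c assume "c \<in> edges H"
    then obtain i where i: "i \<le> n" "c = {f i, f ((i + 1) mod (n + 1))}"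
      by (auto simp: H_def cycle_graph_def less_Suc_eq_le simp del: mod_less)
    show "c \<in> insert {a, b} E'"
    proof (cases "i = n")
      case True
      then show ?thesis using i f by auto
    next
      case False
      then show ?thesis using i step[of i] by auto
    qed
  qed
  have "{n, (n + 1) mod (n + 1)} \<in> edges (cycle_graph (n + 1))"
    unfolding cycle_graph_def by auto
  then have "f ` {n, 0} \<in> edges H" unfolding H_def snd_conv mod_self by (rule imageI)
  then have abH: "{a, b} \<in> edges H" using f by (simp add: insert_commute)
  have vH: "\<Union> (edges H) \<subseteq> verts H"
    unfolding H_def cycle_graph_def by (auto simp del: mod_less)
  have sub: "edges H \<subseteq> edges G" using edges_H E' e(1) by auto
  have "f i \<in> verts G" if "i \<le> n" for i
  proof (cases "i = n")
    case True
    then show ?thesis using f(2) e(1) G by (auto simp: simple_graph_def)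
  next
    case False
    then have "{f i, f (Suc i)} \<in> edges G" using that step[of i] E' by auto
    then show ?thesis using G by (auto simp: simple_graph_def)
  qed
  then have "verts H \<subseteq> verts G" by (auto simp: H_def)
  moreover have "simple_graph H"
    using sub vH G unfolding simple_graph_def by (auto simp: H_def[THEN arg_cong, of fst])
  ultimately have "subgraph H G" using sub by (simp add: subgraph_def)
  moreover have "H \<simeq>\<^sub>g cycle_graph (n + 1)"
    by (rule graph_iso_sym[OF _ cyc]) (auto simp: cycle_graph_def)
  ultimately show ?thesis using that[of H "n + 1"] n abH by simp
qed

text \<open>\<open>p\<close> moves to a neighbour nearer to the cycle. The cycle and the parent
  edges already connect all vertices, so one more edge would lie on a second cycle.\<close>

lemma unicyclic_imp_rep:
  assumes "unicyclic G"
  obtains k v p where "unicyclic_rep G k v p"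
proof -
  have G: "simple_graph G" "connected_graph G" using assms by (auto simp: unicyclic_def)
  obtain H k where H: "subgraph H G" "3 \<le> k" "H \<simeq>\<^sub>g cycle_graph k"
    and uniq: "\<And>H' k'. subgraph H' G \<Longrightarrow> 3 \<le> k' \<Longrightarrow> H' \<simeq>\<^sub>g cycle_graph k' \<Longrightarrow> H' = H"
    using assms unfolding unicyclic_def by blast
  have simpH: "simple_graph H" "verts H \<subseteq> verts G" "edges H \<subseteq> edges G" using H(1) by (auto simp: subgraph_def)
  obtain v where v: "bij_betw v {..<k} (verts H)" "edges H = (\<lambda>e. v ` e) ` {{x, (x + 1) mod k} | x. x < k}"
    using graph_iso_sym[OF simple_graph_Union[OF simpH(1)] H(3)]
    unfolding graph_iso_def cycle_graph_def by auto
  define Z where "Z = verts H"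
  have Z: "Z = v ` {..<k}" "inj_on v {..<k}" using v(1) by (auto simp: bij_betw_def Z_def)
  have eH: "edges H = {{v i, v ((i + 1) mod k)} | i. i < k}"
    unfolding v(2) by (simp add: setcompr_eq_image image_image)
  define R where "R = {(x, y). {x, y} \<in> edges G}"
  define d where "d x = (LEAST n. \<exists>z\<in>Z. (x, z) \<in> R ^^ n)" for x
  have "v 0 \<in> Z" using Z H(2) by auto
  have d_ex: "\<exists>n. \<exists>z\<in>Z. (x, z) \<in> R ^^ n" if "x \<in> verts G" for x
  proof -
    have "(x, v 0) \<in> R\<^sup>*" using G(2) that \<open>v 0 \<in> Z\<close> simpH(2) unfolding connected_graph_def R_def Z_def by blast
    then show ?thesis using \<open>v 0 \<in> Z\<close> rtrancl_imp_relpow by blast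
  qed
  have RV: "y \<in> verts G" if "(x, y) \<in> R" for x y using that G(1) by (auto simp: R_def simple_graph_def)
  have parent: "\<exists>y. (x, y) \<in> R \<and> d y < d x" if x: "x \<in> verts G" "x \<notin> Z" for x
  proof -
    obtain z where z: "z \<in> Z" "(x, z) \<in> R ^^ d x"
      unfolding d_def using LeastI_ex[OF d_ex[OF x(1)]] by blast
    then obtain m where m: "d x = Suc m" using x(2) by (cases "d x") auto
    obtain y where y: "(x, y) \<in> R" "(y, z) \<in> R ^^ m" using z m relpow_Suc_D2 by metis
    have "d y \<le> m" unfolding d_def by (rule Least_le) (use y z in blast)
    then show ?thesis using y m by auto
  qed
  define p where "p x = (if x \<in> verts G - Z then SOME y. (x, y) \<in> R \<and> d y < d x else x)" for x
  have p: "(x, p x) \<in> R" "d (p x) < d x" if "x \<in> verts G" "x \<notin> Z" for x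
    using someI_ex[OF parent[OF that]] that by (auto simp: p_def)
  define E' where "E' = edges H \<union> {{x, p x} | x. x \<in> verts G - Z}"
  have E'_sub: "E' \<subseteq> edges G" using simpH(3) p(1) by (auto simp: E'_def R_def)
  have p_V: "p x \<in> verts G" if "x \<in> verts G" for x
    using that p(1) RV by (cases "x \<in> Z") (auto simp: p_def)
  have reach: "\<exists>j. (p ^^ j) x \<in> Z" if "x \<in> verts G" for x
    using that
  proof (induction "d x" arbitrary: x rule: less_induct)
    case less
    show ?case
    proof (cases "x \<in> Z")
      case True
      then show ?thesis by (intro exI[of _ 0]) simp
    next
      case False
      then obtain j where "(p ^^ j) (p x) \<in> Z" using less p p_V by blast
      then show ?thesis by (intro exI[of _ "Suc j"]) (simp add: funpow_swap1)
    qed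
  qed
  interpret E: unicyclic_rep "(verts G, E')" k v p
  proof
    show "edges (verts G, E') = {{v i, v ((i + 1) mod k)} | i. i < k}
        \<union> {{x, p x} | x. x \<in> verts (verts G, E') - v ` {..<k}}"
      by (simp add: E'_def eH Z(1))
    show "3 \<le> k" "inj_on v {..<k}" by fact+
    show "finite (verts (verts G, E'))" using G(1) by (simp add: simple_graph_def)
    show "v ` {..<k} \<subseteq> verts (verts G, E')" using simpH(2) Z by (simp add: Z_def)
    show "p (v i) = v i" if "i < k" for i using that Z(1) by (simp add: p_def)
    show "p x \<in> verts (verts G, E')" if "x \<in> verts (verts G, E')" for x using that p_V by simp
    show "\<exists>j. (p ^^ j) x \<in> v ` {..<k}" if "x \<in> verts (verts G, E')" for x
      using that reach unfolding Z(1) by simp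
  qed
  have "edges G \<subseteq> E'"
  proof
    fix e assume e: "e \<in> edges G"
    then have "card e = 2" "e \<subseteq> verts G" using G(1) by (auto simp: simple_graph_def)
    then obtain a b where ab: "e = {a, b}" "a \<noteq> b" "a \<in> verts G" "b \<in> verts G"
      by (auto simp: card_2_iff)
    show "e \<in> E'"
    proof (rule ccontr)
      assume "e \<notin> E'"
      moreover have "(a, b) \<in> {(x, y). {x, y} \<in> E'}\<^sup>*"
        using E.connected ab by (auto simp: connected_graph_def)
      moreover have "{a, b} \<in> edges G" "{a, b} \<notin> E'" using e ab \<open>e \<notin> E'\<close> by auto
      ultimately obtain H' l where "subgraph H' G" "3 \<le> l" "H' \<simeq>\<^sub>g cycle_graph l" "{a, b} \<in> edges H'"
        using edge_in_cycle[OF G(1) E'_sub _ _ ab(2)] by blast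
      then show False using uniq[of H' l] \<open>e \<notin> E'\<close> ab by (auto simp: E'_def)
    qed
  qed
  then have "(verts G, E') = G" using E'_sub by (auto simp: prod_eq_iff)
  then show ?thesis using that[of k v p] E.unicyclic_rep_axioms by simp
qed

section \<open>The lower bound as a function of the parameters\<close>

text \<open>Lower bound for the sum of resistances from one member of an \<open>s\<close>-set to the
  others: at most two neighbours at \<open>(k - 1) / k\<close> each, all further members at
  \<open>2 * (k - 2) / k\<close>, the value at distance two.\<close>

definition near_sum :: "nat \<Rightarrow> nat \<Rightarrow> real" where
  "near_sum k s = (if s \<le> 3 then (real s - 1) * (real k - 1) / k
     else (2 * (real k - 1) + 2 * (real s - 3) * (real k - 2)) / k)"

text \<open>The maximum of the row bound and the complement bound; the latter is exact for the full
  cycle. At (7, 3) and (8, 4) both are too small and the true minima are entered. For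
  \<open>s = k\<close> the negative value \<open>near_sum k 0\<close> is multiplied by zero.\<close>

definition pair_min :: "nat \<Rightarrow> nat \<Rightarrow> real" where
  "pair_min k s = (if k = 7 \<and> s = 3 then 22 / 7 else if k = 8 \<and> s = 4 then 15 / 2
     else max (real s / 2 * near_sum k s)
       ((real k ^ 3 - real k) / 12 - (real k - real s) * (real k ^ 2 - 1) / 6
         + (real k - real s) / 2 * near_sum k (k - s)))"

text \<open>In the last summand \<open>n - k - s\<close> counts the vertices beyond the cycle and
  one obligatory vertex per non-trivial tree.\<close>

definition Kf_bound :: "nat \<Rightarrow> nat \<Rightarrow> nat \<Rightarrow> nat \<Rightarrow> real" where
  "Kf_bound n k s q = (real n - real k) * (real n - 1) + real q * (real n - 3) + (real k ^ 3 - real k) / 12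
     + (real n - real k) * (real k ^ 2 - 1) / 6 + pair_min k s + (real n - real k - real s) * near_sum k s"

text \<open>The factor \<open>24 k\<close> clears all denominators of \<open>Kf_bound\<close>, so that the small cases reduce to integer
  arithmetic.\<close>

definition near_sum_int :: "int \<Rightarrow> int \<Rightarrow> int" where
  "near_sum_int k s = (if s \<le> 3 then (s - 1) * (k - 1) else 2 * (k - 1) + 2 * (s - 3) * (k - 2))"

text \<open>528 and 1440 are \<open>24 * 7 * 22 / 7\<close> and \<open>24 * 8 * 15 / 2\<close>, the
  two exceptional values of \<open>pair_min\<close> scaled by \<open>24 * k\<close>.\<close>

definition Kf_bound_int :: "int \<Rightarrow> int \<Rightarrow> int \<Rightarrow> int \<Rightarrow> int" where
  "Kf_bound_int n k s q = 24 * k * (n - k) * (n - 1) + 24 * k * q * (n - 3) + 2 * k * (k * k * k - k)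
     + 4 * k * (n - k) * (k * k - 1)
     + (if k = 7 \<and> s = 3 then 528 else if k = 8 \<and> s = 4 then 1440
        else max (12 * s * near_sum_int k s)
          (2 * k * (k * k * k - k) - 4 * k * (k - s) * (k * k - 1) + 12 * (k - s) * near_sum_int k (k - s)))
     + 24 * (n - k - s) * near_sum_int k s"

lemma near_sum_int: "0 < k \<Longrightarrow> real k * near_sum k s = of_int (near_sum_int (int k) (int s))"
  by (simp add: near_sum_def near_sum_int_def)

lemma Kf_bound_int:
  assumes "0 < k" "s \<le> k"
  shows "24 * real k * Kf_bound n k s q = of_int (Kf_bound_int (int n) (int k) (int s) (int q))"
proof -
  have near: "real k * near_sum k s = of_int (near_sum_int (int k) (int s))"
    "real k * near_sum k (k - s) = of_int (near_sum_int (int k) (int k - int s))"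
    using near_sum_int[of k s] near_sum_int[of k "k - s"] assms by (simp_all add: of_nat_diff)
  have "24 * real k * pair_min k s = of_int (if int k = 7 \<and> int s = 3 then 528 else if int k = 8 \<and> int s = 4 then 1440
        else max (12 * int s * near_sum_int k s)
          (2 * k * (int k * k * k - k) - 4 * k * (int k - s) * (int k * k - 1) + 12 * (int k - s) * near_sum_int k (int k - s)))"
  proof -
    have max: "c * max x y = max (c * x) (c * y)" if "c \<ge> 0" for c x y :: real
      using that by (simp add: max_mult_distrib_left)
    have B: "24 * real k * ((real k ^ 3 - real k) / 12 - (real k - real s) * (real k ^ 2 - 1) / 6
        + (real k - real s) / 2 * near_sum k (k - s))
      = 2 * k * (real k * k * k - k) - 4 * k * (real k - s) * (real k * k - 1)
        + 12 * (real k - s) * (real k * near_sum k (k - s))"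
      by (simp add: field_simps power2_eq_square power3_eq_cube)
    have "24 * real k * max (real s / 2 * near_sum k s)
       ((real k ^ 3 - real k) / 12 - (real k - real s) * (real k ^ 2 - 1) / 6
         + (real k - real s) / 2 * near_sum k (k - s))
      = max (12 * real s * (real k * near_sum k s))
       (2 * k * (real k * k * k - k) - 4 * k * (real k - s) * (real k * k - 1)
        + 12 * (real k - s) * (real k * near_sum k (k - s)))"
      unfolding B[symmetric] by (subst max) (simp_all add: mult_ac)
    then show ?thesis
      unfolding pair_min_def near by (simp add: of_int_max)
  qed
  then show ?thesis
    unfolding Kf_bound_def Kf_bound_int_def of_int_add ring_distribs(1)
    by (intro arg_cong2[where f="(+)"])
       (simp_all flip: near(1) add: field_simps power2_eq_square power3_eq_cube)
qed

text \<open>The table lists, for each small \<open>(n, m)\<close>, the numerator and the denominator of the minimum and the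
  triples (cycle length, number of non-trivial trees, number of non-pendent bridges) that attain it.\<close>

definition small_cases :: "(nat \<times> nat \<times> int \<times> int \<times> (nat \<times> nat \<times> nat) list) list" where
  "small_cases =
    [(4, 2, 5, 1, []),
     (5, 2, 10, 1, []),
     (6, 2, 20, 1, [(4, 1, 0)]),
     (6, 3, 35, 2, []),
     (7, 2, 61, 2, [(4, 1, 0)]),
     (7, 3, 28, 1, []),
     (8, 2, 43, 1, [(4, 1, 0)]),
     (8, 3, 43, 1, [(5, 1, 0)]),
     (8, 4, 42, 1, []),
     (9, 2, 115, 2, [(4, 1, 0)]),
     (9, 3, 58, 1, [(5, 1, 0)]),
     (9, 4, 60, 1, [(7, 1, 0)]),
     (10, 2, 74, 1, [(4, 1, 0)]),
     (10, 3, 75, 1, [(5, 1, 0)]),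
     (10, 4, 79, 1, [(7, 1, 0)]),
     (10, 5, 655, 8, [(8, 2, 0)]),
     (11, 2, 185, 2, [(4, 1, 0)]),
     (11, 3, 94, 1, [(5, 1, 0)]),
     (11, 4, 100, 1, [(6, 2, 0), (7, 1, 0)]),
     (11, 5, 734, 7, [(7, 3, 0)]),
     (12, 2, 113, 1, [(3, 1, 0), (4, 1, 0)]),
     (12, 3, 115, 1, [(5, 1, 0)]),
     (12, 4, 368, 3, [(6, 2, 0)]),
     (12, 5, 907, 7, [(7, 3, 0)]),
     (12, 6, 271, 2, [(8, 4, 0)]),
     (13, 2, 406, 3, [(3, 1, 0)]),
     (13, 3, 138, 1, [(5, 1, 0)]),
     (13, 4, 442, 3, [(6, 2, 0)]),
     (13, 5, 1094, 7, [(7, 3, 0)]),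
     (13, 6, 661, 4, [(8, 4, 0)]),
     (14, 2, 479, 3, [(3, 1, 0)]),
     (14, 3, 163, 1, [(5, 1, 0)]),
     (14, 4, 174, 1, [(5, 1, 1), (6, 2, 0)]),
     (14, 5, 185, 1, [(5, 1, 2), (6, 2, 1), (7, 3, 0)]),
     (14, 6, 196, 1, [(5, 1, 3), (6, 2, 2), (7, 3, 1)]),
     (14, 7, 203, 1, [(7, 7, 0)])]"

text \<open>Only the least \<open>q\<close> allowed by the matching number is tested, with truncated
  subtraction giving 0 where nothing is required. The alternative \<open>(k + 1) div 2 > m\<close>
  discards cycles that are too long.\<close>

lemma small_cases_check:
  "list_all (\<lambda>(n, m, a, b, W). list_all (\<lambda>k. list_all (\<lambda>s.
      let q = m - (k + s) div 2; x = b * Kf_bound_int (int n) (int k) (int s) (int q); y = 24 * int k * a in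
      (k + 1) div 2 > m \<or> x > y \<or> x = y \<and> (k, s, q) \<in> set W)
     [1..<Suc (min k (n - k))]) [3..<n]) small_cases"
  by code_simp

text \<open>The bound is linear in \<open>q\<close> with the positive slope
  \<open>n - 3\<close>.\<close>

lemma Kf_bound_mono:
  assumes "n \<ge> 4" "q \<le> q'"
  shows "Kf_bound n k s q \<le> Kf_bound n k s q'" "Kf_bound n k s q = Kf_bound n k s q' \<Longrightarrow> q = q'"
proof -
  have "Kf_bound n k s q' - Kf_bound n k s q = (real q' - real q) * (real n - 3)"
    by (simp add: Kf_bound_def algebra_simps)
  moreover have "(real q' - real q) * (real n - 3) \<ge> 0"
    using assms by (intro mult_nonneg_nonneg) auto
  moreover have "real n - 3 \<noteq> 0" using assms by simp
  ultimately show "Kf_bound n k s q \<le> Kf_bound n k s q'" "Kf_bound n k s q = Kf_bound n k s q' \<Longrightarrow> q = q'"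
    by auto
qed

lemma Kf_bound_small:
  assumes "(n, m, a, b, W) \<in> set small_cases" and "0 < b" "4 \<le> n"
    and "3 \<le> k" "1 \<le> s" "s \<le> k" "k + s \<le> n" "(k + 1) div 2 \<le> m" "2 * m \<le> 2 * q + k + s"
  shows "Kf_bound n k s q \<ge> of_int a / of_int b"
    and "Kf_bound n k s q = of_int a / of_int b \<Longrightarrow> (k, s, q) \<in> set W"
proof -
  define q0 where "q0 = m - (k + s) div 2"
  define x where "x = b * Kf_bound_int (int n) (int k) (int s) (int q0)"
  have q0: "q0 \<le> q" using assms by (simp add: q0_def)
  have "k < n" using assms by simp
  have x: "of_int x = of_int b * (24 * real k * Kf_bound n k s q0)"
    using Kf_bound_int[of k s n q0] assms by (simp add: x_def)
  have pos: "of_int b * (24 * real k) > (0::real)" using assms by simp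
  have diff: "Kf_bound n k s q0 - of_int a / of_int b = (of_int x - 24 * real k * of_int a) / (of_int b * (24 * real k))"
    using assms x by (simp add: field_simps)
  have ks: "k \<in> set [3..<n]" "s \<in> set [1..<Suc (min k (n - k))]" using assms by auto
  have "x > 24 * int k * a \<or> x = 24 * int k * a \<and> (k, s, q0) \<in> set W"
    using bspec[OF bspec[OF bspec[OF small_cases_check[unfolded list_all_iff] assms(1), unfolded prod.case] ks(1)] ks(2)]
      assms(8)
    by (simp add: Let_def x_def q0_def)
  then consider "x > 24 * int k * a" | "x = 24 * int k * a" "(k, s, q0) \<in> set W" by blast
  then have "Kf_bound n k s q0 > of_int a / of_int b
      \<or> Kf_bound n k s q0 = of_int a / of_int b \<and> (k, s, q0) \<in> set W"
  proof cases
    case 1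
    then have "real_of_int (24 * int k * a) < real_of_int x" by (simp only: of_int_less_iff)
    then have "0 < real_of_int x - 24 * real k * of_int a" by simp
    then have "0 < Kf_bound n k s q0 - of_int a / of_int b" unfolding diff using pos by (rule divide_pos_pos)
    then show ?thesis by simp
  next
    case 2
    then have "real_of_int x = real_of_int (24 * int k * a)" by (simp only:)
    then have "Kf_bound n k s q0 - of_int a / of_int b = 0" unfolding diff by simp
    then show ?thesis using 2 by simp
  qed
  then show "Kf_bound n k s q \<ge> of_int a / of_int b"
    "Kf_bound n k s q = of_int a / of_int b \<Longrightarrow> (k, s, q) \<in> set W"
    using Kf_bound_mono[OF assms(3) q0, of k s] by auto
qed

text \<open>A 5-cycle with a tree has a matching of size 3, so the general minimiser has no analogue
  for \<open>m = 2\<close>; only \<open>k = 3\<close> and \<open>k = 4\<close> compete.\<close>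

lemma Kf_bound_matching_two:
  assumes "15 \<le> n" "3 \<le> k" "1 \<le> s" "s \<le> k" "(k + 1) div 2 \<le> 2"
  defines "x \<equiv> (3 * real n ^ 2 - 8 * real n + 3) / 3"
  shows "Kf_bound n k s q \<ge> x" and "Kf_bound n k s q = x \<Longrightarrow> (k, s, q) = (3, 1, 0)"
proof -
  have n: "4 \<le> n" using assms by simp
  have "Kf_bound n k s 0 > x \<or> Kf_bound n k s 0 = x \<and> k = 3 \<and> s = 1"
  proof -
    have "k = 3 \<or> k = 4" "s = 1 \<or> s = 2 \<or> s = 3 \<or> s = 4" using assms by auto
    then show ?thesis
      using assms(1,4) unfolding x_def
      by (elim disjE) (simp_all add: Kf_bound_def pair_min_def near_sum_def max_def field_simps power2_eq_square)
  qed
  then show "Kf_bound n k s q \<ge> x" "Kf_bound n k s q = x \<Longrightarrow> (k, s, q) = (3, 1, 0)"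
    using Kf_bound_mono[OF n, of 0 q k s] by auto
qed

section \<open>Large graphs: the excess over the claimed minimum\<close>

lemma near_sum_ge:
  assumes "3 \<le> k" "1 \<le> s"
  shows "(real s - 1) * (real k - 1) / k \<le> near_sum k s"
proof (cases "s \<le> 3")
  case False
  \<comment> \<open>\<open>k - 1 <= 2 * (k - 2)\<close> for \<open>k >= 3\<close>, so the linear
    minorant survives beyond \<open>s = 3\<close>.\<close>
  then have "(real s - 3) * (real k - 1) \<le> (real s - 3) * (2 * (real k - 2))"
    using assms by (intro mult_left_mono) auto
  then have "(real s - 1) * (real k - 1) \<le> 2 * (real k - 1) + 2 * (real s - 3) * (real k - 2)"
    by (simp add: algebra_simps)
  then show ?thesis using False assms by (simp add: near_sum_def divide_right_mono)
qed (simp add: near_sum_def)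

text \<open>\<open>Kf_bound\<close> at \<open>q = m - (k + s) div 2\<close>, read as a possibly
  negative real, minus the claimed minimum. Both are linear in \<open>m\<close> with slope
  \<open>n - 3\<close>, so \<open>m\<close> cancels.\<close>

definition excess :: "nat \<Rightarrow> nat \<Rightarrow> nat \<Rightarrow> real" where
  "excess n k s = (real n - real k) * (real n - 1) - real ((k + s) div 2) * (real n - 3) + (real k ^ 3 - real k) / 12
     + (real n - real k) * (real k ^ 2 - 1) / 6 + pair_min k s + (real n - real k - real s) * near_sum k s
     - (real n ^ 2 - 5 * real n + 4)"

text \<open>With \<open>k = a + 13\<close>, \<open>s = b + 1\<close> and
  \<open>n = a + b + e + 14\<close> the hypotheses become nonnegativity of \<open>a\<close>,
  \<open>b\<close>, \<open>e\<close> and \<open>b <= a + 12\<close>. After clearing denominators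
  only \<open>b * b\<close> has the wrong sign.\<close>

lemma excess_pos_large:
  assumes "13 \<le> k" "1 \<le> s" "s \<le> k" "k + s \<le> n"
  shows "0 < excess n k s"
proof -
  define a b e where "a = real k - 13" and "b = real s - 1" and "e = real n - real k - real s"
  define r where "r = near_sum k s"
  have nn: "0 \<le> a" "0 \<le> b" "0 \<le> e" "b \<le> a + 12" using assms by (auto simp: a_def b_def e_def)
  have k: "real k = a + 13" and s: "real s = b + 1" and n: "real n = a + b + e + 14" by (auto simp: a_def b_def e_def)
  have fl: "real ((k + s) div 2) \<le> (a + b + 14) / 2"
  proof -
    have "real (2 * ((k + s) div 2)) \<le> real (k + s)" by (intro of_nat_mono) simp
    then show ?thesis using k s by simp
  qed
  have "b * (a + 12) / (a + 13) \<le> r"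
    using near_sum_ge[of k s] assms unfolding r_def k s by (simp add: add.commute)
  \<comment> \<open>12/13 is the least value of \<open>(a + 12) / (a + 13)\<close> for
    \<open>a >= 0\<close>.\<close>
  moreover have "b * (12 / 13) \<le> b * ((a + 12) / (a + 13))"
    using nn by (intro mult_left_mono) (auto simp: field_simps)
  ultimately have r: "b * 12 / 13 \<le> r"
    unfolding times_divide_eq_right by (rule order_trans[rotated])
  have pm: "real s / 2 * r \<le> pair_min k s" using assms by (simp add: pair_min_def r_def)
  have "(b + 1) / 2 * (b * 12 / 13) \<le> (b + 1) / 2 * r" using r nn by (intro mult_left_mono) auto
  then have pm': "(b + 1) / 2 * (b * 12 / 13) \<le> pair_min k s" using pm unfolding s by linarith
  have "e * (b * 12 / 13) \<le> e * r" using r nn by (intro mult_left_mono) auto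
  moreover have "real ((k + s) div 2) * (real n - 3) \<le> (a + b + 14) / 2 * (real n - 3)"
    using fl assms by (intro mult_right_mono) auto
  ultimately have "(real n - real k) * (real n - 1) - (a + b + 14) / 2 * (real n - 3)
      + (real k ^ 3 - real k) / 12 + (real n - real k) * (real k ^ 2 - 1) / 6
      + (b + 1) / 2 * (b * 12 / 13) + e * (b * 12 / 13) - (real n ^ 2 - 5 * real n + 4)
      \<le> excess n k s" (is "?L \<le> _")
    using pm' unfolding excess_def r_def[symmetric] e_def[symmetric] by linarith
  moreover have "0 < ?L"
  proof -
    \<comment> \<open>The last of these facts, a form of \<open>s <= k\<close>, absorbs the negative
      term.\<close>
    have "0 \<le> a * (a * a)" "0 \<le> b * e" "0 \<le> a * (a * b)" "0 \<le> a * (a * e)" "0 \<le> a * a"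
      "0 \<le> a * b" "0 \<le> a * e" "b * b \<le> (a + 12) * b"
      using nn by (simp_all add: mult_right_mono)
    then have "b * (b * 144) < a * (a * (a * 312)) + (b * (e * 1584) + (a * (a * (b * 624))
        + (a * (a * (e * 624)) + (59904 + (a * (a * 7176) + (b * 26064 + (a * (b * 8736)
        + (a * (e * 10608) + (a * 44928 + e * 44928)))))))))"
      using nn by (simp only: ring_distribs mult.assoc[symmetric])
    then show ?thesis
      unfolding k n by (simp add: field_simps power2_eq_square power3_eq_cube)
  qed
  ultimately show ?thesis by linarith
qed

text \<open>For fixed \<open>k\<close> and \<open>s\<close> the quadratic terms in \<open>n\<close>
  cancel, so finitely many linear inequalities in \<open>n\<close> remain. At the excluded pair the
  excess vanishes.\<close>

lemma excess_pos_small: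
  assumes "3 \<le> k" "k \<le> 12" "1 \<le> s" "s \<le> k" "k + s \<le> n" "15 \<le> n" "(k, s) \<noteq> (5, 1)"
  shows "0 < excess n k s"
proof -
  have "k \<in> {3, 4, 5, 6, 7, 8, 9, 10, 11, 12}" "s \<in> {1, 2, 3, 4, 5, 6, 7, 8, 9, 10, 11, 12}"
    using assms unfolding insert_iff empty_iff by presburger+
  then show ?thesis
    using assms unfolding insert_iff empty_iff
    by (elim disjE; simp add: excess_def pair_min_def near_sum_def max_def field_simps power2_eq_square)
qed

lemma Kf_bound_large:
  assumes "15 \<le> n" "3 \<le> m" "3 \<le> k" "1 \<le> s" "s \<le> k" "k + s \<le> n" "2 * m \<le> 2 * q + k + s"
  defines "x \<equiv> real n ^ 2 + real n * real m - 5 * real n - 3 * real m + 4"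
  shows "Kf_bound n k s q \<ge> x" and "Kf_bound n k s q = x \<Longrightarrow> (k, s, q) = (5, 1, m - 3)"
proof -
  have eq: "Kf_bound n k s q - x = excess n k s + (real q + real ((k + s) div 2) - real m) * (real n - 3)"
    by (simp add: Kf_bound_def excess_def x_def algebra_simps)
  have "real q + real ((k + s) div 2) - real m \<ge> 0"
  proof -
    have "m \<le> q + (k + s) div 2" using assms(7) by linarith
    then have "real m \<le> real (q + (k + s) div 2)" by (rule of_nat_mono)
    then show ?thesis by simp
  qed
  then have nn: "(real q + real ((k + s) div 2) - real m) * (real n - 3) \<ge> 0"
    using assms(1) by (intro mult_nonneg_nonneg) auto
  have "Kf_bound n k s q > x \<or> k = 5 \<and> s = 1 \<and> Kf_bound n k s q \<ge> x \<and> (Kf_bound n k s q = x \<longrightarrow> q = m - 3)"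
  proof (cases "(k, s) = (5, 1)")
    case False
    then have "0 < excess n k s"
      using excess_pos_large[of k s n] excess_pos_small[of k s n] assms by linarith
    then show ?thesis using eq nn by linarith
  next
    case True
    \<comment> \<open>This holds for every \<open>n\<close>, so the pair (5, 1) attains the minimum,
      and then the slope \<open>n - 3\<close> fixes \<open>q\<close>.\<close>
    have "excess n 5 1 = 0"
      by (simp add: excess_def pair_min_def near_sum_def max_def field_simps power2_eq_square)
    then have "Kf_bound n k s q - x = (real q + 3 - real m) * (real n - 3)" using eq True by simp
    moreover have "x \<le> Kf_bound n k s q" using eq nn \<open>excess n 5 1 = 0\<close> True by simp
    moreover have "real n - 3 \<noteq> 0" using assms(1) by simp
    ultimately show ?thesis using True assms(2) by (auto simp: of_nat_diff)
  qed
  then show "Kf_bound n k s q \<ge> x" "Kf_bound n k s q = x \<Longrightarrow> (k, s, q) = (5, 1, m - 3)" by auto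
qed

section \<open>Sums of resistances over subsets of a cycle\<close>

definition pair_sum :: "nat \<Rightarrow> nat set \<Rightarrow> real" where
  "pair_sum k S = (\<Sum>i\<in>S. \<Sum>j\<in>S. cycle_resistance k i j) / 2"

lemma cycle_resistance_nonneg: "i < k \<Longrightarrow> j < k \<Longrightarrow> 0 \<le> cycle_resistance k i j"
  by (auto simp: cycle_resistance_def intro!: divide_nonneg_nonneg mult_nonneg_nonneg)

text \<open>\<open>d * (k - d)\<close> is concave in \<open>d\<close>, so it is least at the ends of
  the admissible range; this is \<open>(d - 1) * (k - 1 - d) >= 0\<close>.\<close>

lemma cycle_resistance_ge_1:
  assumes "i < k" "j < k" "i \<noteq> j"
  shows "(real k - 1) / k \<le> cycle_resistance k i j"
proof -
  define d where "d = \<bar>real i - real j\<bar>"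
  have "1 \<le> d" "d \<le> real k - 1" using assms by (auto simp: d_def)
  then have "0 \<le> (d - 1) * (real k - 1 - d)" by (intro mult_nonneg_nonneg) auto
  then show ?thesis
    unfolding cycle_resistance_def d_def[symmetric] by (intro divide_right_mono) (simp_all add: algebra_simps)
qed

lemma cycle_resistance_ge_2:
  assumes "i < k" "j < k" "i \<noteq> j" "j \<noteq> (i + 1) mod k" "j \<noteq> (i + k - 1) mod k"
  shows "2 * (real k - 2) / k \<le> cycle_resistance k i j"
proof -
  define d where "d = \<bar>real i - real j\<bar>"
  have nx: "(i + 1) mod k = (if i + 1 = k then 0 else i + 1)" using assms by auto
  have pv: "(i + k - 1) mod k = (if i = 0 then k - 1 else i - 1)" using assms by (auto simp: mod_if)
  have "i + 2 \<le> j \<and> j + 2 \<le> i + k \<or> j + 2 \<le> i \<and> i + 2 \<le> j + k"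
    using assms(1-3) assms(4,5)[unfolded nx pv] by (auto split: if_splits)
  then have "2 \<le> d" "d \<le> real k - 2" unfolding d_def by linarith+
  then have "0 \<le> (d - 2) * (real k - 2 - d)" by (intro mult_nonneg_nonneg) auto
  then show ?thesis
    unfolding cycle_resistance_def d_def[symmetric] by (intro divide_right_mono) (simp_all add: algebra_simps)
qed

lemma near_sum_le:
  assumes "3 \<le> k" "S \<subseteq> {..<k}" "c \<in> S"
  shows "near_sum k (card S) \<le> (\<Sum>j\<in>S. cycle_resistance k c j)"
proof -
  have fin: "finite S" using assms(2) finite_subset by blast
  have c: "c < k" using assms by auto
  have card: "real (card (S - {c})) = real (card S) - 1"
  proof -
    have "1 \<le> card S" using fin assms(3) by (auto simp: Suc_le_eq card_gt_0_iff)
    then show ?thesis using fin assms(3) by (simp add: of_nat_diff)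
  qed
  have sum: "(\<Sum>j\<in>S. cycle_resistance k c j) = (\<Sum>j\<in>S - {c}. cycle_resistance k c j)"
    using fin assms(3) by (simp add: sum.remove[of S c])
  show ?thesis
  proof (cases "card S \<le> 3")
    case True
    have "near_sum k (card S) = (\<Sum>j\<in>S - {c}. (real k - 1) / k)"
      using True card by (simp add: near_sum_def)
    also have "\<dots> \<le> (\<Sum>j\<in>S - {c}. cycle_resistance k c j)"
      using assms c by (intro sum_mono cycle_resistance_ge_1) auto
    finally show ?thesis unfolding sum .
  next
    case False
    define B where "B = {(c + 1) mod k, (c + k - 1) mod k}"
    have "real (card B) \<le> 2" by (simp add: B_def card_insert_if)
    moreover have "card (B \<inter> (S - {c})) \<le> card B" by (intro card_mono) (simp_all add: B_def)
    ultimately have B: "real (card (B \<inter> (S - {c}))) \<le> 2" by linarith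
    \<comment> \<open>Every member is charged the value at distance two; the cyclic neighbours in
      \<open>B\<close> are refunded \<open>(k - 3) / k\<close>, which leaves
      \<open>(k - 1) / k\<close>.\<close>
    have "2 * (real k - 2) / k - (if j \<in> B then (real k - 3) / k else 0) \<le> cycle_resistance k c j"
      if "j \<in> S - {c}" for j
    proof (cases "j \<in> B")
      case True
      have "2 * (real k - 2) / k - (real k - 3) / k = (real k - 1) / k"
        by (simp add: diff_divide_distrib[symmetric])
      then show ?thesis using True that assms c cycle_resistance_ge_1[of c k j] by auto
    next
      case False
      then show ?thesis using that assms c cycle_resistance_ge_2[of c k j] by (auto simp: B_def)
    qed
    then have "(\<Sum>j\<in>S - {c}. 2 * (real k - 2) / k - (if j \<in> B then (real k - 3) / k else 0))
        \<le> (\<Sum>j\<in>S - {c}. cycle_resistance k c j)"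
      by (rule sum_mono)
    moreover have "(\<Sum>j\<in>S - {c}. 2 * (real k - 2) / k - (if j \<in> B then (real k - 3) / k else 0))
      = (real (card S) - 1) * (2 * (real k - 2) / k) - real (card (B \<inter> (S - {c}))) * ((real k - 3) / k)"
      using fin card by (simp add: sum_subtractf sum.If_cases Int_commute)
    moreover have "real (card (B \<inter> (S - {c}))) * ((real k - 3) / k) \<le> 2 * ((real k - 3) / k)"
      using B assms(1) by (intro mult_right_mono) auto
    moreover have "near_sum k (card S) = (real (card S) - 1) * (2 * (real k - 2) / k) - 2 * ((real k - 3) / k)"
      using False assms(1) by (simp add: near_sum_def field_simps)
    ultimately show ?thesis unfolding sum by linarith
  qed
qed

lemma pair_sum_ge:
  assumes "3 \<le> k" "S \<subseteq> {..<k}"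
  shows "real (card S) / 2 * near_sum k (card S) \<le> pair_sum k S"
proof -
  have "(\<Sum>c\<in>S. near_sum k (card S)) \<le> (\<Sum>c\<in>S. \<Sum>j\<in>S. cycle_resistance k c j)"
    using near_sum_le[OF assms] by (rule sum_mono)
  then show ?thesis by (simp add: pair_sum_def)
qed

text \<open>All rows of the cycle have the same sum. Adding the rows over \<open>S\<close> and over
  the complement and subtracting cancels the mixed terms.\<close>

lemma pair_sum_complement:
  assumes "S \<subseteq> {..<k}"
  shows "pair_sum k S = (real k ^ 3 - real k) / 12 - (real k - real (card S)) * (real k ^ 2 - 1) / 6
    + pair_sum k ({..<k} - S)"
proof -
  let ?T = "{..<k} - S" and ?r = "cycle_resistance k"
  define \<rho> where "\<rho> = (real k ^ 2 - 1) / 6"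
  have row: "(\<Sum>j\<in>S. ?r i j) + (\<Sum>j\<in>?T. ?r i j) = \<rho>" if "i < k" for i
    using sum.subset_diff[OF assms finite_lessThan, of "?r i"] sum_cycle_resistance[OF that] by (simp add: \<rho>_def)
  have card: "card ?T = k - card S" "card S \<le> k"
    using assms card_mono[of "{..<k}" S] by (auto simp: card_Diff_subset finite_subset)
  have SS: "(\<Sum>i\<in>S. (\<Sum>j\<in>S. ?r i j) + (\<Sum>j\<in>?T. ?r i j)) = real (card S) * \<rho>"
    using assms row by (subst sum.cong[OF refl, of _ _ "\<lambda>_. \<rho>"]) auto
  have TT: "(\<Sum>i\<in>?T. (\<Sum>j\<in>S. ?r i j) + (\<Sum>j\<in>?T. ?r i j)) = real (card ?T) * \<rho>"
    using row by (subst sum.cong[OF refl, of _ _ "\<lambda>_. \<rho>"]) auto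
  have "(\<Sum>i\<in>?T. \<Sum>j\<in>S. ?r i j) = (\<Sum>i\<in>S. \<Sum>j\<in>?T. ?r i j)"
    by (subst sum.swap) (simp add: cycle_resistance_commute)
  then have "2 * pair_sum k S - 2 * pair_sum k ?T = real (card S) * \<rho> - real (card ?T) * \<rho>"
    using SS TT by (simp add: pair_sum_def sum.distrib)
  moreover have cube: "(real k ^ 3 - real k) / 12 = real k * \<rho> / 2"
    by (simp add: \<rho>_def field_simps power2_eq_square power3_eq_cube)
  moreover have lin: "(real k - real (card S)) * (real k ^ 2 - 1) / 6 = (real k - real (card S)) * \<rho>"
    by (simp add: \<rho>_def)
  ultimately show ?thesis unfolding cube lin using card by (simp add: of_nat_diff algebra_simps)
qed

text \<open>The cost is scaled by \<open>2 k\<close>, to be an integer.\<close>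

definition list_cost :: "nat \<Rightarrow> nat list \<Rightarrow> int" where
  "list_cost k xs = sum_list (map (\<lambda>i. sum_list (map (\<lambda>j.
     \<bar>int i - int j\<bar> * (int k - \<bar>int i - int j\<bar>)) xs)) xs)"

text \<open>Subsets are enumerated as subsequences of \<open>[0..<k]\<close> so that the statement
  can be evaluated; \<open>r\<close> ranges over the rotations of the block of \<open>s\<close>
  consecutive vertices.\<close>

definition consecutive_check :: "nat \<Rightarrow> nat \<Rightarrow> int \<Rightarrow> bool" where
  "consecutive_check k s t \<longleftrightarrow> list_all (\<lambda>xs. length xs = s \<longrightarrow> list_cost k xs > t \<or> list_cost k xs = t \<and>
     list_ex (\<lambda>r. list_all (\<lambda>i. (i + r) mod k \<in> set xs) [0..<s]) [0..<k]) (subseqs [0..<k])"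

text \<open>The last arguments are \<open>2 * k\<close> times 5/6, 7/8, 22/7 and 15/2, the pair sums
  of consecutive vertices.\<close>

lemma consecutive_check:
  "consecutive_check 6 2 10" "consecutive_check 8 2 14" "consecutive_check 7 3 44" "consecutive_check 8 4 120"
  by code_simp+

lemma filter_in_subseqs: "filter P xs \<in> set (subseqs xs)"
  by (induction xs) (auto simp: Let_def)

lemma consecutive_minimal:
  assumes check: "consecutive_check k s t" and S: "S \<subseteq> {..<k}" "card S = s" and "0 < k" "s \<le> k"
  shows "of_int t / (2 * real k) \<le> pair_sum k S"
    and "pair_sum k S = of_int t / (2 * real k) \<Longrightarrow> \<exists>r<k. S = (\<lambda>i. (i + r) mod k) ` {..<s}"
proof -
  define xs where "xs = filter (\<lambda>i. i \<in> S) [0..<k]"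
  have xs: "set xs = S" "distinct xs" using S by (auto simp: xs_def)
  with S(2) distinct_card[OF xs(2)] have len: "length xs = s" by simp
  have mem: "xs \<in> set (subseqs [0..<k])" by (simp add: xs_def filter_in_subseqs)
  have *: "list_cost k xs > t \<or> list_cost k xs = t \<and>
      (\<exists>r<k. \<forall>i<s. (i + r) mod k \<in> S)"
    using bspec[OF check[unfolded consecutive_check_def list_all_iff] mem] len xs(1)
    by (auto simp: list_ex_iff)
  have cost: "2 * real k * pair_sum k S = of_int (list_cost k xs)"
  proof -
    have "of_int (list_cost k xs) = (\<Sum>i\<in>S. \<Sum>j\<in>S. real k * cycle_resistance k i j)"
      unfolding list_cost_def using assms(4) xs(1,2)
      by (simp add: sum_list_distinct_conv_sum_set cycle_resistance_def)
    then show ?thesis by (simp add: pair_sum_def sum_distrib_left[symmetric])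
  qed
  then have eq: "pair_sum k S - of_int t / (2 * real k) = of_int (list_cost k xs - t) / (2 * real k)"
    using assms(4) by (simp add: field_simps)
  have "0 \<le> of_int (list_cost k xs - t) / (2 * real k)" using * by (intro divide_nonneg_nonneg) auto
  then show "of_int t / (2 * real k) \<le> pair_sum k S" using eq by linarith
  assume "pair_sum k S = of_int t / (2 * real k)"
  then have "list_cost k xs = t" using eq assms(4) by simp
  then obtain r where r: "r < k" "\<forall>i<s. (i + r) mod k \<in> S" using * by auto
  \<comment> \<open>The check yields inclusion of the block only; injectivity and equal cardinality
    turn it into equality.\<close>
  have "inj_on (\<lambda>i. (i + r) mod k) {..<s}"
  proof (rule inj_onI)
    fix x y assume xy: "x \<in> {..<s}" "y \<in> {..<s}" "(x + r) mod k = (y + r) mod k"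
    have "(z + r) mod k = (if z + r < k then z + r else z + r - k)" if "z < k" for z
      using that r(1) by (auto simp: mod_if)
    from this[of x] this[of y] show "x = y" using xy assms(5) by (auto split: if_splits)
  qed
  then have "card ((\<lambda>i. (i + r) mod k) ` {..<s}) = card S" using S by (simp add: card_image)
  moreover have "(\<lambda>i. (i + r) mod k) ` {..<s} \<subseteq> S" using r by auto
  moreover have "finite S" using S finite_subset by blast
  ultimately have "(\<lambda>i. (i + r) mod k) ` {..<s} = S" by (intro card_subset_eq)
  then show "\<exists>r<k. S = (\<lambda>i. (i + r) mod k) ` {..<s}" using r by auto
qed

lemma pair_min_le:
  assumes "3 \<le> k" "S \<subseteq> {..<k}"
  shows "pair_min k (card S) \<le> pair_sum k S"
proof -
  have card: "card ({..<k} - S) = k - card S" "card S \<le> k"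
    using assms card_mono[of "{..<k}" S] by (auto simp: card_Diff_subset finite_subset)
  have "real (k - card S) / 2 * near_sum k (k - card S) \<le> pair_sum k ({..<k} - S)"
    using pair_sum_ge[of k "{..<k} - S"] assms card by simp
  then have "(real k ^ 3 - real k) / 12 - (real k - real (card S)) * (real k ^ 2 - 1) / 6
         + (real k - real (card S)) / 2 * near_sum k (k - card S) \<le> pair_sum k S"
    using pair_sum_complement[OF assms(2)] card by (simp add: of_nat_diff)
  moreover have "real (card S) / 2 * near_sum k (card S) \<le> pair_sum k S"
    by (rule pair_sum_ge[OF assms])
  moreover have "22 / 7 \<le> pair_sum k S" if "k = 7" "card S = 3"
    using consecutive_minimal(1)[OF consecutive_check(3), of S] that assms by simp
  moreover have "15 / 2 \<le> pair_sum k S" if "k = 8" "card S = 4"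
    using consecutive_minimal(1)[OF consecutive_check(4), of S] that assms by simp
  ultimately show ?thesis unfolding pair_min_def by auto
qed

text \<open>Because all rows have the same sum, the linear terms see only the total of
  \<open>x\<close>. The placement of the trees enters through the quadratic part alone.\<close>

lemma quadratic_form_shift:
  "(\<Sum>i<k. \<Sum>j<k. (1 + x i) * (1 + x j) * cycle_resistance k i j) / 2
    = (real k ^ 3 - real k) / 12 + (\<Sum>i<k. x i) * (real k ^ 2 - 1) / 6
      + (\<Sum>i<k. \<Sum>j<k. x i * x j * cycle_resistance k i j) / 2"
proof -
  let ?r = "cycle_resistance k"
  define \<rho> where "\<rho> = (real k ^ 2 - 1) / 6"
  have row: "(\<Sum>j<k. ?r i j) = \<rho>" if "i < k" for i using sum_cycle_resistance[OF that] by (simp add: \<rho>_def)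
  have A: "(\<Sum>i<k. \<Sum>j<k. ?r i j) = real k * \<rho>"
    by (subst sum.cong[OF refl, of _ _ "\<lambda>_. \<rho>"]) (auto simp: row)
  have B: "(\<Sum>i<k. \<Sum>j<k. x i * ?r i j) = (\<Sum>i<k. x i) * \<rho>"
    by (simp add: sum_distrib_left[symmetric] sum_distrib_right row cong: sum.cong_simp)
  have C: "(\<Sum>i<k. \<Sum>j<k. x j * ?r i j) = (\<Sum>i<k. x i) * \<rho>"
    by (subst sum.swap) (simp add: cycle_resistance_commute[of k] B[symmetric])
  have "(\<Sum>i<k. \<Sum>j<k. (1 + x i) * (1 + x j) * ?r i j)
    = (\<Sum>i<k. \<Sum>j<k. ?r i j) + (\<Sum>i<k. \<Sum>j<k. x i * ?r i j) + (\<Sum>i<k. \<Sum>j<k. x j * ?r i j)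
      + (\<Sum>i<k. \<Sum>j<k. x i * x j * ?r i j)"
    unfolding sum.distrib[symmetric] by (intro sum.cong refl) (simp add: algebra_simps)
  moreover have cube: "(real k ^ 3 - real k) / 12 = real k * \<rho> / 2"
    by (simp add: \<rho>_def field_simps power2_eq_square power3_eq_cube)
  moreover have lin: "(\<Sum>i<k. x i) * (real k ^ 2 - 1) / 6 = (\<Sum>i<k. x i) * \<rho>" by (simp add: \<rho>_def)
  ultimately show ?thesis unfolding A B C cube lin by simp
qed

text \<open>The indicator of \<open>S\<close> accounts for the one vertex each non-trivial tree must
  have, \<open>y\<close> for the rest. The choice of \<open>S\<close> and the distribution of
  \<open>y\<close> can then be estimated separately.\<close>

lemma quadratic_form_split:
  fixes y :: "nat \<Rightarrow> real"
  assumes "S \<subseteq> {..<k}" "\<And>i. i \<notin> S \<Longrightarrow> y i = 0"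
  shows "(\<Sum>i<k. \<Sum>j<k. (of_bool (i \<in> S) + y i) * (of_bool (j \<in> S) + y j) * cycle_resistance k i j) / 2
    = pair_sum k S + (\<Sum>c\<in>S. y c * (\<Sum>j\<in>S. cycle_resistance k c j))
      + (\<Sum>i\<in>S. \<Sum>j\<in>S. y i * y j * cycle_resistance k i j) / 2"
proof -
  let ?r = "cycle_resistance k"
  have restrict: "(\<Sum>i<k. g i) = (\<Sum>i\<in>S. g i)" if "\<And>i. i \<notin> S \<Longrightarrow> g i = 0" for g :: "nat \<Rightarrow> real"
    using assms(1) that by (intro sum.mono_neutral_right) auto
  have "(\<Sum>i<k. \<Sum>j<k. (of_bool (i \<in> S) + y i) * (of_bool (j \<in> S) + y j) * ?r i j)
     = (\<Sum>i\<in>S. \<Sum>j<k. (of_bool (i \<in> S) + y i) * (of_bool (j \<in> S) + y j) * ?r i j)"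
    by (rule restrict) (simp add: assms(2))
  also have "\<dots> = (\<Sum>i\<in>S. \<Sum>j\<in>S. (of_bool (i \<in> S) + y i) * (of_bool (j \<in> S) + y j) * ?r i j)"
    by (intro sum.cong refl restrict) (simp add: assms(2))
  also have "\<dots> = (\<Sum>i\<in>S. \<Sum>j\<in>S. ?r i j + y i * ?r i j + y j * ?r i j + y i * y j * ?r i j)"
    by (intro sum.cong refl) (simp add: algebra_simps)
  also have "\<dots> = (\<Sum>i\<in>S. \<Sum>j\<in>S. ?r i j) + (\<Sum>i\<in>S. y i * (\<Sum>j\<in>S. ?r i j)) + (\<Sum>i\<in>S. \<Sum>j\<in>S. y j * ?r i j)
     + (\<Sum>i\<in>S. \<Sum>j\<in>S. y i * y j * ?r i j)"
    by (simp add: sum.distrib sum_distrib_left)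
  also have "(\<Sum>i\<in>S. \<Sum>j\<in>S. y j * ?r i j) = (\<Sum>i\<in>S. y i * (\<Sum>j\<in>S. ?r i j))"
    by (subst sum.swap) (simp add: cycle_resistance_commute[of k] sum_distrib_left)
  finally show ?thesis by (simp add: pair_sum_def)
qed

section \<open>The lower bound for graphs\<close>

lemma sum_eq_one_singleton:
  fixes f :: "'b \<Rightarrow> nat"
  assumes "finite K" "(\<Sum>y\<in>K. f y) = 1" "\<And>y. y \<in> K \<Longrightarrow> 1 \<le> f y"
  obtains y where "K = {y}" "f y = 1"
proof -
  have "card K \<le> (\<Sum>y\<in>K. f y)" using sum_mono[of K "\<lambda>_. 1" f] assms(3) by simp
  moreover have "K \<noteq> {}" using assms(2) by auto
  ultimately have "card K = 1" using assms(1,2) card_gt_0_iff[of K] by linarith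
  then obtain y where "K = {y}" by (rule card_1_singletonE)
  then show ?thesis using assms(2) that by simp
qed

context unicyclic_rep
begin

definition "occ = {i. i < k \<and> 2 \<le> card (D (v i))}"
text \<open>The subtracted 2 stands for the cycle vertex and one obligatory tree vertex.\<close>

definition "surplus i = (if i \<in> occ then real (card (D (v i))) - 2 else 0)"

lemma occ_sub: "occ \<subseteq> {..<k}" and finite_occ [simp]: "finite occ"
  by (auto simp: occ_def)

lemma sum_card_D: "(\<Sum>i<k. card (D (v i))) = card V"
proof -
  have "real (\<Sum>i<k. card (D (v i))) = real (card V)"
    using sum_fibres[of "\<lambda>_. 1"] by simp
  then show ?thesis by (simp only: of_nat_eq_iff)
qed

lemma card_D_not_occ: "i < k \<Longrightarrow> i \<notin> occ \<Longrightarrow> card (D (v i)) = 1"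
  using card_D_pos[OF v_V, of i] by (auto simp: occ_def)

lemma card_D_surplus: "i < k \<Longrightarrow> real (card (D (v i))) = 1 + (of_bool (i \<in> occ) + surplus i)"
  using card_D_not_occ[of i] by (auto simp: surplus_def)

lemma surplus_nonneg: "0 \<le> surplus i"
  by (auto simp: surplus_def occ_def)

lemma sum_surplus: "(\<Sum>i\<in>occ. surplus i) = real (card T) - real (card occ)"
proof -
  have "real k + real (card T) = (\<Sum>i<k. 1 + (of_bool (i \<in> occ) + surplus i))"
    using sum_card_D verts_card card_D_surplus
    by (metis (mono_tags, lifting) lessThan_iff of_nat_add of_nat_sum sum.cong)
  also have "\<dots> = real k + (\<Sum>i<k. of_bool (i \<in> occ)) + (\<Sum>i<k. surplus i)"
    by (simp add: sum.distrib)
  also have "(\<Sum>i<k. of_bool (i \<in> occ)) = real (card occ)"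
    using occ_sub by (simp add: of_bool_def sum.If_cases Int_absorb1)
  also have "(\<Sum>i<k. surplus i) = (\<Sum>i\<in>occ. surplus i)"
    using occ_sub by (intro sum.mono_neutral_right) (auto simp: surplus_def)
  finally show ?thesis by simp
qed

lemma card_occ_le: "card occ \<le> card T"
  using sum_surplus sum_nonneg[of occ surplus] surplus_nonneg by simp

lemma Kirchhoff_expand:
  "Kirchhoff_index G = (\<Sum>t\<in>T. real (card (D t)) * (real (card V) - real (card (D t))))
    + (real k ^ 3 - real k) / 12 + real (card T) * (real k ^ 2 - 1) / 6 + pair_sum k occ
    + (\<Sum>c\<in>occ. surplus c * (\<Sum>j\<in>occ. cycle_resistance k c j))
    + (\<Sum>i\<in>occ. \<Sum>j\<in>occ. surplus i * surplus j * cycle_resistance k i j) / 2"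
proof -
  let ?x = "\<lambda>i. of_bool (i \<in> occ) + surplus i"
  have "(\<Sum>i<k. ?x i) = real (card T)"
  proof -
    have "real k + (\<Sum>i<k. ?x i) = (\<Sum>i<k. real (card (D (v i))))"
      using card_D_surplus by (simp add: sum.distrib)
    also have "\<dots> = real (card V)" using sum_card_D by (metis of_nat_sum)
    finally show ?thesis using verts_card by simp
  qed
  moreover have "(\<Sum>i<k. \<Sum>j<k. real (card (D (v i))) * real (card (D (v j))) * cycle_resistance k i j)
    = (\<Sum>i<k. \<Sum>j<k. (1 + ?x i) * (1 + ?x j) * cycle_resistance k i j)"
    using card_D_surplus by (intro sum.cong refl) auto
  moreover have "\<And>i. i \<notin> occ \<Longrightarrow> surplus i = 0" by (simp add: surplus_def)
  ultimately show ?thesis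
    unfolding Kirchhoff_eq using quadratic_form_shift[of ?x k] quadratic_form_split[OF occ_sub, of surplus] by simp
qed

lemma card_D_tree_le: "t \<in> T \<Longrightarrow> card (D t) + 3 \<le> card V"
  using card_mono[OF finT D_T_sub[of t]] verts_card k3 by simp

text \<open>\<open>b * (n - b)\<close> is \<open>n - 1\<close> at \<open>b = 1\<close> and exceeds
  its value \<open>2 * n - 4\<close> at \<open>b = 2\<close> by
  \<open>(b - 2) * (n - b - 2)\<close>. The second factor is positive, as at least three cycle
  vertices are not below \<open>t\<close>.\<close>

lemma bridge_ge:
  assumes "t \<in> T"
  shows "real (card V) - 1 + of_bool (t \<in> inner) * (real (card V) - 3)
    \<le> real (card (D t)) * (real (card V) - real (card (D t)))"
    and "2 < card (D t) \<Longrightarrow> real (card V) - 1 + of_bool (t \<in> inner) * (real (card V) - 3)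
    < real (card (D t)) * (real (card V) - real (card (D t)))"
proof -
  define b where "b = real (card (D t))"
  define n where "n = real (card V)"
  have bn: "b + 3 \<le> n" using card_D_tree_le[OF assms] by (simp add: b_def n_def flip: of_nat_add)
  have pos: "0 < card (D t)" using card_D_pos assms by simp
  have eq: "b * (n - b) = 2 * n - 4 + (b - 2) * (n - b - 2)" by (simp add: algebra_simps)
  show "n - 1 + of_bool (t \<in> inner) * (n - 3) \<le> b * (n - b)"
  proof (cases "t \<in> inner")
    case True
    then have "2 \<le> b" by (simp add: inner_def b_def)
    then have "0 \<le> (b - 2) * (n - b - 2)" using bn by (intro mult_nonneg_nonneg) auto
    then show ?thesis using True eq by simp
  next
    case False
    then have "b = 1" using pos assms by (auto simp: inner_def b_def)
    then show ?thesis using False by simp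
  qed
  assume "2 < card (D t)"
  then have "t \<in> inner" "2 < b" using assms by (auto simp: inner_def b_def)
  then have "0 < (b - 2) * (n - b - 2)" using bn by (intro mult_pos_pos) auto
  then show "n - 1 + of_bool (t \<in> inner) * (n - 3) < b * (n - b)" using \<open>t \<in> inner\<close> eq by simp
qed

lemma sum_bridge_bound:
  "(\<Sum>t\<in>T. real (card V) - 1 + of_bool (t \<in> inner) * (real (card V) - 3))
    = real (card T) * (real (card V) - 1) + real (card inner) * (real (card V) - 3)"
proof -
  have "T \<inter> {t. t \<in> inner} = inner" by (auto simp: inner_def)
  then show ?thesis
    by (simp add: sum.distrib sum_distrib_right[symmetric] of_bool_def sum.If_cases)
qed

text \<open>The index exceeds the bound by four nonnegative gaps: bridges with more than two
  descendants, a non-optimal set of positions, surplus at a vertex whose row exceeds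
  \<open>near_sum\<close> (\<open>B\<close>), and surplus at two different vertices
  (\<open>C\<close>). Equality makes all of them vanish; the last two concentrate the surplus at one
  optimal centre.\<close>

lemma Kirchhoff_lower_bound:
  assumes "T \<noteq> {}"
  shows "Kf_bound (card V) k (card occ) (card inner) \<le> Kirchhoff_index G"
    and "Kirchhoff_index G = Kf_bound (card V) k (card occ) (card inner) \<Longrightarrow>
      (\<forall>t\<in>T. card (D t) \<le> 2) \<and> pair_sum k occ = pair_min k (card occ)
      \<and> (\<exists>c\<in>occ. \<forall>i\<in>occ. i \<noteq> c \<longrightarrow> card (D (v i)) = 2)
      \<and> (\<forall>c\<in>occ. 2 < card (D (v c)) \<longrightarrow> (\<Sum>j\<in>occ. cycle_resistance k c j) = near_sum k (card occ))"
proof -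
  define A where "A = (\<Sum>t\<in>T. real (card (D t)) * (real (card V) - real (card (D t))))"
  define A0 where "A0 = real (card T) * (real (card V) - 1) + real (card inner) * (real (card V) - 3)"
  define \<rho> where "\<rho> = near_sum k (card occ)"
  define R where "R c = (\<Sum>j\<in>occ. cycle_resistance k c j)" for c
  define B where "B = (\<Sum>c\<in>occ. surplus c * (R c - \<rho>))"
  define C where "C = (\<Sum>i\<in>occ. \<Sum>j\<in>occ. surplus i * surplus j * cycle_resistance k i j)"
  have A: "A0 \<le> A"
    unfolding A_def A0_def sum_bridge_bound[symmetric] using bridge_ge(1) by (rule sum_mono)
  have R: "\<rho> \<le> R c" if "c \<in> occ" for c
    unfolding R_def \<rho>_def using near_sum_le[OF k3 occ_sub that] .
  have B: "0 \<le> B"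
    unfolding B_def using R surplus_nonneg by (intro sum_nonneg mult_nonneg_nonneg) auto
  have Cij: "0 \<le> surplus i * surplus j * cycle_resistance k i j" if "i \<in> occ" "j \<in> occ" for i j
    using that occ_sub surplus_nonneg by (intro mult_nonneg_nonneg cycle_resistance_nonneg) auto
  then have C: "0 \<le> C" unfolding C_def by (intro sum_nonneg) auto
  have "(\<Sum>c\<in>occ. surplus c * R c) = B + (real (card T) - real (card occ)) * \<rho>"
    unfolding B_def sum_surplus[symmetric] by (simp add: right_diff_distrib sum_subtractf sum_distrib_right)
  then have Kf: "Kirchhoff_index G = Kf_bound (card V) k (card occ) (card inner) + (A - A0)
      + (pair_sum k occ - pair_min k (card occ)) + B + C / 2"
    unfolding Kirchhoff_expand Kf_bound_def A_def[symmetric] R_def[symmetric] C_def[symmetric] \<rho>_def[symmetric]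
    using verts_card by (simp add: A0_def)
  have P: "pair_min k (card occ) \<le> pair_sum k occ" by (rule pair_min_le[OF k3 occ_sub])
  show "Kf_bound (card V) k (card occ) (card inner) \<le> Kirchhoff_index G"
    unfolding Kf using A P B C by simp
  assume "Kirchhoff_index G = Kf_bound (card V) k (card occ) (card inner)"
  then have eqs: "A = A0" "pair_sum k occ = pair_min k (card occ)" "B = 0" "C = 0"
    using Kf A P B C by linarith+
  have "card (D t) \<le> 2" if "t \<in> T" for t
  proof (rule ccontr)
    assume "\<not> card (D t) \<le> 2"
    then have strict: "real (card V) - 1 + of_bool (t \<in> inner) * (real (card V) - 3)
        < real (card (D t)) * (real (card V) - real (card (D t)))"
      using bridge_ge(2)[OF that] by simp
    have ex: "\<exists>t\<in>T. real (card V) - 1 + of_bool (t \<in> inner) * (real (card V) - 3)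
        < real (card (D t)) * (real (card V) - real (card (D t)))"
      using strict that by (rule bexI)
    have "A0 < A"
      unfolding A_def A0_def sum_bridge_bound[symmetric]
      by (intro sum_strict_mono_ex1[OF finT _ ex] ballI bridge_ge(1))
    then show False using eqs by simp
  qed
  moreover have big: "R c = \<rho>" if "c \<in> occ" "2 < card (D (v c))" for c
  proof -
    have "\<forall>c\<in>occ. surplus c * (R c - \<rho>) = 0"
      using eqs(3) R surplus_nonneg unfolding B_def
      by (subst (asm) sum_nonneg_eq_0_iff) (auto intro!: mult_nonneg_nonneg)
    then show ?thesis using that by (auto simp: surplus_def)
  qed
  moreover have "\<exists>c\<in>occ. \<forall>i\<in>occ. i \<noteq> c \<longrightarrow> card (D (v i)) = 2"
  proof (cases "\<exists>c\<in>occ. 2 < card (D (v c))")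
    case True
    then obtain c where c: "c \<in> occ" "2 < card (D (v c))" by blast
    have "card (D (v i)) = 2" if i: "i \<in> occ" "i \<noteq> c" for i
    proof -
      have row: "0 \<le> (\<Sum>j\<in>occ. surplus i * surplus j * cycle_resistance k i j)" if "i \<in> occ" for i
        using Cij that by (intro sum_nonneg)
      have "\<forall>i\<in>occ. (\<Sum>j\<in>occ. surplus i * surplus j * cycle_resistance k i j) = 0"
        using sum_nonneg_eq_0_iff[of occ "\<lambda>i. \<Sum>j\<in>occ. surplus i * surplus j * cycle_resistance k i j"]
          row eqs(4) unfolding C_def by simp
      then have "(\<Sum>j\<in>occ. surplus i * surplus j * cycle_resistance k i j) = 0" using i(1) by blast
      then have "\<forall>j\<in>occ. surplus i * surplus j * cycle_resistance k i j = 0"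
        by (rule iffD1[OF sum_nonneg_eq_0_iff, rotated 2]) (simp_all only: finite_occ Cij[OF i(1)])
      \<comment> \<open>Distinct positions have positive resistance, so two positive surpluses
        cannot coexist.\<close>
      then have "surplus i * surplus c * cycle_resistance k i c = 0" using c(1) by blast
      moreover have "0 < cycle_resistance k i c"
      proof -
        have "i < k" "c < k" using i(1) c(1) by (auto simp: occ_def)
        then have "(real k - 1) / k \<le> cycle_resistance k i c" using i(2) by (rule cycle_resistance_ge_1)
        moreover have "0 < (real k - 1) / k" using k3 by simp
        ultimately show ?thesis by linarith
      qed
      moreover have "0 < surplus c" using c by (simp add: surplus_def)
      ultimately have "surplus i = 0" by simp
      then show ?thesis using i by (simp add: surplus_def)
    qed
    then show ?thesis using c by blast
  next
    case False
    \<comment> \<open>Without surplus any occupied position serves as \<open>c\<close>; one exists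
      because there are trees.\<close>
    have "occ \<noteq> {}"
    proof
      assume "occ = {}"
      then have "card V = k" using sum_card_D card_D_not_occ by simp
      then show False using verts_card assms by simp
    qed
    then show ?thesis using False by (force simp: occ_def)
  qed
  ultimately show "(\<forall>t\<in>T. card (D t) \<le> 2) \<and> pair_sum k occ = pair_min k (card occ)
      \<and> (\<exists>c\<in>occ. \<forall>i\<in>occ. i \<noteq> c \<longrightarrow> card (D (v i)) = 2)
      \<and> (\<forall>c\<in>occ. 2 < card (D (v c)) \<longrightarrow> (\<Sum>j\<in>occ. cycle_resistance k c j) = near_sum k (card occ))"
    using eqs(2) unfolding R_def \<rho>_def by blast
qed

text \<open>Under these conditions the bridge estimate is exact and the surplus sits at
  \<open>c\<close> alone; this evaluates the candidate graphs.\<close>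

lemma Kirchhoff_flat:
  assumes flat: "\<And>t. t \<in> T \<Longrightarrow> card (D t) \<le> 2" and c: "c \<in> occ"
    and two: "\<And>i. i \<in> occ \<Longrightarrow> i \<noteq> c \<Longrightarrow> card (D (v i)) = 2"
  shows "Kirchhoff_index G = real (card T) * (real (card V) - 1) + real (card inner) * (real (card V) - 3)
    + (real k ^ 3 - real k) / 12 + real (card T) * (real k ^ 2 - 1) / 6 + pair_sum k occ
    + (real (card T) - real (card occ)) * (\<Sum>j\<in>occ. cycle_resistance k c j)"
proof -
  have s0: "surplus i = 0" if "i \<noteq> c" for i using two[of i] that by (auto simp: surplus_def)
  have only: "(\<Sum>i\<in>occ. surplus i * g i) = surplus c * g c" for g
    using c s0 by (subst sum.remove[of _ c]) (auto intro!: sum.neutral)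
  have "(\<Sum>i\<in>occ. \<Sum>j\<in>occ. surplus i * surplus j * cycle_resistance k i j)
    = (\<Sum>i\<in>occ. surplus i * (\<Sum>j\<in>occ. surplus j * cycle_resistance k i j))"
    by (simp add: sum_distrib_left mult.assoc)
  also have "\<dots> = 0" unfolding only by simp
  finally have C: "(\<Sum>i\<in>occ. \<Sum>j\<in>occ. surplus i * surplus j * cycle_resistance k i j) = 0" .
  have "surplus c = real (card T) - real (card occ)"
    using only[of "\<lambda>_. 1"] sum_surplus by simp
  moreover have "(\<Sum>t\<in>T. real (card (D t)) * (real (card V) - real (card (D t))))
      = (\<Sum>t\<in>T. real (card V) - 1 + of_bool (t \<in> inner) * (real (card V) - 3))"
  proof (rule sum.cong[OF refl])
    fix t assume t: "t \<in> T"
    then have "card (D t) = 1 \<or> card (D t) = 2" using flat[OF t] card_D_pos[of t] by auto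
    then show "real (card (D t)) * (real (card V) - real (card (D t)))
      = real (card V) - 1 + of_bool (t \<in> inner) * (real (card V) - 3)"
      using t by (auto simp: inner_def)
  qed
  ultimately show ?thesis
    unfolding Kirchhoff_expand only C sum_bridge_bound by simp
qed

lemma leafy_sub_occ: "leafy \<subseteq> occ"
  using card_D_parent by (force simp: leafy_def occ_def)

lemma card_D_children:
  assumes "x \<in> V"
  shows "card (D x) = 1 + (\<Sum>y | y \<in> T \<and> p y = x. card (D y))"
proof -
  have cardD: "real (card (D y)) = (\<Sum>u\<in>V. of_bool (u \<in> D y))" for y
  proof -
    have "V \<inter> {u. u \<in> D y} = D y" by (auto simp: D_def)
    then show ?thesis using fin by (simp add: of_bool_def sum.If_cases)
  qed
  have "real (card (D x)) = (\<Sum>u\<in>V. of_bool (u = x) + (\<Sum>y | y \<in> T \<and> p y = x. of_bool (u \<in> D y)))"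
    unfolding cardD using D_children[OF assms] by (intro sum.cong) auto
  also have "\<dots> = (\<Sum>u\<in>V. of_bool (u = x)) + (\<Sum>y | y \<in> T \<and> p y = x. \<Sum>u\<in>V. of_bool (u \<in> D y))"
    unfolding sum.distrib by (subst sum.swap) simp
  also have "(\<Sum>u\<in>V. of_bool (u = x)) = (1 :: real)"
    using assms fin by (subst sum.remove[of _ x]) (auto intro!: sum.neutral)
  also have "(\<Sum>y | y \<in> T \<and> p y = x. \<Sum>u\<in>V. of_bool (u \<in> D y)) = real (\<Sum>y | y \<in> T \<and> p y = x. card (D y))"
    by (simp add: cardD)
  finally have "real (card (D x)) = real (1 + (\<Sum>y | y \<in> T \<and> p y = x. card (D y)))" by simp
  then show ?thesis by (simp only: of_nat_eq_iff)
qed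

lemma unique_child:
  assumes "x \<in> V" "card (D x) = 2"
  obtains y where "y \<in> T" "p y = x" "card (D y) = 1" "\<And>z. z \<in> T \<Longrightarrow> p z = x \<Longrightarrow> z = y"
proof -
  have "(\<Sum>y | y \<in> T \<and> p y = x. card (D y)) = 1" using card_D_children[OF assms(1)] assms(2) by simp
  moreover have "finite {y. y \<in> T \<and> p y = x}" by simp
  moreover have "1 \<le> card (D y)" if "y \<in> {y. y \<in> T \<and> p y = x}" for y
    using that card_D_pos[of y] by simp
  ultimately obtain y where "{y. y \<in> T \<and> p y = x} = {y}" "card (D y) = 1"
    by (metis (no_types, lifting) sum_eq_one_singleton)
  then show ?thesis using that by blast
qed

end

section \<open>Standard models of the candidate graphs\<close>

lemma rep_iso:
  assumes H: "unicyclic_rep H k v' p'" and G: "unicyclic_rep G k v p"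
    and f: "bij_betw f (verts H) (verts G)"
    and fv: "\<And>i. i < k \<Longrightarrow> f (v' i) = v i"
    and fp: "\<And>x. x \<in> verts H - v' ` {..<k} \<Longrightarrow> f (p' x) = p (f x)"
  shows "H \<simeq>\<^sub>g G"
proof -
  interpret H: unicyclic_rep H k v' p' by (rule H)
  interpret G: unicyclic_rep G k v p by (rule G)
  have Z: "f ` v' ` {..<k} = v ` {..<k}" using fv by (simp add: image_image)
  have inj: "inj_on f (verts H)" and img: "f ` verts H = verts G" using f by (auto simp: bij_betw_def)
  have T: "f ` (verts H - v' ` {..<k}) = verts G - v ` {..<k}"
    using inj_on_image_set_diff[OF inj Diff_subset H.cyc_sub] Z img by simp
  have nx: "(i + 1) mod k < k" for i by (rule H.nx_less)
  have "(\<lambda>e. f ` e) ` {{v' i, v' ((i + 1) mod k)} | i. i < k} = {{v i, v ((i + 1) mod k)} | i. i < k}"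
    using fv nx by (simp add: setcompr_eq_image image_image)
  moreover have "(\<lambda>e. f ` e) ` {{x, p' x} | x. x \<in> verts H - v' ` {..<k}}
    = {{x, p x} | x. x \<in> verts G - v ` {..<k}}"
    unfolding T[symmetric] using fp by (simp add: setcompr_eq_image image_image del: Diff_iff)
  ultimately have "edges G = (\<lambda>e. f ` e) ` edges H"
    unfolding H.edges_eq G.edges_eq image_Un by simp
  then show ?thesis unfolding graph_iso_def using f by blast
qed

text \<open>The last block holds the two-vertex paths: even offsets are the vertices joined to
  \<open>c\<close>, odd offsets the far ends.\<close>

definition U_parent :: "nat \<Rightarrow> nat \<Rightarrow> nat \<Rightarrow> nat \<Rightarrow> nat \<Rightarrow> nat" where
  "U_parent c k t i x = (if x < k then x else if x < k + t then x - k else if x < k + t + i then c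
     else if even (x - (k + t + i)) then c else x - 1)"

lemma U_vertex_cases:
  fixes x k t i j :: nat
  assumes "x < k + t + i + 2 * j"
  obtains "x < k" | s where "s < t" "x = k + s" | a where "a < i" "x = k + t + a"
    | b where "b < j" "x = k + t + i + 2 * b" | b where "b < j" "x = k + t + i + 2 * b + 1"
proof -
  have "x < k \<or> k \<le> x \<and> x < k + t \<or> k + t \<le> x \<and> x < k + t + i \<or> k + t + i \<le> x" by arith
  then consider "x < k" | "k \<le> x" "x < k + t" | "k + t \<le> x" "x < k + t + i" | "k + t + i \<le> x" by blast
  then show ?thesis
  proof cases
    case 2
    then show ?thesis using that(2)[of "x - k"] by simp
  next
    case 3
    then show ?thesis using that(3)[of "x - (k + t)"] by simp
  next
    case 4
    then obtain z where z: "x = k + t + i + z" using le_Suc_ex by blast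
    have "z div 2 < j" using z assms by linarith
    moreover have "z = 2 * (z div 2) \<or> z = 2 * (z div 2) + 1" by linarith
    ultimately show ?thesis using that(4,5)[of "z div 2"] z by (metis add.assoc)
  qed (rule that(1))
qed

lemma U_rep:
  assumes "3 \<le> k" "c < t" "t \<le> k"
  shows "unicyclic_rep (U_centre c k t i j) k id (U_parent c k t i)"
proof
  let ?p = "U_parent c k t i" and ?n = "k + t + i + 2 * j"
  have V: "verts (U_centre c k t i j) = {..<?n}" by (simp add: U_centre_def)
  show "3 \<le> k" "inj_on id {..<k}" "finite (verts (U_centre c k t i j))"
    "id ` {..<k} \<subseteq> verts (U_centre c k t i j)" using assms by (auto simp: V)
  show "?p (id x) = id x" if "x < k" for x using that by (simp add: U_parent_def)
  show "?p x \<in> verts (U_centre c k t i j)" if "x \<in> verts (U_centre c k t i j)" for x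
    using that assms unfolding V by (auto simp: U_parent_def)
  show "\<exists>l. (?p ^^ l) x \<in> id ` {..<k}" if "x \<in> verts (U_centre c k t i j)" for x
  proof -
    have "?p (?p x) < k"
      using that[unfolded V lessThan_iff] assms by (cases rule: U_vertex_cases) (auto simp: U_parent_def)
    then show ?thesis by (intro exI[of _ 2]) (simp add: numeral_2_eq_2)
  qed
  show "edges (U_centre c k t i j) = {{id x, id ((x + 1) mod k)} | x. x < k}
      \<union> {{x, ?p x} | x. x \<in> verts (U_centre c k t i j) - id ` {..<k}}" (is "?E = ?C \<union> ?F")
  proof (intro equalityI subsetI)
    fix e assume "e \<in> ?E"
    then consider "e \<in> ?C" | s where "s < t" "e = {s, k + s}" | a where "a < i" "e = {c, k + t + a}"
      | b where "b < j" "e = {c, k + t + i + 2 * b}"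
      | b where "b < j" "e = {k + t + i + 2 * b, k + t + i + 2 * b + 1}"
      unfolding U_centre_def cycle_graph_def snd_conv id_def by blast
    then have "e \<in> ?C \<or> (\<exists>x. k \<le> x \<and> x < ?n \<and> e = {x, ?p x})"
    proof cases
      case 1
      then show ?thesis ..
    next
      case (2 s)
      then show ?thesis using assms by (intro disjI2 exI[of _ "k + s"]) (auto simp: U_parent_def)
    next
      case (3 a)
      then show ?thesis using assms by (intro disjI2 exI[of _ "k + t + a"]) (auto simp: U_parent_def)
    next
      case (4 b)
      then show ?thesis using assms by (intro disjI2 exI[of _ "k + t + i + 2 * b"]) (auto simp: U_parent_def)
    next
      case (5 b)
      then show ?thesis using assms by (intro disjI2 exI[of _ "k + t + i + 2 * b + 1"]) (auto simp: U_parent_def)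
    qed
    then show "e \<in> ?C \<union> ?F" unfolding V by fastforce
  next
    fix e assume "e \<in> ?C \<union> ?F"
    then consider "e \<in> ?C" | x where "x < ?n" "k \<le> x" "e = {x, ?p x}" unfolding V by fastforce
    then show "e \<in> ?E"
    proof cases
      case 1
      then show ?thesis by (simp add: U_centre_def cycle_graph_def)
    next
      case (2 x)
      from 2(1) show ?thesis
      proof (cases rule: U_vertex_cases)
        case (2 s)
        then have "e = {s, k + s}" using \<open>e = _\<close> by (auto simp: U_parent_def)
        then show ?thesis unfolding U_centre_def snd_conv using 2 by blast
      next
        case (3 a)
        then have "e = {c, k + t + a}" using \<open>e = _\<close> by (auto simp: U_parent_def)
        then show ?thesis unfolding U_centre_def snd_conv using 3 by blast
      next
        case (4 b)
        then have "e = {c, k + t + i + 2 * b}" using \<open>e = _\<close> by (auto simp: U_parent_def)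
        then show ?thesis unfolding U_centre_def snd_conv using 4 by blast
      next
        case (5 b)
        then have "e = {k + t + i + 2 * b, k + t + i + 2 * b + 1}" using \<open>e = _\<close> by (auto simp: U_parent_def)
        then show ?thesis unfolding U_centre_def snd_conv using 5 by blast
      qed (use 2(2) in simp)
    qed
  qed
qed

section \<open>The extremal graphs\<close>

text \<open>By \<open>flat\<close>, a vertex with three descendants lies on the cycle, so all
  non-pendent bridges end at \<open>v c\<close>, whose tree consists of leaves and two-vertex paths.
  That \<open>c\<close> is in \<open>leafy\<close> supplies the pendent vertex which the model
  reserves for the centre.\<close>

lemma (in unicyclic_rep) iso_U_centre:
  assumes flat: "\<And>t. t \<in> T \<Longrightarrow> card (D t) \<le> 2" and c: "c < t" "t \<le> k" "c \<in> leafy"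
    and one: "\<And>i. i < t \<Longrightarrow> i \<noteq> c \<Longrightarrow> card (D (v i)) = 2"
    and zero: "\<And>i. t \<le> i \<Longrightarrow> i < k \<Longrightarrow> card (D (v i)) = 1"
    and q: "q = card inner"
  shows "t + 2 * q \<le> card T" and "G \<simeq>\<^sub>g U_centre c k t (card T - t - 2 * q) q"
proof -
  have ck: "c < k" using c by simp
  have two: "2 \<le> card (D (v c))" using c(3) leafy_sub_occ by (auto simp: occ_def)
  have fin_inner: "finite inner" using fin by (simp add: inner_def)
  have cardc: "card (D (v c)) + t = card T + 2"
  proof -
    have split: "(\<Sum>i<k. g i) = g c + (\<Sum>i\<in>{..<k} - {c}. g i)" for g :: "nat \<Rightarrow> nat"
      using ck by (simp add: sum.remove)
    have "(\<Sum>i\<in>{..<k} - {c}. card (D (v i))) = (\<Sum>i\<in>{..<k} - {c}. 1 + of_bool (i < t))"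
      using one zero by (intro sum.cong refl) (auto simp: not_less)
    moreover have "(\<Sum>i<k. 1 + of_bool (i < t)) = k + t"
    proof -
      have "{..<k} \<inter> {i. i < t} = {..<t}" using c(2) by auto
      then show ?thesis by (simp only: sum.distrib of_bool_def sum.If_cases finite_lessThan) simp
    qed
    ultimately show ?thesis
      using split[of "\<lambda>i. card (D (v i))"] split[of "\<lambda>i. 1 + of_bool (i < t)"] sum_card_D verts_card c(1)
      by simp
  qed
  define L where "L = {y \<in> T. p y = v c \<and> card (D y) = 1}"
  have finL: "finite L" using fin by (simp add: L_def)
  have L_ne: "L \<noteq> {}" using c(3) by (auto simp: L_def leafy_def)
  have inner_parent: "p w = v c" if w: "w \<in> inner" for w
  proof -
    have wT: "w \<in> T" "2 \<le> card (D w)" using w by (auto simp: inner_def)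
    have "card (D w) \<le> (\<Sum>y | y \<in> T \<and> p y = p w. card (D y))"
      using wT by (intro member_le_sum) auto
    then have big: "3 \<le> card (D (p w))"
      using card_D_children[of "p w"] p_verts[of w] wT by simp
    then have "p w \<in> Z" using flat[of "p w"] p_verts[of w] wT by fastforce
    then obtain i where i: "i < k" "p w = v i" by auto
    then have "i = c" using big one[of i] zero[of i] by (cases "i < t"; cases "i = c") auto
    then show ?thesis using i by simp
  qed
  have "{y. y \<in> T \<and> p y = v c} = L \<union> inner"
    using inner_parent card_D_pos by (force simp: L_def inner_def)
  then have "card (D (v c)) = 1 + (\<Sum>y\<in>L \<union> inner. card (D y))"
    using card_D_children[OF v_V[OF ck]] by simp
  also have "(\<Sum>y\<in>L \<union> inner. card (D y)) = (\<Sum>y\<in>L. card (D y)) + (\<Sum>y\<in>inner. card (D y))"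
    using finL fin_inner by (intro sum.union_disjoint) (auto simp: L_def inner_def)
  also have "(\<Sum>y\<in>L. card (D y)) = card L" by (simp add: L_def)
  also have inner2: "card (D y) = 2" if "y \<in> inner" for y
    using that flat[of y] by (auto simp: inner_def)
  then have "(\<Sum>y\<in>inner. card (D y)) = 2 * q" by (simp add: q)
  finally have "card (D (v c)) = 1 + (card L + 2 * q)" .
  then have cardL: "card L + t + 2 * q = card T + 1" using cardc by simp
  moreover have "1 \<le> card L" using L_ne finL by (simp add: Suc_le_eq card_gt_0_iff)
  ultimately show le: "t + 2 * q \<le> card T" by simp
  define i0 where "i0 = card T - t - 2 * q"
  have Li: "card L = Suc i0" and N: "card T = t + i0 + 2 * q" using cardL le by (auto simp: i0_def)
  have "\<forall>w\<in>inner. \<exists>y. y \<in> T \<and> p y = w \<and> card (D y) = 1 \<and> (\<forall>z. z \<in> T \<longrightarrow> p z = w \<longrightarrow> z = y)"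
  proof
    fix w assume w: "w \<in> inner"
    then have "w \<in> V" by (auto simp: inner_def)
    from unique_child[OF this inner2[OF w]]
    show "\<exists>y. y \<in> T \<and> p y = w \<and> card (D y) = 1 \<and> (\<forall>z. z \<in> T \<longrightarrow> p z = w \<longrightarrow> z = y)" by metis
  qed
  then obtain ch where ch: "\<And>w. w \<in> inner \<Longrightarrow> ch w \<in> T \<and> p (ch w) = w \<and> card (D (ch w)) = 1
      \<and> (\<forall>z. z \<in> T \<longrightarrow> p z = w \<longrightarrow> z = ch w)" by metis
  have "\<forall>i\<in>{..<t} - {c}. \<exists>y. y \<in> T \<and> p y = v i \<and> card (D y) = 1 \<and> (\<forall>z. z \<in> T \<longrightarrow> p z = v i \<longrightarrow> z = y)"
  proof
    fix i assume i: "i \<in> {..<t} - {c}"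
    then have "v i \<in> V" using c v_V by simp
    from unique_child[OF this] one[of i] i
    show "\<exists>y. y \<in> T \<and> p y = v i \<and> card (D y) = 1 \<and> (\<forall>z. z \<in> T \<longrightarrow> p z = v i \<longrightarrow> z = y)"
      by (metis DiffE insertI1 lessThan_iff)
  qed
  then obtain lf where lf: "\<And>i. i < t \<Longrightarrow> i \<noteq> c \<Longrightarrow> lf i \<in> T \<and> p (lf i) = v i \<and> card (D (lf i)) = 1
      \<and> (\<forall>z. z \<in> T \<longrightarrow> p z = v i \<longrightarrow> z = lf i)" by (metis DiffI lessThan_iff singletonD)
  obtain l where "bij_betw l {0..<card L} L" using ex_bij_betw_nat_finite[OF finL] by blast
  then have l: "l ` {..<Suc i0} = L" by (simp add: bij_betw_def Li atLeast0LessThan)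
  obtain w where "bij_betw w {0..<card inner} inner" using ex_bij_betw_nat_finite[OF fin_inner] by blast
  then have w: "w ` {..<q} = inner" by (simp add: bij_betw_def q atLeast0LessThan)
  \<comment> \<open>\<open>l 0\<close> takes the place of the pendent vertex \<open>k + c\<close>;
    the other leaves at the centre follow with index shifted by one.\<close>
  define f where "f x = (if x < k then v x else if x < k + t then (if x - k = c then l 0 else lf (x - k))
      else if x < k + t + i0 then l (Suc (x - (k + t)))
      else if even (x - (k + t + i0)) then w ((x - (k + t + i0)) div 2)
      else ch (w ((x - (k + t + i0)) div 2)))" for x
  have f1: "f x = v x" if "x < k" for x using that by (simp add: f_def)
  have f2: "f (k + s) = (if s = c then l 0 else lf s)" if "s < t" for s using that by (simp add: f_def)
  have f3: "f (k + t + a) = l (Suc a)" if "a < i0" for a using that by (simp add: f_def)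
  have f4: "f (k + t + i0 + 2 * b) = w b" for b by (simp add: f_def)
  have f5: "f (k + t + i0 + 2 * b + 1) = ch (w b)" for b by (simp add: f_def)
  have lL: "l a \<in> T \<and> p (l a) = v c" if "a < Suc i0" for a
    using that l by (auto simp: L_def)
  have wI: "w b \<in> inner" if "b < q" for b using that w by auto
  let ?n = "k + t + i0 + 2 * q"
  have range: "f ` {..<?n} = V"
  proof (intro equalityI subsetI)
    fix y assume "y \<in> f ` {..<?n}"
    then obtain x where x: "x < ?n" "y = f x" by auto
    from x(1) show "y \<in> V"
    proof (cases rule: U_vertex_cases)
      case 1
      then show ?thesis using x f1 v_V by simp
    next
      case (2 s)
      then show ?thesis using x f2 lL[of 0] lf[of s] by simp
    next
      case (3 a)
      then show ?thesis using x f3 lL[of "Suc a"] by simp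
    next
      case (4 b)
      then show ?thesis using x f4 wI[of b] by (auto simp: inner_def)
    next
      case (5 b)
      then show ?thesis using x f5[of b] ch[OF wI[of b]] by auto
    qed
  next
    fix y assume y: "y \<in> V"
    have imgI: "y \<in> f ` {..<?n}" if "x < ?n" "f x = y" for x using that by blast
    consider i where "i < k" "y = v i" | "y \<in> inner" | "y \<in> L" | i where "i < t" "i \<noteq> c" "y = lf i"
      | u where "u \<in> inner" "y = ch u"
    proof (cases "y \<in> Z \<or> y \<in> inner \<or> y \<in> L")
      case False
      then have leaf: "y \<in> T" "card (D y) = 1" using y card_D_pos[of y] by (auto simp: inner_def)
      have big: "2 \<le> card (D (p y))" by (rule card_D_parent[OF leaf(1)])
      show ?thesis
      proof (cases "p y \<in> Z")
        case True
        then obtain i where i: "i < k" "p y = v i" by auto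
        have "i < t" using zero[of i] i big by fastforce
        moreover have "i \<noteq> c" using False leaf i by (auto simp: L_def)
        ultimately show ?thesis using that(4) lf i leaf by metis
      next
        case False
        then have "p y \<in> inner" using p_verts[OF y] big by (auto simp: inner_def)
        then show ?thesis using that(5) ch leaf by metis
      qed
    qed (use that in blast)
    then show "y \<in> f ` {..<?n}"
    proof cases
      case (1 i)
      then show ?thesis using f1 by (intro imgI[of i]) auto
    next
      case 2
      then have "y \<in> w ` {..<q}" unfolding w .
      then obtain b where "b < q" "w b = y" by auto
      then show ?thesis using f4 by (intro imgI[of "k + t + i0 + 2 * b"]) auto
    next
      case 3
      then have "y \<in> l ` {..<Suc i0}" unfolding l .
      then obtain a where a: "a < Suc i0" "l a = y" by auto
      show ?thesis
      proof (cases a)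
        case 0
        then show ?thesis using a c f2[of c] by (intro imgI[of "k + c"]) auto
      next
        case (Suc a')
        then show ?thesis using a f3[of a'] by (intro imgI[of "k + t + a'"]) auto
      qed
    next
      case (4 i)
      then show ?thesis using f2[of i] by (intro imgI[of "k + i"]) auto
    next
      case (5 u)
      then have "u \<in> w ` {..<q}" unfolding w by simp
      then obtain b where "b < q" "w b = u" by auto
      then show ?thesis using 5 f5[of b] by (intro imgI[of "k + t + i0 + 2 * b + 1"]) auto
    qed
  qed
  have "card V = ?n" using verts_card N by simp
  then have "inj_on f {..<?n}" using range by (intro eq_card_imp_inj_on) auto
  then have bij: "bij_betw f (verts (U_centre c k t i0 q)) V"
    using range by (simp add: bij_betw_def U_centre_def)
  have "U_centre c k t i0 q \<simeq>\<^sub>g G"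
  proof (rule rep_iso[OF U_rep[OF k3 c(1,2)] unicyclic_rep_axioms bij])
    show "f (id i) = v i" if "i < k" for i using f1 that by simp
    fix x assume "x \<in> verts (U_centre c k t i0 q) - id ` {..<k}"
    then have x: "x < ?n" "\<not> x < k" by (auto simp: U_centre_def)
    from x(1) show "f (U_parent c k t i0 x) = p (f x)"
    proof (cases rule: U_vertex_cases)
      case (2 s)
      then have "U_parent c k t i0 x = s" by (simp add: U_parent_def)
      then show ?thesis using 2 f1[of s] f2[of s] lL[of 0] lf[of s] c by auto
    next
      case (3 a)
      then have "U_parent c k t i0 x = c" by (simp add: U_parent_def)
      then show ?thesis using 3 f1[OF ck] f3[of a] lL[of "Suc a"] by auto
    next
      case (4 b)
      then have "U_parent c k t i0 x = c" by (simp add: U_parent_def)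
      then show ?thesis using 4 f1[OF ck] f4[of b] inner_parent[OF wI[of b]] by auto
    next
      case (5 b)
      then have "U_parent c k t i0 x = k + t + i0 + 2 * b" by (simp add: U_parent_def)
      then show ?thesis using 5 f4[of b] f5[of b] ch[OF wI[of b]] by auto
    qed (use x in simp)
  qed
  then have "G \<simeq>\<^sub>g U_centre c k t i0 q"
    by (rule graph_iso_sym[rotated])
       (rule simple_graph_Union, rule unicyclic_rep.simple[OF U_rep[OF k3 c(1,2)]])
  then show "G \<simeq>\<^sub>g U_centre c k t (card T - t - 2 * q) q" by (simp add: i0_def)
qed

section \<open>Parameters, matching number and Kirchhoff index of the models\<close>

locale U_graph =
  fixes c k t i j :: nat
  assumes k3: "3 \<le> k" and ct: "c < t" and tk: "t \<le> k"
begin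

abbreviation "H \<equiv> U_centre c k t i j"

sublocale unicyclic_rep H k id "U_parent c k t i"
  using U_rep[OF k3 ct tk] .

lemma V_U [simp]: "V = {..<k + t + i + 2 * j}" by (simp add: U_centre_def)
lemma T_U: "T = {k..<k + t + i + 2 * j}" unfolding V_U by auto
lemma card_T: "card T = t + i + 2 * j" unfolding T_U by simp

lemma children_leaf:
  assumes "x \<in> T" "\<And>b. b < j \<Longrightarrow> x \<noteq> k + t + i + 2 * b"
  shows "{y. y \<in> T \<and> U_parent c k t i y = x} = {}"
proof -
  have "U_parent c k t i y \<noteq> x" if "y \<in> T" for y
  proof -
    have "y < k + t + i + 2 * j" "k \<le> y" "k \<le> x" using that assms(1) by auto
    from this(1) show ?thesis
      using assms(2) ct tk \<open>k \<le> y\<close> \<open>k \<le> x\<close> by (cases rule: U_vertex_cases) (auto simp: U_parent_def)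
  qed
  then show ?thesis by blast
qed

lemma children_inner:
  assumes "b < j"
  shows "{y. y \<in> T \<and> U_parent c k t i y = k + t + i + 2 * b} = {k + t + i + 2 * b + 1}"
proof -
  have "y = k + t + i + 2 * b + 1" if "y \<in> T" "U_parent c k t i y = k + t + i + 2 * b" for y
  proof -
    have "y < k + t + i + 2 * j" "k \<le> y" using that by auto
    from this(1) show ?thesis
      using that(2) ct tk \<open>k \<le> y\<close> by (cases rule: U_vertex_cases) (auto simp: U_parent_def)
  qed
  then have "{y. y \<in> T \<and> U_parent c k t i y = k + t + i + 2 * b} \<subseteq> {k + t + i + 2 * b + 1}" by blast
  moreover have "k + t + i + 2 * b + 1 \<in> T" "U_parent c k t i (k + t + i + 2 * b + 1) = k + t + i + 2 * b"
    using assms by (auto simp: U_parent_def)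
  ultimately show ?thesis by (intro equalityI) (simp_all only: insert_subset empty_subsetI mem_Collect_eq simp_thms)
qed

lemma children_cycle:
  assumes "s < k" "s \<noteq> c"
  shows "{y. y \<in> T \<and> U_parent c k t i y = s} = (if s < t then {k + s} else {})"
proof -
  have "y = k + s \<and> s < t" if "y \<in> T" "U_parent c k t i y = s" for y
  proof -
    have "y < k + t + i + 2 * j" "k \<le> y" using that by auto
    from this(1) show ?thesis
      using that(2) assms ct tk \<open>k \<le> y\<close> by (cases rule: U_vertex_cases) (auto simp: U_parent_def)
  qed
  then have "{y. y \<in> T \<and> U_parent c k t i y = s} \<subseteq> (if s < t then {k + s} else {})" by auto
  moreover have "k + s \<in> T" "U_parent c k t i (k + s) = s" if "s < t"
    using that by (auto simp: U_parent_def)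
  ultimately show ?thesis by auto
qed

lemma card_D_leaf:
  assumes "x \<in> T" "\<And>b. b < j \<Longrightarrow> x \<noteq> k + t + i + 2 * b"
  shows "card (D x) = 1"
proof -
  have "(\<Sum>y | y \<in> T \<and> U_parent c k t i y = x. card (D y)) = 0"
    by (simp only: children_leaf[OF assms] sum.empty)
  then show ?thesis using card_D_children[of x] assms(1) by (simp only: Diff_iff)
qed

lemma card_D_inner:
  assumes "b < j"
  shows "card (D (k + t + i + 2 * b)) = 2"
proof -
  have "card (D (k + t + i + 2 * b + 1)) = 1"
    using assms by (intro card_D_leaf) (simp, presburger)
  moreover have "k + t + i + 2 * b \<in> V" using assms by (simp add: V_U)
  ultimately show ?thesis
    using card_D_children[of "k + t + i + 2 * b", unfolded children_inner[OF assms]] by simp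
qed

lemma card_D_pendent: "s < t \<Longrightarrow> card (D (k + s)) = 1"
  by (rule card_D_leaf) auto

lemma card_D_cycle:
  assumes "s < k" "s \<noteq> c"
  shows "card (D s) = (if s < t then 2 else 1)"
  using card_D_children[of s, unfolded children_cycle[OF assms]] card_D_pendent[of s] assms by simp

lemma flat: "x \<in> T \<Longrightarrow> card (D x) \<le> 2"
  using card_D_leaf[of x] card_D_inner by fastforce

lemma inner_U: "inner = (\<lambda>b. k + t + i + 2 * b) ` {..<j}"
proof (intro equalityI subsetI)
  fix x assume "x \<in> inner"
  then have x: "x \<in> T" "2 \<le> card (D x)" by (simp_all only: inner_def mem_Collect_eq)
  show "x \<in> (\<lambda>b. k + t + i + 2 * b) ` {..<j}"
  proof (rule ccontr)
    assume "x \<notin> (\<lambda>b. k + t + i + 2 * b) ` {..<j}"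
    then have "card (D x) = 1" by (intro card_D_leaf[OF x(1)]) auto
    then show False using x(2) by simp
  qed
next
  fix x assume "x \<in> (\<lambda>b. k + t + i + 2 * b) ` {..<j}"
  then obtain b where b: "b < j" "x = k + t + i + 2 * b" by auto
  then have "x \<in> T" by simp
  then show "x \<in> inner" using card_D_inner[OF b(1)] b(2) by (simp only: inner_def mem_Collect_eq order_refl simp_thms)
qed

lemma card_inner: "card inner = j"
  unfolding inner_U by (subst card_image) (auto simp: inj_on_def)

lemma leafy_U: "leafy = {..<t}"
proof (intro equalityI subsetI)
  fix s assume "s \<in> leafy"
  then show "s \<in> {..<t}"
    using children_cycle[of s] ct by (cases "s = c") (auto simp: leafy_def split: if_splits)
next
  fix s assume "s \<in> {..<t}"
  then show "s \<in> leafy"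
    using card_D_pendent[of s] tk unfolding leafy_def
    by (intro CollectI conjI bexI[of _ "k + s"]) (auto simp: U_parent_def)
qed

lemma occ_U: "occ = {..<t}"
proof -
  have "s \<in> occ \<longrightarrow> s < t" for s using card_D_cycle[of s] ct by (cases "s = c") (auto simp: occ_def split: if_splits)
  then show ?thesis using leafy_sub_occ leafy_U by auto
qed

text \<open>Every one of the \<open>t\<close> chosen vertices carries a leaf, and the cover bound is
  attained up to rounding.\<close>

lemma matching_number_U: "matching_number H = j + (k + t) div 2"
proof (rule antisym)
  show "matching_number H \<le> j + (k + t) div 2"
    using matching_number_upper unfolding card_inner leafy_U by simp
next
  \<comment> \<open>The pendent edges at the first \<open>t\<close> vertices, then every second edge
    of the path \<open>t, ..., k - 1\<close>, then the outer edges of the attached paths.\<close>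
  define e where "e a = (if a < t then {a, k + a} else if a < (k + t) div 2 then {2 * a - t, 2 * a - t + 1}
    else {k + t + i + 2 * (a - (k + t) div 2), k + t + i + 2 * (a - (k + t) div 2) + 1})" for a
  have "card {..<j + (k + t) div 2} \<le> matching_number H"
  proof (rule matching_number_ge[OF simple])
    show "e a \<in> edges H" if "a \<in> {..<j + (k + t) div 2}" for a
    proof -
      have "a < t \<or> t \<le> a \<and> a < (k + t) div 2 \<or> t \<le> a \<and> (k + t) div 2 \<le> a" by arith
      then consider "a < t" | "t \<le> a" "a < (k + t) div 2" | "t \<le> a" "(k + t) div 2 \<le> a" by blast
      then show ?thesis
      proof cases
        case 1
        then show ?thesis by (auto simp: e_def U_centre_def)
      next
        case 2
        then have "2 * a - t + 1 < k" by linarith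
        then show ?thesis using 2 cycle_edge[of "2 * a - t"] by (simp add: e_def)
      next
        case 3
        then have "a - (k + t) div 2 < j" using that tk by auto
        then show ?thesis using 3 by (auto simp: e_def U_centre_def)
      qed
    qed
    show "e a \<inter> e b = {}" if "a \<in> {..<j + (k + t) div 2}" "b \<in> {..<j + (k + t) div 2}" "a \<noteq> b" for a b
      using that tk unfolding e_def by (auto split: if_splits; presburger)
  qed simp
  then show "j + (k + t) div 2 \<le> matching_number H" by simp
qed

text \<open>\<open>i + 2 * j\<close> is the surplus at the centre. If it is zero, the row at
  \<open>c\<close> does not enter; this is the case of \<open>k = t = 7\<close>, where no row
  attains \<open>near_sum\<close>.\<close>

lemma Kirchhoff_U:
  assumes "pair_sum k {..<t} = pair_min k t"
    and "i + 2 * j = 0 \<or> (\<Sum>s<t. cycle_resistance k c s) = near_sum k t"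
  shows "Kirchhoff_index H = Kf_bound (k + t + i + 2 * j) k t j"
proof -
  have "card (D (id s)) = 2" if "s \<in> occ" "s \<noteq> c" for s
    using that tk card_D_cycle[of s] by (simp add: occ_U)
  then have "Kirchhoff_index H = real (t + i + 2 * j) * (real (k + t + i + 2 * j) - 1)
    + real j * (real (k + t + i + 2 * j) - 3)
    + (real k ^ 3 - real k) / 12 + real (t + i + 2 * j) * (real k ^ 2 - 1) / 6 + pair_sum k {..<t}
    + (real (t + i + 2 * j) - real t) * (\<Sum>s<t. cycle_resistance k c s)"
    using Kirchhoff_flat[OF flat, of c] ct unfolding occ_U card_T card_inner verts_card
    by (simp add: add.assoc)
  also have "(real (t + i + 2 * j) - real t) * (\<Sum>s<t. cycle_resistance k c s)
    = (real (t + i + 2 * j) - real t) * near_sum k t"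
    using assms(2) by auto
  finally show ?thesis unfolding assms(1) Kf_bound_def by (simp add: algebra_simps)
qed

end

section \<open>Isomorphism invariance and the equality case\<close>

lemma neighbours_iso:
  assumes G: "\<Union> (edges G) \<subseteq> verts G" and f: "inj_on f (verts G)" "edges H = (\<lambda>e. f ` e) ` edges G"
    and x: "x \<in> verts G"
  shows "{y. {f x, y} \<in> edges H} = f ` {y. {x, y} \<in> edges G}"
proof (intro equalityI subsetI)
  fix y assume "y \<in> {y. {f x, y} \<in> edges H}"
  then obtain e where e: "e \<in> edges G" "{f x, y} = f ` e" unfolding f(2) by auto
  then have "y \<in> f ` e" by blast
  then obtain z where z: "z \<in> e" "y = f z" by blast
  have "e \<subseteq> verts G" using e(1) G by blast
  moreover have "f ` {x, z} = f ` e" using e(2) z by simp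
  moreover have "{x, z} \<subseteq> verts G" using z \<open>e \<subseteq> verts G\<close> x by auto
  ultimately have "{x, z} = e" using inj_on_image_eq_iff[OF f(1)] by blast
  then show "y \<in> f ` {y. {x, y} \<in> edges G}" using e z by auto
next
  fix y assume "y \<in> f ` {y. {x, y} \<in> edges G}"
  then obtain z where "{x, z} \<in> edges G" "y = f z" by auto
  then show "y \<in> {y. {f x, y} \<in> edges H}"
    unfolding f(2) by (auto intro!: image_eqI[of _ _ "{x, z}"])
qed

lemma unit_current_potential_iso:
  assumes G: "\<Union> (edges G) \<subseteq> verts G" and f: "bij_betw f (verts G) (verts H)" "edges H = (\<lambda>e. f ` e) ` edges G"
    and "u \<in> verts G" "w \<in> verts G" and \<phi>: "unit_current_potential H (f u) (f w) \<phi>"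
  shows "unit_current_potential G u w (\<phi> \<circ> f)"
  unfolding unit_current_potential_def
proof
  fix x assume x: "x \<in> verts G"
  have inj: "inj_on f (verts G)" using f(1) by (simp add: bij_betw_def)
  have "{y. {x, y} \<in> edges G} \<subseteq> verts G" using G by auto
  then have "inj_on f {y. {x, y} \<in> edges G}" using inj inj_on_subset by blast
  then have "(\<Sum>y | {x, y} \<in> edges G. (\<phi> \<circ> f) x - (\<phi> \<circ> f) y) = (\<Sum>y | {f x, y} \<in> edges H. \<phi> (f x) - \<phi> y)"
    unfolding neighbours_iso[OF G inj f(2) x] by (simp add: sum.reindex)
  also have "\<dots> = of_bool (f x = f u) - of_bool (f x = f w)"
  proof -
    have "f x \<in> verts H" using x f(1) by (auto simp: bij_betw_def)
    then show ?thesis using \<phi> unfolding unit_current_potential_def by blast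
  qed
  also have "\<dots> = of_bool (x = u) - of_bool (x = w)"
    using inj_on_eq_iff[OF inj] x assms(4,5) by simp
  finally show "(\<Sum>y | {x, y} \<in> edges G. (\<phi> \<circ> f) x - (\<phi> \<circ> f) y) = of_bool (x = u) - of_bool (x = w)" .
qed

text \<open>Potentials pull back along \<open>f\<close> and along its inverse, so both description
  operators speak of the same numbers.\<close>

lemma resistance_iso:
  assumes G: "\<Union> (edges G) \<subseteq> verts G" and f: "bij_betw f (verts G) (verts H)" "edges H = (\<lambda>e. f ` e) ` edges G"
    and u: "u \<in> verts G" and w: "w \<in> verts G"
  shows "resistance H (f u) (f w) = resistance G u w"
proof -
  define g where "g = the_inv_into (verts G) f"
  have g: "g (f x) = x" if "x \<in> verts G" for x
    using that f(1) by (simp add: g_def bij_betw_def the_inv_into_f_f)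
  have gbij: "bij_betw g (verts H) (verts G)" unfolding g_def by (rule bij_betw_the_inv_into[OF f(1)])
  have img: "g ` f ` e = e" if "e \<subseteq> verts G" for e
    using that g by (force simp: image_iff)
  have "g ` f ` e = e" if "e \<in> edges G" for e
    using that G by (intro img) blast
  then have "(\<lambda>e. g ` f ` e) ` edges G = edges G" by simp
  then have gedges: "edges G = (\<lambda>e. g ` e) ` edges H" unfolding f(2) by (simp add: image_image)
  have "verts H = f ` verts G" using f(1) by (simp add: bij_betw_def)
  then have H: "\<Union> (edges H) \<subseteq> verts H" using G unfolding f(2) by blast
  have fV: "f u \<in> verts H" "f w \<in> verts H" using f(1) u w by (auto simp: bij_betw_def)
  have "(\<exists>\<phi>. unit_current_potential H (f u) (f w) \<phi> \<and> r = \<phi> (f u) - \<phi> (f w))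
    \<longleftrightarrow> (\<exists>\<phi>. unit_current_potential G u w \<phi> \<and> r = \<phi> u - \<phi> w)" for r
  proof
    assume "\<exists>\<phi>. unit_current_potential H (f u) (f w) \<phi> \<and> r = \<phi> (f u) - \<phi> (f w)"
    then obtain \<phi> where "unit_current_potential H (f u) (f w) \<phi>" "r = \<phi> (f u) - \<phi> (f w)" by blast
    then show "\<exists>\<phi>. unit_current_potential G u w \<phi> \<and> r = \<phi> u - \<phi> w"
      using unit_current_potential_iso[OF G f u w] by (intro exI[of _ "\<phi> \<circ> f"]) simp
  next
    assume "\<exists>\<phi>. unit_current_potential G u w \<phi> \<and> r = \<phi> u - \<phi> w"
    then obtain \<phi> where "unit_current_potential G u w \<phi>" "r = \<phi> u - \<phi> w" by blast
    then show "\<exists>\<phi>. unit_current_potential H (f u) (f w) \<phi> \<and> r = \<phi> (f u) - \<phi> (f w)"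
      using unit_current_potential_iso[OF H gbij gedges fV, of \<phi>] g u w
      by (intro exI[of _ "\<phi> \<circ> g"]) simp
  qed
  then show ?thesis unfolding resistance_def by presburger
qed

lemma Kirchhoff_index_iso:
  assumes G: "\<Union> (edges G) \<subseteq> verts G" and "G \<simeq>\<^sub>g H"
  shows "Kirchhoff_index H = Kirchhoff_index G"
proof -
  obtain f where f: "bij_betw f (verts G) (verts H)" "edges H = (\<lambda>e. f ` e) ` edges G"
    using assms(2) unfolding graph_iso_def by blast
  have inj: "inj_on f (verts G)" and img: "verts H = f ` verts G" using f(1) by (auto simp: bij_betw_def)
  have "(\<Sum>w\<in>verts H - {f u}. resistance H (f u) w) = (\<Sum>w\<in>verts G - {u}. resistance G u w)" if u: "u \<in> verts G" for u
  proof -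
    have "verts H - {f u} = f ` (verts G - {u})"
      using inj_on_image_set_diff[OF inj, of "verts G" "{u}"] u unfolding img by auto
    moreover have "inj_on f (verts G - {u})" using inj by (rule inj_on_subset) auto
    ultimately show ?thesis using resistance_iso[OF G f u] by (simp add: sum.reindex)
  qed
  then show ?thesis
    unfolding Kirchhoff_index_def img sum.reindex[OF inj] by (simp flip: img)
qed

lemma matching_number_iso_le:
  assumes G: "simple_graph G" and H: "simple_graph H" and "G \<simeq>\<^sub>g H"
  shows "matching_number G \<le> matching_number H"
proof (rule matching_number_le[OF G])
  obtain f where f: "bij_betw f (verts G) (verts H)" "edges H = (\<lambda>e. f ` e) ` edges G"
    using assms(3) unfolding graph_iso_def by blast
  have inj: "inj_on f (verts G)" using f(1) by (simp add: bij_betw_def)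
  fix M assume M: "matching G M"
  then have sub: "M \<subseteq> edges G" and dis: "disjoint M" by (auto simp: matching_def)
  have "finite (edges G)"
    using G by (intro finite_subset[of "edges G" "Pow (verts G)"]) (auto simp: simple_graph_def)
  show "card M \<le> matching_number H"
  proof (rule matching_number_ge[OF H, of M "\<lambda>e. f ` e"])
    show "finite M" using sub \<open>finite (edges G)\<close> finite_subset by blast
    show "f ` e \<in> edges H" if "e \<in> M" for e using that sub f(2) by blast
    show "f ` a \<inter> f ` b = {}" if "a \<in> M" "b \<in> M" "a \<noteq> b" for a b
    proof -
      have "a \<subseteq> verts G" "b \<subseteq> verts G" using that sub G by (auto simp: simple_graph_def)
      then have "f ` a \<inter> f ` b = f ` (a \<inter> b)" using inj_on_image_Int[OF inj] by blast
      then show ?thesis using dis that by (auto simp: disjoint_def)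
    qed
  qed
qed

lemma matching_number_iso:
  assumes "simple_graph G" "simple_graph H" "G \<simeq>\<^sub>g H"
  shows "matching_number G = matching_number H"
  by (rule antisym[OF matching_number_iso_le[OF assms]
        matching_number_iso_le[OF assms(2,1) graph_iso_sym[OF simple_graph_Union[OF assms(1)] assms(3)]]])

context unicyclic_rep
begin

lemma no_trees:
  assumes "T = {}"
  shows "card V = k" "Kirchhoff_index G = (real k ^ 3 - real k) / 12" "matching_number G = k div 2"
    "G \<simeq>\<^sub>g cycle_graph k"
proof -
  show "card V = k" using verts_card assms by simp
  have occ: "occ = {}" using card_occ_le assms by simp
  then show "Kirchhoff_index G = (real k ^ 3 - real k) / 12"
    unfolding Kirchhoff_expand assms by (simp add: pair_sum_def)
  have "inner = {}" "leafy = {}" using assms leafy_sub_occ occ by (auto simp: inner_def)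
  then show "matching_number G = k div 2"
    using matching_number_upper matching_number_half_cycle by simp
  have "V = Z" using assms cyc_sub by blast
  then have "cycle_part = G" unfolding cycle_part_def edges_eq prod_eq_iff by simp
  then show "G \<simeq>\<^sub>g cycle_graph k" using cycle_part_iso by simp
qed

end

lemma cycle_graph_rep: "3 \<le> n \<Longrightarrow> unicyclic_rep (cycle_graph n) n id id"
  by unfold_locales (auto simp: cycle_graph_def)

lemma cycle_graph_facts:
  assumes "3 \<le> n"
  shows "Kirchhoff_index (cycle_graph n) = (real n ^ 3 - real n) / 12" "matching_number (cycle_graph n) = n div 2"
proof -
  interpret unicyclic_rep "cycle_graph n" n id id by (rule cycle_graph_rep[OF assms])
  have "T = {}" by (simp add: cycle_graph_def)
  then show "Kirchhoff_index (cycle_graph n) = (real n ^ 3 - real n) / 12" "matching_number (cycle_graph n) = n div 2"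
    using no_trees by auto
qed

definition extremal_shape :: "nat \<Rightarrow> nat \<Rightarrow> nat \<Rightarrow> bool" where
  "extremal_shape n k s \<longleftrightarrow> 3 \<le> k \<and> (s = 1 \<or> (k, s) = (6, 2) \<or> (k, s) = (8, 2) \<or> (k, s) = (7, 3) \<or> (k, s) = (8, 4)
     \<or> (k, s) = (7, 7) \<and> n = 14)"

lemma extremal_shapeE:
  assumes "extremal_shape n k s"
  obtains "3 \<le> k" "s = 1" | "k = 6" "s = 2" | "k = 8" "s = 2" | "k = 7" "s = 3" | "k = 8" "s = 4"
    | "k = 7" "s = 7" "n = 14"
  using assms unfolding extremal_shape_def by auto

lemma pair_min_ge:
  assumes "(k, s) \<noteq> (7, 3)" "(k, s) \<noteq> (8, 4)"
  shows "real s / 2 * near_sum k s \<le> pair_min k s"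
    and "(real k ^ 3 - real k) / 12 - (real k - real s) * (real k ^ 2 - 1) / 6
         + (real k - real s) / 2 * near_sum k (k - s) \<le> pair_min k s"
proof -
  have "pair_min k s = max (real s / 2 * near_sum k s)
      ((real k ^ 3 - real k) / 12 - (real k - real s) * (real k ^ 2 - 1) / 6
         + (real k - real s) / 2 * near_sum k (k - s))"
    using assms by (auto simp: pair_min_def)
  then show "real s / 2 * near_sum k s \<le> pair_min k s"
    "(real k ^ 3 - real k) / 12 - (real k - real s) * (real k ^ 2 - 1) / 6
         + (real k - real s) / 2 * near_sum k (k - s) \<le> pair_min k s"
    by (simp_all only: max.cobounded1 max.cobounded2)
qed

lemma pair_sum_values:
  "pair_sum k {..<1} = 0" "pair_sum 6 {..<2} = 5 / 6" "pair_sum 8 {..<2} = 7 / 8"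
  "pair_sum 7 {..<3} = 22 / 7" "pair_sum 8 {..<4} = 15 / 2" "pair_sum 7 {..<7} = 28"
  by (simp_all add: pair_sum_def cycle_resistance_def numeral_eq_Suc)

lemma extremal_pair_sum:
  assumes "extremal_shape n k s"
  shows "pair_sum k {..<s} = pair_min k s"
proof (rule antisym)
  show "pair_min k s \<le> pair_sum k {..<s}"
    using pair_min_le[of k "{..<s}"] assms by (auto simp: extremal_shape_def)
  show "pair_sum k {..<s} \<le> pair_min k s"
    using assms
  proof (cases rule: extremal_shapeE)
    case 1
    then show ?thesis using pair_min_ge(1)[of k s] pair_sum_values(1)[of k] by (simp add: near_sum_def)
  next
    case 2
    then show ?thesis using pair_min_ge(1)[of k s] pair_sum_values by (simp add: near_sum_def)
  next
    case 3
    then show ?thesis using pair_min_ge(1)[of k s] pair_sum_values by (simp add: near_sum_def)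
  next
    case 6
    \<comment> \<open>The complement is empty, so its bound gives the exact value 28, whereas the
      row bound is only 26.\<close>
    then show ?thesis using pair_min_ge(2)[of k s] pair_sum_values by simp
  qed (simp_all add: pair_sum_values pair_min_def)
qed

lemma extremal_consecutive:
  assumes "extremal_shape n k s" and S: "S \<subseteq> {..<k}" "card S = s" "pair_sum k S = pair_min k s"
  shows "\<exists>r<k. S = (\<lambda>i. (i + r) mod k) ` {..<s}"
proof -
  have *: "\<exists>r<k. S = (\<lambda>i. (i + r) mod k) ` {..<s}"
    if "consecutive_check k s t" "0 < k" "s \<le> k" "pair_sum k {..<s} = of_int t / (2 * real k)" for t
    using consecutive_minimal(2)[OF that(1) S(1,2) that(2,3)] S(3) extremal_pair_sum[OF assms(1)] that(4) by simp
  from assms(1) show ?thesis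
  proof (cases rule: extremal_shapeE)
    case 1
    then obtain r where "S = {r}" using S(2) card_1_singletonE by blast
    then show ?thesis using S(1) 1 by (intro exI[of _ r]) (auto simp: lessThan_Suc)
  next
    case 2
    then show ?thesis using *[of 10] consecutive_check(1) pair_sum_values by simp
  next
    case 3
    then show ?thesis using *[of 14] consecutive_check(2) pair_sum_values by simp
  next
    case 4
    then show ?thesis using *[of 44] consecutive_check(3) pair_sum_values by simp
  next
    case 5
    then show ?thesis using *[of 120] consecutive_check(4) pair_sum_values by simp
  next
    case 6
    then have "S = {..<7}" using S card_subset_eq[of "{..<7}" S] by simp
    then show ?thesis using 6 by (intro exI[of _ 0]) auto
  qed
qed

text \<open>The inequalities exclude the end vertices as centres. For \<open>s <= 2\<close> there is
  nothing to exclude, since every chosen vertex is a middle one.\<close>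

lemma centre_sums:
  "(\<Sum>j<2. cycle_resistance 6 0 j) = near_sum 6 2" "(\<Sum>j<2. cycle_resistance 8 0 j) = near_sum 8 2"
  "(\<Sum>j<3. cycle_resistance 7 1 j) = near_sum 7 3" "(\<Sum>j<4. cycle_resistance 8 1 j) = near_sum 8 4"
  "(\<Sum>j<3. cycle_resistance 7 0 j) \<noteq> near_sum 7 3" "(\<Sum>j<3. cycle_resistance 7 2 j) \<noteq> near_sum 7 3"
  "(\<Sum>j<4. cycle_resistance 8 0 j) \<noteq> near_sum 8 4" "(\<Sum>j<4. cycle_resistance 8 3 j) \<noteq> near_sum 8 4"
  by (simp_all add: near_sum_def cycle_resistance_def numeral_eq_Suc)

lemma extremal_centre:
  assumes "extremal_shape n k s" "c < s" "(\<Sum>j<s. cycle_resistance k c j) = near_sum k s" "\<not> (s = 7 \<and> n = 14)"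
  shows "c = (s - 1) div 2 \<or> c = s div 2"
  using assms(1)
proof (cases rule: extremal_shapeE)
  case 4
  then have "c = 0 \<or> c = 1 \<or> c = 2" using assms(2) by auto
  then show ?thesis using 4 assms(3) centre_sums(5,6) by auto
next
  case 5
  then have "c = 0 \<or> c = 1 \<or> c = 2 \<or> c = 3" using assms(2) by auto
  then show ?thesis using 5 assms(3) centre_sums(7,8) by auto
qed (use assms in auto)

lemma U_values:
  assumes "extremal_shape n k s" and n: "n = k + s + i + 2 * j"
  shows "Kirchhoff_index (U k s i j) = Kf_bound n k s j" "matching_number (U k s i j) = j + (k + s) div 2"
    "unicyclic_rep (U k s i j) k id (U_parent ((s - 1) div 2) k s i)" "card (verts (U k s i j)) = n"
proof -
  let ?c = "(s - 1) div 2"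
  have ks: "3 \<le> k" "?c < s" "s \<le> k" using assms(1) by (auto simp: extremal_shape_def)
  interpret U_graph ?c k s i j by unfold_locales (rule ks)+
  have "i + 2 * j = 0 \<or> (\<Sum>l<s. cycle_resistance k ?c l) = near_sum k s"
    using assms(1)
  proof (cases rule: extremal_shapeE)
    case 1
    then show ?thesis by (simp add: near_sum_def)
  next
    case 6
    then show ?thesis using n by simp
  qed (use centre_sums in simp_all)
  then show "Kirchhoff_index (U k s i j) = Kf_bound n k s j"
    using Kirchhoff_U[OF extremal_pair_sum[OF assms(1)]] n by (simp add: U_def)
  show "matching_number (U k s i j) = j + (k + s) div 2" using matching_number_U by (simp add: U_def)
  show "unicyclic_rep (U k s i j) k id (U_parent ?c k s i)" using unicyclic_rep_axioms by (simp add: U_def)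
  show "card (verts (U k s i j)) = n" using V_U n by (simp add: U_def)
qed

text \<open>The assumption \<open>m\<close> provides a leaf at the centre: without non-pendent
  bridges every child is a leaf, and if the cover bound is tight then \<open>leafy\<close> and
  \<open>occ\<close> coincide.\<close>

lemma (in unicyclic_rep) extremal_iso:
  assumes T: "T \<noteq> {}" and shape: "extremal_shape (card V) k (card occ)"
    and Kf: "Kirchhoff_index G = Kf_bound (card V) k (card occ) (card inner)"
    and m: "card inner = 0 \<or> 2 * matching_number G = 2 * card inner + k + card occ"
  shows "card occ + 2 * card inner \<le> card T"
    "G \<simeq>\<^sub>g U k (card occ) (card T - card occ - 2 * card inner) (card inner)"
proof -
  define s where "s = card occ"
  have ks: "3 \<le> k" "0 < s" "s \<le> k" using shape by (auto simp: extremal_shape_def s_def)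
  obtain r where r: "r < k" "occ = (\<lambda>i. (i + r) mod k) ` {..<s}"
    using extremal_consecutive[OF shape occ_sub refl] Kirchhoff_lower_bound(2)[OF T Kf] s_def by blast
  interpret R: unicyclic_rep G k "\<lambda>i. v ((i + r) mod k)" p by (rule rotate[OF r(1)])
  have less: "(i + r) mod k < k" for i using k0 by simp
  have inj_r: "i = j" if "(i + r) mod k = (j + r) mod k" "i < k" "j < k" for i j
    using that r(1) R.v_eq[of i j] by simp
  have Z: "R.Z = Z"
    by (intro card_subset_eq) (use less in \<open>auto simp: card_image[OF inj] card_image[OF R.inj]\<close>)
  have occ: "R.occ = {..<s}"
  proof (intro equalityI subsetI)
    fix i assume "i \<in> R.occ"
    then have i: "i < k" "(i + r) mod k \<in> occ" using less by (auto simp: R.occ_def occ_def)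
    then obtain j where j: "j < s" "(i + r) mod k = (j + r) mod k" unfolding r(2) by auto
    have "i = j" by (rule inj_r[OF j(2) i(1)]) (use j(1) ks(3) in simp)
    then show "i \<in> {..<s}" using j(1) by simp
  next
    fix i assume i: "i \<in> {..<s}"
    then have "(i + r) mod k \<in> occ" unfolding r(2) by blast
    then show "i \<in> R.occ" using i ks(3) by (auto simp: R.occ_def occ_def)
  qed
  have inner: "R.inner = inner" unfolding R.inner_def inner_def Z ..
  have "Kirchhoff_index G = Kf_bound (card V) k (card R.occ) (card R.inner)"
    unfolding occ inner using Kf by (simp add: s_def)
  then have flat: "\<forall>t\<in>T. card (D t) \<le> 2"
    and "\<exists>c\<in>{..<s}. \<forall>i\<in>{..<s}. i \<noteq> c \<longrightarrow> card (D (v ((i + r) mod k))) = 2"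
    and big: "\<forall>c\<in>{..<s}. 2 < card (D (v ((c + r) mod k))) \<longrightarrow> (\<Sum>j<s. cycle_resistance k c j) = near_sum k s"
    using R.Kirchhoff_lower_bound(2) T unfolding Z occ by auto
  then obtain c0 where c0: "c0 < s" "\<And>i. i < s \<Longrightarrow> i \<noteq> c0 \<Longrightarrow> card (D (v ((i + r) mod k))) = 2" by auto
  obtain c where c: "c = (s - 1) div 2 \<or> c = s div 2" "c < s"
    "\<And>i. i < s \<Longrightarrow> i \<noteq> c \<Longrightarrow> card (D (v ((i + r) mod k))) = 2"
  proof (cases "2 < card (D (v ((c0 + r) mod k)))")
    case True
    \<comment> \<open>With seven trees on a 7-cycle and \<open>n = 14\<close> every tree is one
      pendent vertex, so no position has surplus.\<close>
    have "\<not> (s = 7 \<and> card V = 14)"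
    proof
      assume *: "s = 7 \<and> card V = 14"
      then have "k = 7" using shape by (auto simp: extremal_shape_def s_def)
      then have "card T = 7" using verts_card * by simp
      then have "(\<Sum>i\<in>R.occ. R.surplus i) = 0" using R.sum_surplus * unfolding Z occ by simp
      moreover have "0 < R.surplus c0" using True c0(1) unfolding R.surplus_def occ by simp
      ultimately show False
        using sum_nonneg_eq_0_iff[of R.occ R.surplus] R.surplus_nonneg c0(1) unfolding occ by auto
    qed
    then have "c0 = (s - 1) div 2 \<or> c0 = s div 2"
      using extremal_centre[OF shape[folded s_def] c0(1)] big c0(1) True by blast
    then show ?thesis using that c0 by blast
  next
    case False
    \<comment> \<open>Without surplus all occupied positions look alike, and the middle one may be
      taken as the centre.\<close>
    have "card (D (v ((i + r) mod k))) = 2" if "i < s" for i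
    proof (cases "i = c0")
      case True
      have "c0 \<in> R.occ" using c0(1) occ by simp
      then show ?thesis using False True by (simp add: R.occ_def)
    qed (use c0 that in blast)
    then show ?thesis using that[of "(s - 1) div 2"] ks(2) by auto
  qed
  have "c \<in> R.leafy"
    using m
  proof
    assume "card inner = 0"
    then have no_inner: "inner = {}" by (simp add: inner_def fin)
    have "c \<in> R.occ" using c occ by simp
    then have "2 \<le> card (D (v ((c + r) mod k)))" by (simp add: R.occ_def)
    have "{y. y \<in> T \<and> p y = v ((c + r) mod k)} \<noteq> {}"
    proof
      assume "{y. y \<in> T \<and> p y = v ((c + r) mod k)} = {}"
      then have "card (D (v ((c + r) mod k))) = 1 + 0"
        using card_D_children[OF v_V[OF less[of c]]] by (simp only: sum.empty)
      then show False using \<open>2 \<le> card (D (v ((c + r) mod k)))\<close> by simp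
    qed
    then obtain y where y: "y \<in> T" "p y = v ((c + r) mod k)" by blast
    then have "card (D y) = 1" using no_inner card_D_pos[of y] by (auto simp: inner_def)
    then show ?thesis using y c(2) ks(3) unfolding R.leafy_def Z by auto
  next
    assume "2 * matching_number G = 2 * card inner + k + card occ"
    then have "card R.occ \<le> card R.leafy"
      using R.matching_number_upper unfolding inner occ by (simp add: s_def)
    then have "R.leafy = R.occ" using R.leafy_sub_occ R.finite_occ card_seteq by blast
    then show ?thesis using c(2) occ by simp
  qed
  note leafy = this
  have flat': "card (D t) \<le> 2" if "t \<in> R.T" for t using that flat unfolding Z by blast
  have zero: "card (D (v ((i + r) mod k))) = 1" if "s \<le> i" "i < k" for i
    using R.card_D_not_occ[OF that(2)] that(1) occ by simp
  have "s + 2 * card inner \<le> card R.T" "G \<simeq>\<^sub>g U_centre c k s (card R.T - s - 2 * card inner) (card inner)"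
    using R.iso_U_centre[where c = c and t = s and q = "card inner"] flat' c(2,3) ks(3) leafy zero inner by simp_all
  then have *: "s + 2 * card inner \<le> card T" "G \<simeq>\<^sub>g U_centre c k s (card T - s - 2 * card inner) (card inner)"
    unfolding Z by auto
  show "card occ + 2 * card inner \<le> card T" using * s_def by simp
  have other: "U_centre (s div 2) k s i j \<simeq>\<^sub>g U k s i j" for i j
  proof (rule graph_iso_sym)
    have "simple_graph (U k s i j)"
      unfolding U_def using ks by (intro unicyclic_rep.simple[OF U_rep]) auto
    then show "\<Union> (edges (U k s i j)) \<subseteq> verts (U k s i j)" by (rule simple_graph_Union)
    show "U k s i j \<simeq>\<^sub>g U_centre (s div 2) k s i j" using ks by (intro U_other_centre) auto
  qed
  from c(1) show "G \<simeq>\<^sub>g U k (card occ) (card T - card occ - 2 * card inner) (card inner)"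
  proof
    assume "c = (s - 1) div 2"
    then show ?thesis using *(2) by (simp add: U_def s_def)
  next
    assume "c = s div 2"
    then show ?thesis using graph_iso_trans[OF *(2)[unfolded \<open>c = s div 2\<close>] other] by (simp add: s_def)
  qed
qed

section \<open>The minimisers\<close>

text \<open>What is required of a triple so that its model has matching number \<open>m\<close>,
  attains \<open>Kf_bound\<close> and is the only graph to do so; the disjunction provides the leaf
  at the centre.\<close>

definition winner :: "nat \<Rightarrow> nat \<Rightarrow> nat \<times> nat \<times> nat \<Rightarrow> bool" where
  "winner n m = (\<lambda>(k, s, q). extremal_shape n k s \<and> (q = 0 \<or> 2 * m = 2 * q + k + s) \<and> k + s + 2 * q \<le> n
     \<and> m = q + (k + s) div 2)"

definition winner_graph :: "nat \<Rightarrow> nat \<times> nat \<times> nat \<Rightarrow> nat graph" where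
  "winner_graph n = (\<lambda>(k, s, q). U k s (n - k - s - 2 * q) q)"

lemma winner_graph_values:
  assumes "winner n m (k, s, q)"
  shows "Kirchhoff_index (winner_graph n (k, s, q)) = Kf_bound n k s q"
    and "matching_number (winner_graph n (k, s, q)) = m"
    and "\<exists>v p. unicyclic_rep (winner_graph n (k, s, q)) k v p"
    and "card (verts (winner_graph n (k, s, q))) = n"
proof -
  have shape: "extremal_shape n k s" and n: "n = k + s + (n - k - s - 2 * q) + 2 * q" and m: "m = q + (k + s) div 2"
    using assms by (auto simp: winner_def)
  from U_values[OF shape n]
  show "Kirchhoff_index (winner_graph n (k, s, q)) = Kf_bound n k s q"
    "matching_number (winner_graph n (k, s, q)) = m"
    "\<exists>v p. unicyclic_rep (winner_graph n (k, s, q)) k v p"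
    "card (verts (winner_graph n (k, s, q))) = n"
    using m by (auto simp: winner_graph_def)
qed

text \<open>Reduces one pair \<open>(n, m)\<close> to inequalities between numbers:
  \<open>bound\<close> handles graphs with trees, \<open>cyc\<close> the cycle alone, and
  \<open>W\<close> lists the triples with equality.\<close>

lemma minimisers:
  fixes W :: "(nat \<times> nat \<times> nat) set" and x :: real
  assumes m: "2 \<le> m" "2 * m \<le> n"
    and bound: "\<And>k s q. \<lbrakk>3 \<le> k; 1 \<le> s; s \<le> k; k + s \<le> n; (k + 1) div 2 \<le> m; 2 * m \<le> 2 * q + k + s\<rbrakk>
      \<Longrightarrow> x \<le> Kf_bound n k s q \<and> (Kf_bound n k s q = x \<longrightarrow> (k, s, q) \<in> W)"
    and cyc: "n div 2 = m \<Longrightarrow> x \<le> (real n ^ 3 - real n) / 12"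
    and W: "\<And>k s q. (k, s, q) \<in> W \<Longrightarrow> winner n m (k, s, q) \<and> Kf_bound n k s q = x"
    and Ls: "Ls = winner_graph n ` W
      \<union> (if n div 2 = m \<and> (real n ^ 3 - real n) / 12 = x then {cycle_graph n} else {})"
    and ne: "Ls \<noteq> {}"
  shows "Kirchhoff_minimisers (unicyclic_graphs n m :: 'a graph set) Ls x"
proof -
  have n3: "3 \<le> n" using m by simp
  have L: "Kirchhoff_index L = x \<and> matching_number L = m \<and> (\<exists>k v p. unicyclic_rep L k v p) \<and> card (verts L) = n"
    if "L \<in> Ls" for L
  proof -
    have "(\<exists>w\<in>W. L = winner_graph n w) \<or> L = cycle_graph n \<and> n div 2 = m \<and> (real n ^ 3 - real n) / 12 = x"
      using that unfolding Ls by (auto split: if_splits)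
    then consider w where "w \<in> W" "L = winner_graph n w"
      | "L = cycle_graph n" "n div 2 = m" "(real n ^ 3 - real n) / 12 = x" by blast
    then show ?thesis
    proof cases
      case 1
      obtain k s q where w: "w = (k, s, q)" by (cases w)
      then have "winner n m (k, s, q)" "Kf_bound n k s q = x" using W 1(1) by auto
      then show ?thesis using winner_graph_values[of n m k s q] 1(2) unfolding w by blast
    next
      case 2
      then show ?thesis
        using cycle_graph_facts[OF n3] cycle_graph_rep[OF n3] by (auto simp: cycle_graph_def)
    qed
  qed
  have lower: "x \<le> Kirchhoff_index G \<and> (Kirchhoff_index G = x \<longrightarrow> simple_graph G \<and> (\<exists>L\<in>Ls. G \<simeq>\<^sub>g L))"
    if G: "G \<in> unicyclic_graphs n m" for G :: "'a graph"
  proof -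
    have card: "card (verts G) = n" and mG: "matching_number G = m" and "unicyclic G"
      using G by (auto simp: unicyclic_graphs_def)
    then obtain k v p where "unicyclic_rep G k v p" using unicyclic_imp_rep by blast
    then interpret unicyclic_rep G k v p .
    show ?thesis
    proof (cases "T = {}")
      case True
      note cycle = no_trees[OF True]
      then have "k = n" "n div 2 = m" using card mG by auto
      then show ?thesis using cycle cyc simple unfolding Ls by auto
    next
      case False
      let ?s = "card occ" and ?q = "card inner"
      have ks: "k + ?s \<le> n" using card_occ_le verts_card card by simp
      have "?s \<le> k" using card_mono[OF _ occ_sub] by simp
      have "(k + 1) div 2 \<le> m" using matching_number_lower False mG by simp
      have "card leafy \<le> ?s" using leafy_sub_occ by (intro card_mono) auto
      then have mq: "2 * m \<le> 2 * ?q + k + ?s" using matching_number_upper mG by simp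
      have "occ \<noteq> {}"
      proof
        assume "occ = {}"
        then have "card V = k" using sum_card_D card_D_not_occ by simp
        then show False using verts_card False by simp
      qed
      then have "1 \<le> ?s" by (simp add: Suc_le_eq card_gt_0_iff)
      have b: "x \<le> Kf_bound n k ?s ?q" "Kf_bound n k ?s ?q = x \<Longrightarrow> (k, ?s, ?q) \<in> W"
        using bound[OF k3 \<open>1 \<le> ?s\<close> \<open>?s \<le> k\<close> ks \<open>(k + 1) div 2 \<le> m\<close> mq] by auto
      have Kf: "Kf_bound n k ?s ?q \<le> Kirchhoff_index G" using Kirchhoff_lower_bound(1)[OF False] card by simp
      have "simple_graph G \<and> (\<exists>L\<in>Ls. G \<simeq>\<^sub>g L)" if "Kirchhoff_index G = x"
      proof -
        have eq: "Kf_bound n k ?s ?q = x" using that b(1) Kf by simp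
        then have inW: "(k, ?s, ?q) \<in> W" by (rule b(2))
        then have win: "winner n m (k, ?s, ?q)" using W by blast
        have "G \<simeq>\<^sub>g U k ?s (card T - ?s - 2 * ?q) ?q"
          using win that eq card mG by (intro extremal_iso[OF False]) (auto simp: winner_def)
        also have "card T = n - k" using verts_card card by simp
        finally have "G \<simeq>\<^sub>g winner_graph n (k, ?s, ?q)" by (simp add: winner_graph_def)
        then show ?thesis using inW simple unfolding Ls by blast
      qed
      then show ?thesis using b(1) Kf by simp
    qed
  qed
  have upper: "G \<in> unicyclic_graphs n m \<and> Kirchhoff_index G = x"
    if G: "simple_graph G" "L \<in> Ls" "G \<simeq>\<^sub>g L" for G :: "'a graph" and L
  proof -
    obtain k v p where rep: "unicyclic_rep L k v p" using L[OF G(2)] by blast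
    have simpL: "simple_graph L" by (rule unicyclic_rep.simple[OF rep])
    have LG: "L \<simeq>\<^sub>g G" by (rule graph_iso_sym[OF simple_graph_Union[OF G(1)] G(3)])
    then obtain f where f: "bij_betw f (verts L) (verts G)" "edges G = (\<lambda>e. f ` e) ` edges L"
      unfolding graph_iso_def by blast
    have "unicyclic G" using unicyclic_rep.unicyclic[OF unicyclic_rep_iso[OF rep f]] .
    moreover have "card (verts G) = n" using bij_betw_same_card[OF f(1)] L[OF G(2)] by simp
    moreover have "matching_number G = m" using matching_number_iso[OF G(1) simpL G(3)] L[OF G(2)] by simp
    moreover have "Kirchhoff_index G = x" using Kirchhoff_index_iso[OF simple_graph_Union[OF simpL] LG] L[OF G(2)] by simp
    ultimately show ?thesis by (simp add: unicyclic_graphs_def)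
  qed
  show ?thesis
    unfolding Kirchhoff_minimisers_def
  proof (intro conjI ballI equalityI subsetI)
    fix L assume "L \<in> Ls"
    then show "Kirchhoff_index L = x" using L by blast
  next
    fix G :: "'a graph" assume "G \<in> {G. simple_graph G \<and> (\<exists>L\<in>Ls. G \<simeq>\<^sub>g L)}"
    then have "G \<in> unicyclic_graphs n m" "Kirchhoff_index G = x" using upper by blast+
    then show "G \<in> {G \<in> unicyclic_graphs n m. \<forall>H\<in>unicyclic_graphs n m. Kirchhoff_index G \<le> Kirchhoff_index (H :: 'a graph)}"
      using lower by simp
  next
    fix G :: "'a graph"
    assume "G \<in> {G \<in> unicyclic_graphs n m. \<forall>H\<in>unicyclic_graphs n m. Kirchhoff_index G \<le> Kirchhoff_index (H :: 'a graph)}"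
    then have G: "G \<in> unicyclic_graphs n m" and min: "\<And>H :: 'a graph. H \<in> unicyclic_graphs n m \<Longrightarrow> Kirchhoff_index G \<le> Kirchhoff_index H"
      by auto
    obtain L where LL: "L \<in> Ls" using ne by blast
    have "card (verts G) = n" using G by (simp add: unicyclic_graphs_def)
    moreover have "card (verts L) = n" using L[OF LL] by simp
    ultimately obtain f where f: "bij_betw f (verts L) (verts G)"
      using n3 finite_same_card_bij[of "verts L" "verts G"] by (metis card.infinite not_numeral_le_zero)
    obtain k v p where rep: "unicyclic_rep L k v p" using L[OF LL] by blast
    \<comment> \<open>The type of the vertices may be too small to carry any graph of the class, so
      a competitor is built only now, by transporting \<open>L\<close> to the vertex set of the
      given \<open>G\<close>.\<close>
    define H where "H = (verts G, (\<lambda>e. f ` e) ` edges L)"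
    have fH: "bij_betw f (verts L) (verts H)" "edges H = (\<lambda>e. f ` e) ` edges L" using f by (auto simp: H_def)
    have simpH: "simple_graph H" by (rule unicyclic_rep.simple[OF unicyclic_rep_iso[OF rep fH]])
    have "L \<simeq>\<^sub>g H" using fH unfolding graph_iso_def by blast
    then have "H \<simeq>\<^sub>g L" by (rule graph_iso_sym[OF simple_graph_Union[OF unicyclic_rep.simple[OF rep]]])
    then have "Kirchhoff_index G \<le> x" using upper[OF simpH LL] min[of H] by simp
    then show "G \<in> {G. simple_graph G \<and> (\<exists>L\<in>Ls. G \<simeq>\<^sub>g L)}" using lower[OF G] by simp
  qed
qed

text \<open>The terms with \<open>12 * a\<close> compare the tabulated minimum with the index of the
  cycle; an empty list of triples is allowed only where the cycle attains it.\<close>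

lemma small_cases_winners:
  "list_all (\<lambda>(n, m, a, b, W). 2 \<le> m \<and> 2 * m \<le> n \<and> 0 < b
     \<and> (n div 2 = m \<longrightarrow> 12 * a \<le> b * (int n * int n * int n - int n))
     \<and> (W \<noteq> [] \<or> n div 2 = m \<and> 12 * a = b * (int n * int n * int n - int n))
     \<and> list_all (\<lambda>(k, s, q). winner n m (k, s, q) \<and> s \<le> k \<and>
          b * Kf_bound_int (int n) (int k) (int s) (int q) = 24 * int k * a) W) small_cases"
  by code_simp

lemma minimisers_small:
  assumes mem: "(n, m, a, b, W) \<in> set small_cases"
    and Ls: "Ls = winner_graph n ` set W
      \<union> (if n div 2 = m \<and> (real n ^ 3 - real n) / 12 = of_int a / of_int b then {cycle_graph n} else {})"
  shows "Kirchhoff_minimisers (unicyclic_graphs n m :: 'a graph set) Ls (of_int a / of_int b)"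
proof -
  note row = bspec[OF small_cases_winners[unfolded list_all_iff] mem, unfolded prod.case]
  have m: "2 \<le> m" "2 * m \<le> n" and b: "0 < b" using row by blast+
  have cube: "(real n ^ 3 - real n) / 12 - of_int a / of_int b
      = of_int (b * (int n * int n * int n - int n) - 12 * a) / (12 * of_int b)"
    using b by (simp add: field_simps power3_eq_cube)
  show ?thesis
  proof (rule minimisers[OF m, where W = "set W"])
    fix k s q assume "3 \<le> k" "1 \<le> s" "s \<le> k" "k + s \<le> n" "(k + 1) div 2 \<le> m" "2 * m \<le> 2 * q + k + s"
    then show "of_int a / of_int b \<le> Kf_bound n k s q \<and> (Kf_bound n k s q = of_int a / of_int b \<longrightarrow> (k, s, q) \<in> set W)"
      using Kf_bound_small[OF mem b] m by simp
  next
    assume "n div 2 = m"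
    then have "12 * a \<le> b * (int n * int n * int n - int n)" using row by blast
    then have "0 \<le> real_of_int (b * (int n * int n * int n - int n) - 12 * a)"
      by (subst of_int_0_le_iff) simp
    then have "0 \<le> of_int (b * (int n * int n * int n - int n) - 12 * a) / (12 * real_of_int b)"
      using b by (intro divide_nonneg_nonneg) simp_all
    then show "of_int a / of_int b \<le> (real n ^ 3 - real n) / 12" using cube by linarith
  next
    fix k s q assume W: "(k, s, q) \<in> set W"
    then have win: "winner n m (k, s, q)" "s \<le> k" "b * Kf_bound_int (int n) (int k) (int s) (int q) = 24 * int k * a"
      using row by blast+
    have k: "0 < k" using win(1) by (simp add: winner_def extremal_shape_def)
    have "of_int b * (24 * real k * Kf_bound n k s q) = of_int (b * Kf_bound_int (int n) (int k) (int s) (int q))"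
      using Kf_bound_int[OF k win(2)] by simp
    also have "\<dots> = 24 * real k * of_int a" unfolding win(3) by simp
    finally show "winner n m (k, s, q) \<and> Kf_bound n k s q = of_int a / of_int b"
      using win(1) k b by (simp add: field_simps)
  next
    show "Ls = winner_graph n ` set W
      \<union> (if n div 2 = m \<and> (real n ^ 3 - real n) / 12 = of_int a / of_int b then {cycle_graph n} else {})" by (rule Ls)
    have "W \<noteq> [] \<or> n div 2 = m \<and> 12 * a = b * (int n * int n * int n - int n)" using row by blast
    then show "Ls \<noteq> {}"
    proof
      assume "n div 2 = m \<and> 12 * a = b * (int n * int n * int n - int n)"
      then have "(real n ^ 3 - real n) / 12 - of_int a / of_int b = 0" "n div 2 = m" using cube by simp_all
      then show ?thesis unfolding Ls by simp
    qed (simp add: Ls)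
  qed
qed

text \<open>The cycle never wins for \<open>n >= 15\<close>. The claimed minimum grows with
  \<open>m\<close>, so \<open>m = n / 2\<close> is the worst case, and in \<open>d = n - 15\<close>
  the difference has positive coefficients.\<close>

lemma cube_bound:
  assumes "15 \<le> n" "2 * m \<le> n"
  shows "real n ^ 2 + real n * real m - 5 * real n - 3 * real m + 4 < (real n ^ 3 - real n) / 12"
proof -
  define d where "d = real n - 15"
  have d: "0 \<le> d" "real n = d + 15" using assms by (auto simp: d_def)
  have "real m * (real n - 3) \<le> real n / 2 * (real n - 3)"
    using assms by (intro mult_right_mono) linarith+
  moreover have "real n ^ 2 - 5 * real n + 4 + real n / 2 * (real n - 3) < (real n ^ 3 - real n) / 12"
  proof -
    have "0 < d * (d * (d * 2)) + (d * (d * 54) + (864 + d * 424))"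
      using d(1) by (intro add_nonneg_pos add_pos_nonneg mult_nonneg_nonneg) auto
    then show ?thesis unfolding d(2) by (simp add: field_simps power2_eq_square power3_eq_cube)
  qed
  moreover have "real n * real m - 3 * real m = real m * (real n - 3)" by (simp add: algebra_simps)
  ultimately show ?thesis by linarith
qed

lemma minimisers_large:
  assumes "15 \<le> n" "3 \<le> m" "2 * m \<le> n"
  shows "Kirchhoff_minimisers (unicyclic_graphs n m :: 'a graph set) {U_nm n m}
    (real n ^ 2 + real n * real m - 5 * real n - 3 * real m + 4)"
proof (rule minimisers[where W = "{(5, 1, m - 3)}"])
  let ?x = "real n ^ 2 + real n * real m - 5 * real n - 3 * real m + 4"
  show "2 \<le> m" "2 * m \<le> n" using assms by auto
  show "?x \<le> Kf_bound n k s q \<and> (Kf_bound n k s q = ?x \<longrightarrow> (k, s, q) \<in> {(5, 1, m - 3)})"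
    if "3 \<le> k" "1 \<le> s" "s \<le> k" "k + s \<le> n" "2 * m \<le> 2 * q + k + s" for k s q
    using Kf_bound_large[OF assms(1,2) that] by simp
  show "?x \<le> (real n ^ 3 - real n) / 12" using cube_bound[OF assms(1,3)] by simp
  show "winner n m (k, s, q) \<and> Kf_bound n k s q = ?x" if "(k, s, q) \<in> {(5, 1, m - 3)}" for k s q
    using that assms
    by (auto simp: winner_def extremal_shape_def Kf_bound_def pair_min_def near_sum_def max_def of_nat_diff
        field_simps power2_eq_square)
  have "n - 5 - 1 - 2 * (m - 3) = n - 2 * m" using assms by simp
  then show "{U_nm n m} = winner_graph n ` {(5, 1, m - 3)}
      \<union> (if n div 2 = m \<and> (real n ^ 3 - real n) / 12 = ?x then {cycle_graph n} else {})"
    using cube_bound[OF assms(1,3)] by (auto simp: winner_graph_def U_nm_def)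
qed simp

lemma minimisers_matching_two:
  assumes "15 \<le> n"
  shows "Kirchhoff_minimisers (unicyclic_graphs n 2 :: 'a graph set) {U 3 1 (n - 4) 0}
    (1 / 3 * (3 * real n ^ 2 - 8 * real n + 3))"
proof (rule minimisers[where W = "{(3, 1, 0)}"])
  let ?x = "1 / 3 * (3 * real n ^ 2 - 8 * real n + 3)"
  show "(2 :: nat) \<le> 2" "2 * 2 \<le> n" using assms by auto
  show "?x \<le> Kf_bound n k s q \<and> (Kf_bound n k s q = ?x \<longrightarrow> (k, s, q) \<in> {(3, 1, 0)})"
    if "3 \<le> k" "1 \<le> s" "s \<le> k" "(k + 1) div 2 \<le> 2" for k s q
    using Kf_bound_matching_two[OF assms that] by simp
  show "?x \<le> (real n ^ 3 - real n) / 12" if "n div 2 = 2" using that assms by simp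
  show "winner n 2 (k, s, q) \<and> Kf_bound n k s q = ?x" if "(k, s, q) \<in> {(3, 1, 0)}" for k s q
    using that assms
    by (auto simp: winner_def extremal_shape_def Kf_bound_def pair_min_def near_sum_def max_def
        field_simps power2_eq_square)
  show "{U 3 1 (n - 4) 0} = winner_graph n ` {(3, 1, 0)}
      \<union> (if n div 2 = 2 \<and> (real n ^ 3 - real n) / 12 = ?x then {cycle_graph n} else {})"
    using assms by (auto simp: winner_graph_def)
qed simp

lemma small_cases_minimisers:
  "list_all (\<lambda>(n, m, a, b, W). Kirchhoff_minimisers (unicyclic_graphs n m :: 'a graph set)
      (winner_graph n ` set W \<union>
        (if n div 2 = m \<and> (real n ^ 3 - real n) / 12 = of_int a / of_int b then {cycle_graph n} else {}))
      (of_int a / of_int b)) small_cases"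
  unfolding list_all_iff using minimisers_small by blast

theorem theorem3p2:
  fixes n m :: nat and \<U> :: "'a graph set"
  assumes "2 \<le> m" and "m \<le> n div 2"
    and "\<U> = unicyclic_graphs n m"
  shows
    "(m = 2 \<longrightarrow>
        (n \<in> {4, 5} \<longrightarrow> Kirchhoff_minimisers \<U> {cycle_graph n} ((real n ^ 3 - real n) / 12))
      \<and> (6 \<le> n \<and> n \<le> 11 \<longrightarrow>
           Kirchhoff_minimisers \<U> {U 4 1 (n - 5) 0} (1 / 2 * (2 * real n ^ 2 - 5 * real n - 2)))
      \<and> (n = 12 \<longrightarrow> Kirchhoff_minimisers \<U> {U 3 1 8 0, U 4 1 7 0} 113)
      \<and> (13 \<le> n \<longrightarrow>
           Kirchhoff_minimisers \<U> {U 3 1 (n - 4) 0} (1 / 3 * (3 * real n ^ 2 - 8 * real n + 3))))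
   \<and> (m = 3 \<longrightarrow>
        (n \<in> {6, 7} \<longrightarrow> Kirchhoff_minimisers \<U> {cycle_graph n} ((real n ^ 3 - real n) / 12))
      \<and> (8 \<le> n \<longrightarrow> Kirchhoff_minimisers \<U> {U_nm n 3} (real n ^ 2 - 2 * real n - 5)))
   \<and> (m = 4 \<longrightarrow>
        (n = 8 \<longrightarrow> Kirchhoff_minimisers \<U> {cycle_graph 8} 42)
      \<and> (n = 9 \<longrightarrow> Kirchhoff_minimisers \<U> {U 7 1 1 0, cycle_graph 9} 60)
      \<and> (n = 10 \<longrightarrow> Kirchhoff_minimisers \<U> {U 7 1 2 0} 79)
      \<and> (n = 11 \<longrightarrow> Kirchhoff_minimisers \<U> {U 6 2 3 0, U 7 1 3 0} 100)
      \<and> (n \<in> {12, 13} \<longrightarrow>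
           Kirchhoff_minimisers \<U> {U 6 2 (n - 8) 0} (1 / 3 * (3 * real n ^ 2 - real n - 52)))
      \<and> (n = 14 \<longrightarrow> Kirchhoff_minimisers \<U> {U_nm 14 4, U 6 2 6 0} 174)
      \<and> (15 \<le> n \<longrightarrow> Kirchhoff_minimisers \<U> {U_nm n 4} (real n ^ 2 - real n - 8)))
   \<and> (m = 5 \<longrightarrow>
        (n = 10 \<longrightarrow> Kirchhoff_minimisers \<U> {U 8 2 0 0} (81 + 7 / 8))
      \<and> (11 \<le> n \<and> n \<le> 13 \<longrightarrow>
           Kirchhoff_minimisers \<U> {U 7 3 (n - 10) 0} (1 / 7 * (7 * real n ^ 2 + 12 * real n - 245)))
      \<and> (n = 14 \<longrightarrow> Kirchhoff_minimisers \<U> {U_nm 14 5, U 6 2 4 1, U 7 3 4 0} 185)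
      \<and> (15 \<le> n \<longrightarrow> Kirchhoff_minimisers \<U> {U_nm n 5} (real n ^ 2 - 11)))
   \<and> (m = 6 \<longrightarrow>
        (n \<in> {12, 13} \<longrightarrow>
           Kirchhoff_minimisers \<U> {U 8 4 (n - 12) 0} (1 / 4 * (4 * real n ^ 2 + 19 * real n - 262)))
      \<and> (n = 14 \<longrightarrow> Kirchhoff_minimisers \<U> {U_nm 14 6, U 6 2 2 2, U 7 3 2 1} 196)
      \<and> (15 \<le> n \<longrightarrow> Kirchhoff_minimisers \<U> {U_nm n 6} (real n ^ 2 + real n - 14)))
   \<and> (m = 7 \<longrightarrow>
        (n = 14 \<longrightarrow> Kirchhoff_minimisers \<U> {U 7 7 0 0} 203)
      \<and> (15 \<le> n \<longrightarrow> Kirchhoff_minimisers \<U> {U_nm n 7} (real n ^ 2 + 2 * real n - 17)))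
   \<and> (8 \<le> m \<and> 16 \<le> n \<longrightarrow>
        Kirchhoff_minimisers \<U> {U_nm n m}
          (real n ^ 2 + real n * real m - 5 * real n - 3 * real m + 4))"
proof -
  note small = small_cases_minimisers[where 'a = 'a, unfolded small_cases_def, simplified list.pred_inject prod.case]
  have n: "2 * m \<le> n" using assms(2) by linarith
  show ?thesis
  proof (cases "15 \<le> n")
    case True
    have "m = 2 \<or> 3 \<le> m" using assms(1) by arith
    then show ?thesis
    proof
      assume "m = 2"
      then show ?thesis using minimisers_matching_two[OF True, where 'a = 'a] True assms(3) by simp
    next
      assume m: "3 \<le> m"
      note large = minimisers_large[OF True m n, where 'a = 'a]
      show ?thesis using m True large unfolding assms(3) by (auto simp: algebra_simps)
    qed
  next
    case False
    then have small_n: "n = 4 \<or> n = 5 \<or> n = 6 \<or> n = 7 \<or> n = 8 \<or> n = 9 \<or> n = 10 \<or> n = 11 \<or> n = 12 \<or> n = 13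
        \<or> n = 14"
      using assms(1) n by presburger
    have small_m: "m = 2 \<or> m = 3 \<or> m = 4 \<or> m = 5 \<or> m = 6 \<or> m = 7" using n False assms(1) by presburger
    show ?thesis
      using small small_n small_m n unfolding assms(3)
      by (elim disjE) (simp_all add: winner_graph_def U_nm_def insert_commute)
  qed
qed

end
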